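(* Let $x^n(\cdot)$ be the occupancy process of the $n$-server system under the PULL routing algorithm, as described in the context, with all standing assumptions there, including $\lambda<\sum_{j}\beta_j\mu_j$. Then for all sufficiently large $n$ the Markov process $x^n(\cdot)$ is ergodic (and then has a unique stationary distribution), and, denoting by $x^n(\infty)$ a random element of $\mathcal{X}$ distributed according to this stationary distribution, $$x^n(\infty)\Rightarrow x^*\qquad\text{as } n\to\infty,$$ where $\Rightarrow$ denotes convergence in distribution of random elements of $\mathcal{X}$ and $x^*\in\mathcal{X}$ is the (deterministic) equilibrium point.
   Context: Model. Let $J\ge 1$, $\mathcal{J}=\{1,\dots,J\}$. Fix positive constants $\lambda$, $\beta_j$, $\mu_j$ ($j\in\mathcal{J}$) with $\sum_j\beta_j=1$, and buffer sizes $B_j\in\{1,2,\dots\}\cup\{\infty\}$. Standing assumption (subcritical load): $\lambda<\sum_j\beta_j\mu_j$. The scaling parameter $n$ is the total number of servers; $n$ ranges over positive integers for which all $\beta_jn$ are integers. In the $n$-th system there are $J$ server pools, pool $j$ consisting of $\beta_jn$ identical servers; $\mathcal{N}_j$ is the set of servers in pool $j$ and $\mathcal{N}=\cup_j\mathcal{N}_j$. Customers arrive according to a Poisson process of rate $\lambda n$. Each arriving customer is immediately routed to one server. Service times are independent of each other and of the arrivals, exponentially distributed with mean $1/\mu_j$ at servers of pool $j$. Each server serves one customer at a time, first-come-first-serve. A customer routed to a server in pool $j$ joins the queue there, unless $B_j<\infty$ and the queue length (including the customer in service) equals $B_j$, in which case the customer is lost. PULL algorithm. If at a customer arrival there are idle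 servers (servers with queue length zero) in the system, the customer is routed to an idle server chosen uniformly at random among all idle servers; if there are no idle servers, the customer is routed to a server chosen uniformly at random among all $n$ servers. State. $Q^n_i(t)\in\mathbb{Z}_+$ (where $\mathbb{Z}_+=\{0,1,2,\dots\}$) is the queue length at server $i$ at time $t$. For $k\in\mathbb{Z}_+$, $j\in\mathcal{J}$, $x^n_{k,j}(t)=\frac1n\,\#\{i\in\mathcal{N}_j: Q_i^n(t)\ge k\}$, and $x^n(t)=(x^n_{k,j}(t))_{k,j}$. This is a continuous-time, irreducible, countable-state Markov process whose states are regarded as elements of $$\mathcal{X}=\{x=(x_{k,j},\,k\in\mathbb{Z}_+,\,j\in\mathcal{J}):\ \beta_j=x_{0,j}\ge x_{1,j}\ge x_{2,j}\ge\cdots\ge 0\},$$ equipped with the metric $\rho(x,x')=\sum_j\sum_k2^{-k}\frac{|x_{k,j}-x'_{k,j}|}{1+|x_{k,j}-x'_{k,j}|}$ (which makes $\mathcal{X}$ compact) and the Borel $\sigma$-algebra. Ergodic means positive recurrent. Equilibrium point. The numbers $\nu_j\in(0,\beta_j)$, $j\in\mathcal{J}$, are uniquely determined by $\lambda=\sum_j\nu_j\mu_j$ and $\frac{\nu_j\mu_j}{\beta_j-\nu_j}=\frac{\nu_\ell\mu_\ell}{\beta_\ell-\nu_\ell}$ for all $j,\ell\in\mathcal{J}$. The point $x^*\in\mathcal{X}$ is given by $x^*_{0,j}=\beta_j$, $x^*_{1,j}=\nu_j$, $x^*_{k,j}=0$ for $k\ge2$, $j\in\mathcal{J}$. *)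

theory Defs
  imports "HOL-Probability.Probability"
begin

section \<open>Markov jump processes with given transition rates\<close>

text \<open>
  A family of rates \<^term>\<open>R s s' \<ge> 0\<close> (\<^term>\<open>s \<noteq> s'\<close>) determines the jump chain / holding time
  construction below. Diagonal values of \<^term>\<open>R\<close> are ignored. The state space is given the
  discrete sigma-algebra.
\<close>

definition exit_rate :: "('s \<Rightarrow> 's \<Rightarrow> real) \<Rightarrow> 's \<Rightarrow> real" where
  "exit_rate R s = (\<Sum>\<^sub>\<infinity>s'\<in>-{s}. R s s')"

definition jump_pmf :: "('s \<Rightarrow> 's \<Rightarrow> real) \<Rightarrow> 's \<Rightarrow> 's pmf" where
  "jump_pmf R s =
     (if exit_rate R s > 0 then embed_pmf (\<lambda>s'. if s' = s then 0 else R s s' / exit_rate R s)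
      else return_pmf s)"

text \<open>
  An absorbing state is left only formally: its holding times are given rate 1 and all jumps lead
  back to the state itself, so the process stays there.
\<close>

definition hold_rate :: "('s \<Rightarrow> 's \<Rightarrow> real) \<Rightarrow> 's \<Rightarrow> real" where
  "hold_rate R s = (if exit_rate R s > 0 then exit_rate R s else 1)"

abbreviation stay_space :: "('s \<times> real) measure" where
  "stay_space \<equiv> count_space UNIV \<Otimes>\<^sub>M borel"

definition stay_law :: "('s \<Rightarrow> 's \<Rightarrow> real) \<Rightarrow> 's pmf \<Rightarrow> ('s \<times> real) measure" where
  "stay_law R p =
     measure_pmf p \<bind>
       (\<lambda>s. distr (density lborel (exponential_density (hold_rate R s))) stay_space (Pair s))"

definition jump_kernel ::
    "('s \<Rightarrow> 's \<Rightarrow> real) \<Rightarrow> 's pmf \<Rightarrow> nat \<Rightarrow> (nat \<Rightarrow> 's \<times> real) \<Rightarrow> ('s \<times> real) measure" where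
  "jump_kernel R init m \<omega> =
     stay_law R (case m of 0 \<Rightarrow> init | Suc k \<Rightarrow> jump_pmf R (fst (\<omega> k)))"

text \<open>
  The law of the sequence of (visited state, holding time), with initial distribution
  \<^term>\<open>init\<close>: the Ionescu-Tulcea product of the kernels above. The two constants are those of the
  locale \<^locale>\<open>Ionescu_Tulcea\<close>, whose assumptions are verified below.
\<close>

definition path_law :: "('s \<Rightarrow> 's \<Rightarrow> real) \<Rightarrow> 's pmf \<Rightarrow> (nat \<Rightarrow> 's \<times> real) measure" where
  "path_law R init =
     projective_family.lim UNIV
       (Ionescu_Tulcea.CI (jump_kernel R init) (\<lambda>_. stay_space)) (\<lambda>_. stay_space)"

definition state_at :: "(nat \<Rightarrow> 's \<times> real) \<Rightarrow> real \<Rightarrow> 's" where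
  "state_at \<omega> t = fst (\<omega> (LEAST m. t < (\<Sum>k\<le>m. snd (\<omega> k))))"

lemma hold_rate_pos: "hold_rate R s > 0"
  by (simp add: hold_rate_def)

lemma stay_law_prob_algebra: "stay_law R p \<in> space (prob_algebra stay_space)"
proof -
  have "distr (density lborel (exponential_density (hold_rate R s))) stay_space (Pair s)
          \<in> space (prob_algebra stay_space)" for s
    by (auto simp: space_prob_algebra
             intro!: prob_space.prob_space_distr prob_space_exponential_density hold_rate_pos)
  then have *: "(\<lambda>s. distr (density lborel (exponential_density (hold_rate R s))) stay_space (Pair s))
          \<in> measure_pmf p \<rightarrow>\<^sub>M prob_algebra stay_space"
    by (simp add: measurable_def)
  have p: "measure_pmf p \<in> space (prob_algebra (measure_pmf p))"
    by (simp add: space_prob_algebra measure_pmf.prob_space_axioms)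
  show ?thesis
    unfolding stay_law_def space_prob_algebra
    using prob_space_bind'[OF p *] sets_bind'[OF p *] by simp
qed

lemma jump_kernel_Ionescu_Tulcea: "Ionescu_Tulcea (jump_kernel R init) (\<lambda>_. stay_space)"
proof (rule Ionescu_Tulcea.intro)
  fix i
  show "jump_kernel R init i \<in> Pi\<^sub>M {0..<i} (\<lambda>_. stay_space) \<rightarrow>\<^sub>M subprob_algebra stay_space"
  proof (cases i)
    case 0
    have "stay_law R init \<in> space (subprob_algebra stay_space)"
      using stay_law_prob_algebra[of R init] space_prob_algebra[of "stay_space"]
      by (auto simp: space_subprob_algebra prob_space_imp_subprob_space space_prob_algebra)
    then show ?thesis
      using 0 by (simp add: jump_kernel_def[abs_def])
  next
    case (Suc k)
    have "(\<lambda>s. stay_law R (jump_pmf R s)) \<in> count_space UNIV \<rightarrow>\<^sub>M subprob_algebra stay_space"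
      using stay_law_prob_algebra[of R]
      by (auto simp: space_subprob_algebra prob_space_imp_subprob_space space_prob_algebra)
    moreover have "(\<lambda>\<omega>. fst (\<omega> k)) \<in> Pi\<^sub>M {0..<i} (\<lambda>_. stay_space) \<rightarrow>\<^sub>M count_space UNIV"
      using Suc by (intro measurable_compose[OF measurable_component_singleton[of k] measurable_fst]) simp
    ultimately show ?thesis
      using Suc unfolding jump_kernel_def[abs_def]
      by (auto simp del: measurable_count_space_eq1 intro: measurable_compose[rotated])
  qed
next
  show "prob_space (jump_kernel R init i \<omega>)"
    if "\<omega> \<in> space (Pi\<^sub>M {0..<i} (\<lambda>_. stay_space))" for i \<omega>
    using stay_law_prob_algebra[of R] by (auto simp: jump_kernel_def space_prob_algebra)
qed

lemma sets_path_law: "sets (path_law R init) = sets (Pi\<^sub>M UNIV (\<lambda>_. stay_space))"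
proof -
  interpret Ionescu_Tulcea "jump_kernel R init" "\<lambda>_. stay_space"
    by (rule jump_kernel_Ionescu_Tulcea)
  show ?thesis
    by (simp add: path_law_def)
qed

lemma prob_space_path_law: "prob_space (path_law R init)"
proof -
  interpret Ionescu_Tulcea "jump_kernel R init" "\<lambda>_. stay_space"
    by (rule jump_kernel_Ionescu_Tulcea)
  have "distr PF.lim (Pi\<^sub>M {} (\<lambda>_. stay_space)) (\<lambda>x. restrict x {}) = CI {}"
    by (rule distr_lim) simp
  moreover have "prob_space (CI {})"
    by (rule PF.prob_space_P) simp_all
  ultimately have "prob_space (distr PF.lim (Pi\<^sub>M {} (\<lambda>_. stay_space)) (\<lambda>x. restrict x {}))"
    by simp
  then have "prob_space PF.lim"
    by (rule prob_space_distrD[rotated])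
       (auto simp: measurable_cong_sets[OF PF.sets_lim refl] intro!: measurable_restrict)
  then show ?thesis
    by (simp add: path_law_def)
qed

lemma measurable_state_at: "(\<lambda>\<omega>. state_at \<omega> t) \<in> path_law R init \<rightarrow>\<^sub>M count_space UNIV"
proof -
  have [measurable]: "(\<lambda>\<omega>. snd (\<omega> k)) \<in> borel_measurable (path_law R init)"
    "(\<lambda>\<omega>. fst (\<omega> k)) \<in> path_law R init \<rightarrow>\<^sub>M count_space UNIV" for k :: nat
    unfolding measurable_cong_sets[OF sets_path_law refl] 
    by (auto intro!: measurable_compose[OF measurable_component_singleton])
  show ?thesis
    unfolding state_at_def by (rule measurable_compose_countable) measurable
qed

section \<open>The PULL system\<close>

text \<open>
  Pools are the elements of a finite type \<^typ>\<open>'p\<close>; server \<^term>\<open>(j, i)\<close> is the \<^term>\<open>i\<close>-th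
  server of pool \<^term>\<open>j\<close>. The admissible system sizes are those for which every
  \<^term>\<open>\<beta> j * real n\<close> is an integer, so that the floor below is exact.
\<close>

type_synonym 'p config = "'p \<times> nat \<Rightarrow> nat"

definition sizes :: "('p::finite \<Rightarrow> real) \<Rightarrow> nat set" where
  "sizes \<beta> = {n. n > 0 \<and> (\<forall>j. \<beta> j * real n \<in> \<int>)}"

definition pool_size :: "('p::finite \<Rightarrow> real) \<Rightarrow> nat \<Rightarrow> 'p \<Rightarrow> nat" where
  "pool_size \<beta> n j = nat \<lfloor>\<beta> j * real n\<rfloor>"

definition servers :: "('p::finite \<Rightarrow> real) \<Rightarrow> nat \<Rightarrow> ('p \<times> nat) set" where
  "servers \<beta> n = (SIGMA j:UNIV. {..<pool_size \<beta> n j})"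

definition idle :: "('p::finite \<Rightarrow> real) \<Rightarrow> nat \<Rightarrow> 'p config \<Rightarrow> ('p \<times> nat) set" where
  "idle \<beta> n q = {s \<in> servers \<beta> n. q s = 0}"

definition route :: "('p::finite \<Rightarrow> real) \<Rightarrow> nat \<Rightarrow> 'p config \<Rightarrow> ('p \<times> nat) pmf" where
  "route \<beta> n q = pmf_of_set (if idle \<beta> n q \<noteq> {} then idle \<beta> n q else servers \<beta> n)"

definition join :: "('p \<Rightarrow> enat) \<Rightarrow> 'p config \<Rightarrow> 'p \<times> nat \<Rightarrow> 'p config" where
  "join B q s = (if enat (q s) = B (fst s) then q else q(s := q s + 1))"

text \<open>
  Transition rates of the vector of queue lengths: arrivals occur at rate \<^term>\<open>lam * real n\<close>, and
  each busy server of pool \<^term>\<open>j\<close> completes a service at rate \<^term>\<open>\<mu> j\<close>. A lost customer only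
  contributes to the diagonal.
\<close>

definition pull_rate ::
    "real \<Rightarrow> ('p::finite \<Rightarrow> real) \<Rightarrow> ('p \<Rightarrow> real) \<Rightarrow> ('p \<Rightarrow> enat) \<Rightarrow> nat
      \<Rightarrow> 'p config \<Rightarrow> 'p config \<Rightarrow> real" where
  "pull_rate lam \<beta> \<mu> B n q q' =
     lam * real n * pmf (map_pmf (join B q) (route \<beta> n q)) q'
     + (\<Sum>s\<in>servers \<beta> n. (if q s > 0 \<and> q' = q(s := q s - 1) then \<mu> (fst s) else 0))"

definition configs ::
    "('p::finite \<Rightarrow> real) \<Rightarrow> ('p \<Rightarrow> enat) \<Rightarrow> nat \<Rightarrow> 'p config set" where
  "configs \<beta> B n =
     {q. (\<forall>s\<in>servers \<beta> n. enat (q s) \<le> B (fst s)) \<and> (\<forall>s. s \<notin> servers \<beta> n \<longrightarrow> q s = 0)}"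

section \<open>The occupancy process\<close>

type_synonym 'p occ = "nat \<Rightarrow> 'p \<Rightarrow> real"

definition occ_space :: "('p::finite \<Rightarrow> real) \<Rightarrow> 'p occ set" where
  "occ_space \<beta> = {x. \<forall>j. x 0 j = \<beta> j \<and> (\<forall>k. x (Suc k) j \<le> x k j \<and> 0 \<le> x k j)}"

definition occ_dist :: "'p::finite occ \<Rightarrow> 'p occ \<Rightarrow> real" where
  "occ_dist x y =
     (\<Sum>j\<in>UNIV. \<Sum>k. (1/2) ^ k * (\<bar>x k j - y k j\<bar> / (1 + \<bar>x k j - y k j\<bar>)))"

abbreviation occ_top :: "('p::finite \<Rightarrow> real) \<Rightarrow> 'p occ topology" where
  "occ_top \<beta> \<equiv> Metric_space.mtopology (occ_space \<beta>) occ_dist"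

definition occ_borel :: "('p::finite \<Rightarrow> real) \<Rightarrow> 'p occ measure" where
  "occ_borel \<beta> = sigma (occ_space \<beta>) {U. openin (occ_top \<beta>) U}"

definition occupancy :: "('p::finite \<Rightarrow> real) \<Rightarrow> nat \<Rightarrow> 'p config \<Rightarrow> 'p occ" where
  "occupancy \<beta> n q = (\<lambda>k j. real (card {i. i < pool_size \<beta> n j \<and> k \<le> q (j, i)}) / real n)"

definition occ_path ::
    "('p::finite \<Rightarrow> real) \<Rightarrow> nat \<Rightarrow> (nat \<Rightarrow> 'p config \<times> real) \<Rightarrow> real \<Rightarrow> 'p occ" where
  "occ_path \<beta> n \<omega> t = occupancy \<beta> n (state_at \<omega> t)"

text \<open>The first time a path is in \<^term>\<open>x\<close> after having been elsewhere.\<close>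

definition return_time :: "(real \<Rightarrow> 'a) \<Rightarrow> 'a \<Rightarrow> ennreal" where
  "return_time X x = Inf {ennreal t | t. X t = x \<and> (\<exists>s. 0 \<le> s \<and> s < t \<and> X s \<noteq> x)}"

text \<open>
  Positive recurrence of the occupancy process: every state \<^term>\<open>x = occupancy \<beta> n q\<close> has finite
  mean return time. Servers of one pool are exchangeable, so the law of the occupancy process
  depends on the initial queue lengths only through their occupancy; here finiteness is asked for
  every configuration with occupancy \<^term>\<open>x\<close>.
\<close>

definition pull_ergodic ::
    "real \<Rightarrow> ('p::finite \<Rightarrow> real) \<Rightarrow> ('p \<Rightarrow> real) \<Rightarrow> ('p \<Rightarrow> enat) \<Rightarrow> nat \<Rightarrow> bool" where
  "pull_ergodic lam \<beta> \<mu> B n \<longleftrightarrow>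
     (\<forall>q\<in>configs \<beta> B n.
        (\<integral>\<^sup>+\<omega>. return_time (occ_path \<beta> n \<omega>) (occupancy \<beta> n q)
           \<partial>path_law (pull_rate lam \<beta> \<mu> B n) (return_pmf q)) < \<infinity>)"

text \<open>
  \<^term>\<open>\<pi>\<close> is stationary if the system can be started so that the occupancy has law \<^term>\<open>\<pi>\<close> at
  all times. Any law on the occupancy states of the \<^term>\<open>n\<close>-server system is the occupancy law
  of some \<^term>\<open>init\<close>, and by exchangeability it does not matter which such \<^term>\<open>init\<close> is taken.
\<close>

definition pull_stationary ::
    "real \<Rightarrow> ('p::finite \<Rightarrow> real) \<Rightarrow> ('p \<Rightarrow> real) \<Rightarrow> ('p \<Rightarrow> enat) \<Rightarrow> nat \<Rightarrow> 'p occ measure \<Rightarrow> bool" where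
  "pull_stationary lam \<beta> \<mu> B n \<pi> \<longleftrightarrow>
     (\<exists>init. set_pmf init \<subseteq> configs \<beta> B n \<and>
        (\<forall>t\<ge>0. distr (path_law (pull_rate lam \<beta> \<mu> B n) init) (occ_borel \<beta>)
                  (\<lambda>\<omega>. occ_path \<beta> n \<omega> t) = \<pi>))"

definition stationary_law ::
    "real \<Rightarrow> ('p::finite \<Rightarrow> real) \<Rightarrow> ('p \<Rightarrow> real) \<Rightarrow> ('p \<Rightarrow> enat) \<Rightarrow> nat \<Rightarrow> 'p occ measure" where
  "stationary_law lam \<beta> \<mu> B n = (THE \<pi>. pull_stationary lam \<beta> \<mu> B n \<pi>)"

section \<open>Equilibrium point and convergence in distribution\<close>

definition equilibrium ::
    "real \<Rightarrow> ('p::finite \<Rightarrow> real) \<Rightarrow> ('p \<Rightarrow> real) \<Rightarrow> ('p \<Rightarrow> real) \<Rightarrow> bool" where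
  "equilibrium lam \<beta> \<mu> \<nu> \<longleftrightarrow>
     (\<forall>j. 0 < \<nu> j \<and> \<nu> j < \<beta> j) \<and> lam = (\<Sum>j\<in>UNIV. \<nu> j * \<mu> j) \<and>
     (\<forall>j l. \<nu> j * \<mu> j / (\<beta> j - \<nu> j) = \<nu> l * \<mu> l / (\<beta> l - \<nu> l))"

definition x_star :: "real \<Rightarrow> ('p::finite \<Rightarrow> real) \<Rightarrow> ('p \<Rightarrow> real) \<Rightarrow> 'p occ" where
  "x_star lam \<beta> \<mu> =
     (\<lambda>k j. if k = 0 then \<beta> j else if k = 1 then (THE \<nu>. equilibrium lam \<beta> \<mu> \<nu>) j else 0)"

definition weakly_converges ::
    "'a topology \<Rightarrow> ('i \<Rightarrow> 'a measure) \<Rightarrow> 'a measure \<Rightarrow> 'i filter \<Rightarrow> bool" where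
  "weakly_converges T P Q F \<longleftrightarrow>
     (\<forall>f. continuous_map T euclideanreal f \<and> bounded (f ` topspace T) \<longrightarrow>
        ((\<lambda>n. \<integral>x. f x \<partial>P n) \<longlongrightarrow> (\<integral>x. f x \<partial>Q)) F)"

section \<open>Basic facts\<close>

lemma pool_size_eq:
  assumes "n \<in> sizes \<beta>" "\<beta> j > 0"
  shows "real (pool_size \<beta> n j) = \<beta> j * real n" "pool_size \<beta> n j > 0"
proof -
  obtain z where z: "\<beta> j * real n = of_int z"
    using assms by (auto simp: sizes_def Ints_def)
  moreover have "\<beta> j * real n > 0"
    using assms by (simp add: sizes_def)
  ultimately show "real (pool_size \<beta> n j) = \<beta> j * real n" "pool_size \<beta> n j > 0"
    by (simp_all add: pool_size_def)
qed

lemma finite_servers [simp]: "finite (servers \<beta> n)"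
  by (simp add: servers_def)

lemma servers_nonempty:
  assumes "n \<in> sizes \<beta>" "\<And>j. \<beta> j > 0"
  shows "servers \<beta> n \<noteq> {}"
  using pool_size_eq(2)[OF assms] by (force simp: servers_def)

lemma card_servers:
  assumes "n \<in> sizes \<beta>" "\<And>j. \<beta> j > 0" "(\<Sum>j\<in>UNIV. \<beta> j) = 1"
  shows "card (servers \<beta> n) = n"
proof -
  have "real (card (servers \<beta> n)) = (\<Sum>j\<in>UNIV. \<beta> j * real n)"
    using pool_size_eq(1)[OF assms(1,2)] by (simp add: servers_def)
  also have "\<dots> = real n"
    using assms(3) by (simp add: sum_distrib_right[symmetric])
  finally show ?thesis
    by simp
qed

lemma jump_pmf_eq:
  assumes "\<And>s'. R s s' \<ge> 0" "finite {s'. R s s' \<noteq> 0}" "exit_rate R s > 0"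
  shows "pmf (jump_pmf R s) s' = (if s' = s then 0 else R s s' / exit_rate R s)"
proof -
  let ?f = "\<lambda>s'. if s' = s then 0 else R s s' / exit_rate R s"
  let ?A = "{s'. R s s' \<noteq> 0} - {s}"
  have "exit_rate R s = infsum (R s) ?A"
    unfolding exit_rate_def by (rule infsum_cong_neutral) auto
  then have e: "exit_rate R s = sum (R s) ?A"
    using assms(2) by simp
  have "(\<integral>\<^sup>+s'. ennreal (?f s') \<partial>count_space UNIV) = (\<Sum>s'\<in>?A. ennreal (?f s'))"
    using assms(2) by (intro nn_integral_count_space') auto
  also have "\<dots> = ennreal (\<Sum>s'\<in>?A. ?f s')"
    using assms by (intro sum_ennreal) auto
  also have "(\<Sum>s'\<in>?A. ?f s') = (\<Sum>s'\<in>?A. R s s' / exit_rate R s)"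
    by (intro sum.cong) auto
  also have "\<dots> = 1"
    using assms(3) e by (simp add: sum_divide_distrib[symmetric])
  finally have "(\<integral>\<^sup>+s'. ennreal (?f s') \<partial>count_space UNIV) = 1"
    by simp
  then show ?thesis
    unfolding jump_pmf_def using assms(1,3) by (simp add: pmf_embed_pmf)
qed

lemma set_route:
  assumes "n \<in> sizes \<beta>" "\<And>j. \<beta> j > 0"
  shows "set_pmf (route \<beta> n q) = (if idle \<beta> n q \<noteq> {} then idle \<beta> n q else servers \<beta> n)"
proof -
  have "finite (idle \<beta> n q)"
    by (simp add: idle_def)
  then show ?thesis
    using servers_nonempty[OF assms] by (simp add: route_def set_pmf_of_set)
qed

lemma pull_rate_nonneg:
  "lam > 0 \<Longrightarrow> (\<And>j. \<mu> j > 0) \<Longrightarrow> pull_rate lam \<beta> \<mu> B n q q' \<ge> 0"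
  by (auto simp: pull_rate_def less_imp_le intro!: add_nonneg_nonneg sum_nonneg)

lemma finite_pull_rate:
  assumes "n \<in> sizes \<beta>" "\<And>j. \<beta> j > 0"
  shows "finite {q'. pull_rate lam \<beta> \<mu> B n q q' \<noteq> 0}"
proof (rule finite_subset)
  let ?A = "join B q ` servers \<beta> n \<union> (\<lambda>s. q(s := q s - 1)) ` servers \<beta> n"
  show "finite ?A"
    by simp
  show "{q'. pull_rate lam \<beta> \<mu> B n q q' \<noteq> 0} \<subseteq> ?A"
  proof (intro subsetI, rule ccontr)
    fix q' assume q': "q' \<in> {q'. pull_rate lam \<beta> \<mu> B n q q' \<noteq> 0}" "q' \<notin> ?A"
    have "set_pmf (route \<beta> n q) \<subseteq> servers \<beta> n"
      by (auto simp: set_route[OF assms] idle_def)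
    then have "q' \<notin> set_pmf (map_pmf (join B q) (route \<beta> n q))"
      using q'(2) by auto
    then have "pmf (map_pmf (join B q) (route \<beta> n q)) q' = 0"
      by (rule pmf_eq_0_set_pmf[THEN iffD2])
    moreover have "(\<Sum>s\<in>servers \<beta> n. (if q s > 0 \<and> q' = q(s := q s - 1) then \<mu> (fst s) else 0)) = 0"
      using q'(2) by (intro sum.neutral) auto
    ultimately show False
      using q'(1) by (simp add: pull_rate_def)
  qed
qed

lemma exit_rate_pull_pos:
  assumes "n \<in> sizes \<beta>" "\<And>j. \<beta> j > 0" "lam > 0" "\<And>j. \<mu> j > 0" "\<And>j. B j \<ge> 1"
  shows "exit_rate (pull_rate lam \<beta> \<mu> B n) q > 0"
proof -
  let ?R = "pull_rate lam \<beta> \<mu> B n q"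
  let ?A = "{q'. ?R q' \<noteq> 0} - {q}"
  have "n > 0"
    using assms(1) by (simp add: sizes_def)
  have "exit_rate (pull_rate lam \<beta> \<mu> B n) q = infsum ?R ?A"
    unfolding exit_rate_def by (rule infsum_cong_neutral) auto
  also have "\<dots> = sum ?R ?A"
    using finite_pull_rate[OF assms(1,2)] by simp
  finally have e: "exit_rate (pull_rate lam \<beta> \<mu> B n) q = sum ?R ?A" .
  have "\<exists>q'. q' \<noteq> q \<and> ?R q' > 0"
  proof (cases "idle \<beta> n q = {}")
    case True
    obtain s where s: "s \<in> servers \<beta> n"
      using servers_nonempty[OF assms(1,2)] by auto
    then have "q s > 0"
      using True by (cases s) (auto simp: idle_def)
    let ?q' = "q(s := q s - 1)"
    have "0 < (\<Sum>s\<in>servers \<beta> n. (if q s > 0 \<and> ?q' = q(s := q s - 1) then \<mu> (fst s) else 0))"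
      using s \<open>q s > 0\<close> assms(4) by (intro sum_pos2[of _ s]) (auto simp: less_imp_le)
    then have "?R ?q' > 0"
      using assms(3) by (auto simp: pull_rate_def intro!: add_nonneg_pos)
    moreover have "?q' \<noteq> q"
      using \<open>q s > 0\<close> by (auto dest: fun_cong[of _ _ s])
    ultimately show ?thesis
      by blast
  next
    case False
    then obtain s where s: "s \<in> idle \<beta> n q"
      by auto
    have "B (fst s) \<noteq> 0"
      using assms(5)[of "fst s"] by auto
    then have j: "join B q s = q(s := 1)" "q(s := 1) \<noteq> q"
      using s by (auto simp: join_def idle_def zero_enat_def dest: fun_cong[of _ _ s])
    have "q(s := 1) \<in> set_pmf (map_pmf (join B q) (route \<beta> n q))"
      using s j(1) by (force simp: set_route[OF assms(1,2)])
    then have "pmf (map_pmf (join B q) (route \<beta> n q)) (q(s := 1)) > 0"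
      by (simp add: pmf_positive)
    then have "?R (q(s := 1)) > 0"
      using assms(3,4) \<open>n > 0\<close>
      by (auto simp: pull_rate_def less_imp_le intro!: add_pos_nonneg sum_nonneg)
    then show ?thesis
      using j(2) by blast
  qed
  then obtain q' where "q' \<noteq> q" "?R q' > 0"
    by blast
  then show ?thesis
    unfolding e using finite_pull_rate[OF assms(1,2)] pull_rate_nonneg[where \<mu> = \<mu>, OF assms(3,4)]
    by (intro sum_pos2[of _ q']) auto
qed

lemma occupancy_in_occ_space:
  assumes "n \<in> sizes \<beta>" "\<And>j. \<beta> j > 0"
  shows "occupancy \<beta> n q \<in> occ_space \<beta>"
proof -
  have "n > 0"
    using assms by (simp add: sizes_def)
  then show ?thesis
    using pool_size_eq[OF assms]
    by (auto simp: occ_space_def occupancy_def intro!: divide_right_mono card_mono)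
qed

lemma occ_dist_summable:
  "summable (\<lambda>k. (1/2) ^ k * (\<bar>x k j - y k j\<bar> / (1 + \<bar>x k j - y k j\<bar>)) :: real)"
  by (rule summable_comparison_test'[where g = "\<lambda>k. (1/2) ^ k" and N = 0])
     (auto simp: abs_mult divide_le_eq intro!: summable_geometric mult_left_le)

lemma Metric_space_occ: "Metric_space (occ_space \<beta>) (occ_dist :: 'p::finite occ \<Rightarrow> _)"
proof
  fix x y :: "'p occ"
  show "0 \<le> occ_dist x y"
    unfolding occ_dist_def by (intro sum_nonneg suminf_nonneg occ_dist_summable) simp
  show "occ_dist x y = occ_dist y x"
    by (simp add: occ_dist_def abs_minus_commute)
  show "occ_dist x y = 0 \<longleftrightarrow> x = y"
  proof
    assume "occ_dist x y = 0"
    then have "(\<Sum>k. (1/2) ^ k * (\<bar>x k j - y k j\<bar> / (1 + \<bar>x k j - y k j\<bar>))) = 0" for j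
      unfolding occ_dist_def
      by (subst (asm) sum_nonneg_eq_0_iff)
         (auto intro!: suminf_nonneg occ_dist_summable simp del: times_divide_eq_right)
    then have "(1/2) ^ k * (\<bar>x k j - y k j\<bar> / (1 + \<bar>x k j - y k j\<bar>)) = 0" for j k
      by (subst (asm) suminf_eq_zero_iff)
         (auto intro!: occ_dist_summable simp del: times_divide_eq_right)
    then show "x = y"
      by (intro ext) (simp add: add_nonneg_eq_0_iff)
  qed (simp add: occ_dist_def)
next
  fix x y z :: "'p occ"
  have tri: "\<bar>a - c\<bar> / (1 + \<bar>a - c\<bar>) \<le> \<bar>a - b\<bar> / (1 + \<bar>a - b\<bar>) + \<bar>b - c\<bar> / (1 + \<bar>b - c\<bar>)"
    for a b c :: real
  proof -
    let ?u = "\<bar>a - b\<bar>" and ?v = "\<bar>b - c\<bar>"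
    have "\<bar>a - c\<bar> / (1 + \<bar>a - c\<bar>) \<le> (?u + ?v) / (1 + (?u + ?v))"
      by (auto simp: divide_simps algebra_simps)
    also have "\<dots> = ?u / (1 + (?u + ?v)) + ?v / (1 + (?u + ?v))"
      by (rule add_divide_distrib)
    also have "\<dots> \<le> ?u / (1 + ?u) + ?v / (1 + ?v)"
      by (intro add_mono divide_left_mono mult_pos_pos) auto
    finally show ?thesis .
  qed
  show "occ_dist x z \<le> occ_dist x y + occ_dist y z"
    unfolding occ_dist_def sum.distrib[symmetric]
    by (intro sum_mono, subst suminf_add[OF occ_dist_summable occ_dist_summable])
       (intro suminf_le occ_dist_summable summable_add, 
        simp add: distrib_left[symmetric] mult_left_mono tri del: times_divide_eq_right)
qed

lemma measurable_occ_path: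
  assumes "n \<in> sizes \<beta>" "\<And>j. \<beta> j > 0"
  shows "(\<lambda>\<omega>. occ_path \<beta> n \<omega> t) \<in> path_law R init \<rightarrow>\<^sub>M occ_borel \<beta>"
proof -
  have "space (occ_borel \<beta>) = occ_space \<beta>"
    by (simp add: occ_borel_def space_measure_of_conv)
  then have "occupancy \<beta> n \<in> count_space UNIV \<rightarrow>\<^sub>M occ_borel \<beta>"
    using occupancy_in_occ_space[OF assms] by auto
  then show ?thesis
    unfolding occ_path_def by (rule measurable_compose[OF measurable_state_at])
qed

lemma equilibrium_ex1:
  fixes \<beta> \<mu> :: "'p::finite \<Rightarrow> real"
  assumes "lam > 0" "\<And>j. \<beta> j > 0" "\<And>j. \<mu> j > 0" "lam < (\<Sum>j\<in>UNIV. \<beta> j * \<mu> j)"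
  shows "\<exists>!\<nu>. equilibrium lam \<beta> \<mu> \<nu>"
proof -
  define g where "g c j = \<beta> j * c / (\<mu> j + c)" for c j
  define G where "G c = (\<Sum>j\<in>UNIV. g c j * \<mu> j)" for c
  have pos: "\<mu> j + c > 0" if "c \<ge> 0" for c j
    using assms(3)[of j] that by linarith
  have g_less: "g c j < g d j" if "0 \<le> c" "c < d" for c d j
    using that pos[of c j] pos[of d j] assms(2)[of j] assms(3)[of j]
    by (simp add: g_def divide_simps algebra_simps)
  have G_less: "G c < G d" if "0 \<le> c" "c < d" for c d
    unfolding G_def using that assms(3) by (intro sum_strict_mono mult_strict_right_mono g_less) auto
  have "(G \<longlongrightarrow> (\<Sum>j\<in>UNIV. \<beta> j * \<mu> j)) at_top"
    unfolding G_def
  proof (intro tendsto_sum tendsto_mult tendsto_const)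
    fix j
    have "((\<lambda>c. \<beta> j - \<beta> j * \<mu> j / (\<mu> j + c)) \<longlongrightarrow> \<beta> j - 0) at_top"
      by (intro tendsto_diff tendsto_const tendsto_divide_0[OF tendsto_const]
            filterlim_at_top_imp_at_infinity filterlim_tendsto_add_at_top[OF tendsto_const]
            filterlim_ident)
    moreover have "\<forall>\<^sub>F c in at_top. \<beta> j - \<beta> j * \<mu> j / (\<mu> j + c) = g c j"
      using eventually_ge_at_top[of 0]
    proof eventually_elim
      case (elim c)
      then show ?case
        using pos[of c j] by (simp add: g_def field_simps)
    qed
    ultimately show "((\<lambda>c. g c j) \<longlongrightarrow> \<beta> j) at_top"
      by (simp add: tendsto_cong)
  qed
  then have "\<forall>\<^sub>F c in at_top. lam < G c \<and> c \<ge> 0"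
    using assms(4) by (intro eventually_conj order_tendstoD eventually_ge_at_top)
  then obtain d where d: "lam < G d" "d \<ge> 0"
    by (auto simp: eventually_at_top_linorder)
  have "continuous_on {0..d} G"
    unfolding G_def g_def using pos by (intro continuous_intros) (auto simp: less_imp_neq[symmetric])
  moreover have "G 0 \<le> lam"
    using assms(1) by (simp add: G_def g_def)
  ultimately obtain c where c: "0 \<le> c" "G c = lam"
    using IVT'[of G 0 lam d] d by auto
  have "c \<noteq> 0"
    using c assms(1) by (auto simp: G_def g_def)
  then have "c > 0"
    using c by simp
  have "equilibrium lam \<beta> \<mu> (g c)"
  proof -
    have "\<beta> j - g c j = \<beta> j * \<mu> j / (\<mu> j + c)" for j
      using pos[OF c(1), of j] by (simp add: g_def field_simps)
    then have "g c j * \<mu> j / (\<beta> j - g c j) = c" for j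
      using pos[OF c(1), of j] assms(2)[of j] assms(3)[of j] by (simp add: g_def)
    moreover have "0 < g c j \<and> g c j < \<beta> j" for j
      using pos[OF c(1), of j] assms(2)[of j] assms(3)[of j] \<open>c > 0\<close>
      by (simp add: g_def divide_simps)
    ultimately show ?thesis
      using c by (simp add: equilibrium_def G_def)
  qed
  moreover have "\<nu> = g c" if "equilibrium lam \<beta> \<mu> \<nu>" for \<nu>
  proof -
    define e where "e = \<nu> undefined * \<mu> undefined / (\<beta> undefined - \<nu> undefined)"
    have \<nu>: "0 < \<nu> j" "\<nu> j < \<beta> j" "\<nu> j * \<mu> j / (\<beta> j - \<nu> j) = e" for j
      using that unfolding equilibrium_def e_def by blast+
    have "e > 0"
      unfolding \<nu>(3)[of undefined, symmetric] using \<nu>(1,2)[of undefined] assms(3)[of undefined]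
      by simp
    have "\<nu> j = g e j" for j
    proof -
      have "\<nu> j * \<mu> j = e * (\<beta> j - \<nu> j)"
        using \<nu>[of j] by (auto simp: field_simps)
      then show ?thesis
        using pos[of e j] \<open>e > 0\<close> by (simp add: g_def field_simps)
    qed
    then have "\<nu> = g e"
      by auto
    moreover have "G e = lam"
      using that \<open>\<nu> = g e\<close> by (simp add: equilibrium_def G_def)
    ultimately show ?thesis
      using G_less[of c e] G_less[of e c] c \<open>e > 0\<close> by (cases c e rule: linorder_cases) auto
  qed
  ultimately show ?thesis
    by blast
qed

lemma x_star_in_occ_space:
  fixes \<beta> \<mu> :: "'p::finite \<Rightarrow> real"
  assumes "lam > 0" "\<And>j. \<beta> j > 0" "\<And>j. \<mu> j > 0" "lam < (\<Sum>j\<in>UNIV. \<beta> j * \<mu> j)"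
  shows "x_star lam \<beta> \<mu> \<in> occ_space \<beta>"
proof -
  define \<nu> where "\<nu> = (THE \<nu>. equilibrium lam \<beta> \<mu> \<nu>)"
  have "equilibrium lam \<beta> \<mu> \<nu>"
    unfolding \<nu>_def by (rule theI'[OF equilibrium_ex1[OF assms]])
  then have "0 < \<nu> j" "\<nu> j < \<beta> j" for j
    by (auto simp: equilibrium_def)
  then show ?thesis
    using assms(2) by (auto simp: occ_space_def x_star_def \<nu>_def[symmetric] less_imp_le)
qed

end

theory Submission
  imports Defs "HOL-Real_Asymp.Real_Asymp"
begin

text \<open>
  The transition probabilities solve the integrated Kolmogorov equation, so a distribution that
  annihilates the generator on bounded functions is stationary, and time averages of transition
  probabilities started in two configurations differ by \<open>O(1/T)\<close> times a Lyapunov function with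
  negative drift off the empty configuration. This gives existence (by excursions from the empty
  configuration) and uniqueness; positive recurrence is Kac's formula.

  For the limit no fluid analysis is needed. Let \<open>V\<close> be the number of customers waiting behind a
  customer in service, plus a sum of geometric weights \<open>\<theta>\<^sup>k\<close> over \<open>k\<close> from the number of idle servers
  up to a small fraction \<open>m\<close> of \<open>n\<close>. By subcriticality its drift is at most
  \<open>\<lambda> n \<theta>\<^sup>m\<close> minus a multiple of the number of servers with at least two customers, hence in
  equilibrium the mean of the latter number is exponentially small. The idle fractions \<open>u\<^sub>j\<close> then
  follow, up to \<open>O(1/n)\<close>, an equation for which \<open>\<Sum>\<^sub>j (u\<^sub>j - u\<^sup>*\<^sub>j)\<^sup>2 / u\<^sup>*\<^sub>j\<close>, with \<open>u\<^sup>*\<^sub>j = \<beta>\<^sub>j - \<nu>\<^sub>j\<close>, is a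
  Lyapunov function by the Cauchy-Schwarz inequality, so its equilibrium mean is \<open>O(1/n)\<close>.
\<close>

section \<open>Path laws of jump processes\<close>

text \<open>\<open>path_law\<close> comes with nothing but its one-step kernels; the Markov property
  at the first jump is obtained by comparing measures on cylinder sets. For fixed \<open>n\<close>
  all rates are bounded, even with infinite buffers: this excludes explosion and keeps the generator
  of a bounded function bounded. The obstacle is that the Lyapunov functions may be unbounded and
  their integrability under an invariant law is not known beforehand. Hence invariance is tested on
  bounded functions, and drift inequalities are integrated after truncation. Comparing time averages
  instead of transition probabilities turns uniqueness into a maximum principle. The limit takes two
  Lyapunov functions because the idle counts do not evolve autonomously: a departure from a server
  with two or more customers creates no idle server, so the drift of the quadratic function carries
  an error proportional to the number of such servers. The first function makes this error
  negligible. Its level \<open>m\<close> is a fraction of \<open>n\<close>, small enough to leave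
  spare service capacity and large enough for \<open>\<theta> ^ m\<close> to beat the factor
  \<open>n\<close>.\<close>

lemma kernel_stay_law [measurable]:
  "(\<lambda>s. stay_law R (jump_pmf R s)) \<in> count_space UNIV \<rightarrow>\<^sub>M subprob_algebra stay_space"
  using stay_law_prob_algebra[of R]
  by (auto simp: space_subprob_algebra prob_space_imp_subprob_space space_prob_algebra)

lemma sets_stay_law [measurable_cong, simp]: "sets (stay_law R p) = sets stay_space"
  using stay_law_prob_algebra[of R p] by (simp add: space_prob_algebra)

lemma prob_space_stay_law: "prob_space (stay_law R p)"
  using stay_law_prob_algebra[of R p] by (simp add: space_prob_algebra)

lemma space_stay_law [simp]: "space (stay_law R p) = UNIV"
  using sets_eq_imp_space_eq[OF sets_stay_law[of R p]] by (simp add: space_pair_measure)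

lemma nn_integral_stay_law:
  assumes [measurable]: "F \<in> borel_measurable stay_space"
  shows "(\<integral>\<^sup>+y. F y \<partial>stay_law R p) =
    (\<integral>\<^sup>+s. (\<integral>\<^sup>+x. ennreal (exponential_density (hold_rate R s) x) * F (s, x) \<partial>lborel) \<partial>measure_pmf p)"
proof -
  have k: "(\<lambda>s. distr (density lborel (exponential_density (hold_rate R s))) stay_space (Pair s))
          \<in> measure_pmf p \<rightarrow>\<^sub>M subprob_algebra stay_space"
    by (auto simp: space_subprob_algebra intro!: prob_space_imp_subprob_space
        prob_space.prob_space_distr prob_space_exponential_density hold_rate_pos)
  have "(\<integral>\<^sup>+y. F y \<partial>distr (density lborel (exponential_density (hold_rate R s))) stay_space (Pair s))
      = (\<integral>\<^sup>+x. ennreal (exponential_density (hold_rate R s) x) * F (s, x) \<partial>lborel)" for s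
    by (subst nn_integral_distr) (auto simp: nn_integral_density)
  then show ?thesis
    unfolding stay_law_def by (subst nn_integral_bind[OF assms k]) simp
qed

text \<open>Positive holding times make the jump times strictly increasing, on which
  \<open>state_at_jump_time\<close> relies.\<close>

lemma AE_stay_law_pos: "AE y in stay_law R p. 0 < snd y"
proof -
  have z: "(\<integral>\<^sup>+x. ennreal (exponential_density (hold_rate R s) x) *
     indicator {y \<in> space stay_space. \<not> 0 < snd y} (s, x) \<partial>lborel) = 0" for s
  proof -
    have "(\<integral>\<^sup>+x. ennreal (exponential_density (hold_rate R s) x) *
       indicator {y \<in> space stay_space. \<not> 0 < snd y} (s, x) \<partial>lborel) = (\<integral>\<^sup>+x. 0 \<partial>(lborel :: real measure))"
      using AE_lborel_singleton[of 0]
      by (intro nn_integral_cong_AE) (auto simp: exponential_density_def split: split_indicator)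
    then show ?thesis by simp
  qed
  have "emeasure (stay_law R p) {y \<in> space stay_space. \<not> 0 < snd y} =
     (\<integral>\<^sup>+y. indicator {y \<in> space stay_space. \<not> 0 < snd y} y \<partial>stay_law R p)"
    by (subst nn_integral_indicator) (simp_all, measurable)
  also have "\<dots> = 0"
    by (subst nn_integral_stay_law) (simp_all add: z)
  moreover have "{y \<in> space (stay_law R p). \<not> 0 < snd y} \<in> sets (stay_law R p)"
    by measurable
  ultimately show ?thesis
    by (subst AE_iff_measurable[OF _ refl]) (simp_all add: space_pair_measure)
qed

lemma space_path_law [simp]: "space (path_law R p) = UNIV"
  using sets_eq_imp_space_eq[OF sets_path_law[of R p]] by (simp add: space_PiM space_pair_measure)

lemma measurable_path_law_component:
  "(\<lambda>\<omega>. \<omega> i) \<in> path_law R p \<rightarrow>\<^sub>M stay_space"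
  unfolding measurable_cong_sets[OF sets_path_law refl] by (rule measurable_component_singleton) simp

text \<open>The marginal of the projective limit on the first \<open>m\<close> coordinates is the
  composition \<open>C 0 m\<close> of the kernels. Splitting off its last kernel integrates out
  coordinate \<open>n\<close> while the product of the earlier factors is frozen.\<close>

lemma nn_integral_path_law_step:
  assumes f[measurable]: "\<And>i. f i \<in> borel_measurable stay_space"
    and \<psi>[measurable]: "\<psi> \<in> borel_measurable stay_space"
  shows "(\<integral>\<^sup>+\<omega>. (\<Prod>i<n. f i (\<omega> i)) * \<psi> (\<omega> n) \<partial>path_law R p) =
    (\<integral>\<^sup>+\<omega>. (\<Prod>i<n. f i (\<omega> i)) * (\<integral>\<^sup>+y. \<psi> y \<partial>jump_kernel R p n \<omega>) \<partial>path_law R p)"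
proof -
  interpret Ionescu_Tulcea "jump_kernel R p" "\<lambda>_. stay_space"
    by (rule jump_kernel_Ionescu_Tulcea)
  let ?M = "\<lambda>n. Pi\<^sub>M {0..<n} (\<lambda>_::nat. stay_space)"
  have sp: "space (?M 0) = {\<lambda>_. undefined}"
    by (simp add: space_PiM_empty)
  \<comment> \<open>\<open>CI\<close> is defined through the shortest initial segment that contains
    the index set; here the index set is such a segment already.\<close>
  have up: "up_to {0..<m} = m" for m
    by (rule antisym) (simp_all add: up_to_iff, metis up_to_less finite_atLeastLessThan
        atLeastLessThan_iff le0 less_irrefl_nat not_le)
  have lim: "(\<integral>\<^sup>+\<omega>. g (restrict \<omega> {0..<m}) \<partial>path_law R p) = (\<integral>\<^sup>+\<omega>. g \<omega> \<partial>C 0 m (\<lambda>_. undefined))"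
    if g[measurable]: "g \<in> borel_measurable (?M m)" for m g
  proof -
    have r: "(\<lambda>\<omega>. restrict \<omega> {0..<m}) \<in> path_law R p \<rightarrow>\<^sub>M ?M m"
      by (auto intro!: measurable_restrict measurable_path_law_component)
    have "(\<integral>\<^sup>+\<omega>. g (restrict \<omega> {0..<m}) \<partial>path_law R p)
        = (\<integral>\<^sup>+\<omega>. g \<omega> \<partial>distr (path_law R p) (?M m) (\<lambda>\<omega>. restrict \<omega> {0..<m}))"
      by (rule nn_integral_distr[symmetric, OF r]) simp
    also have "distr (path_law R p) (?M m) (\<lambda>\<omega>. restrict \<omega> {0..<m}) = CI {0..<m}"
      unfolding path_law_def by (rule distr_lim) simp
    also have "\<dots> = distr (C 0 m (\<lambda>_. undefined)) (?M m) (\<lambda>f. restrict f {0..<0 + m})"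
      unfolding CI_def up by simp
    also have "\<dots> = C 0 m (\<lambda>_. undefined)"
      using distr_C[of m m "\<lambda>_. undefined" 0] by (simp add: sp)
    finally show ?thesis .
  qed
  have PM[measurable]: "jump_kernel R p n \<in> ?M n \<rightarrow>\<^sub>M subprob_algebra stay_space"
    by (rule P)
  let ?G = "\<lambda>\<omega>. (\<Prod>i<n. f i (\<omega> i))"
  have G2: "(\<lambda>\<omega>. ?G \<omega> * \<psi> (\<omega> n)) \<in> borel_measurable (?M (Suc n))"
    by measurable
  have [measurable]: "?G \<in> borel_measurable (?M n)"
    by measurable
  have [measurable]: "(\<lambda>\<omega>. \<integral>\<^sup>+y. \<psi> y \<partial>jump_kernel R p n \<omega>) \<in> borel_measurable (?M n)"
    by (rule measurable_compose[OF PM nn_integral_measurable_subprob_algebra]) fact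
  have G1: "(\<lambda>\<omega>. ?G \<omega> * (\<integral>\<^sup>+y. \<psi> y \<partial>jump_kernel R p n \<omega>)) \<in> borel_measurable (?M n)"
    by measurable
  have "(\<integral>\<^sup>+\<omega>. (\<Prod>i<n. f i (\<omega> i)) * \<psi> (\<omega> n) \<partial>path_law R p) =
    (\<integral>\<^sup>+\<omega>. (\<lambda>\<omega>. ?G \<omega> * \<psi> (\<omega> n)) (restrict \<omega> {0..<Suc n}) \<partial>path_law R p)"
    by simp
  also have "\<dots> = (\<integral>\<^sup>+\<omega>. ?G \<omega> * \<psi> (\<omega> n) \<partial>C 0 (Suc n) (\<lambda>_. undefined))"
    by (rule lim) (rule G2)
  also have "\<dots> = (\<integral>\<^sup>+\<omega>. (\<integral>\<^sup>+\<omega>'. ?G \<omega>' * \<psi> (\<omega>' n) \<partial>eP n \<omega>) \<partial>C 0 n (\<lambda>_. undefined))"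
  proof -
    have "C 0 n (\<lambda>_. undefined) \<in> space (subprob_algebra (?M n))"
      using measurable_space[OF measurable_C[of 0 n], of "\<lambda>_. undefined"] by (simp add: sp)
    then have "sets (C 0 n (\<lambda>_. undefined)) = sets (?M n)"
      by (simp add: space_subprob_algebra)
    then have "eP n \<in> C 0 n (\<lambda>_. undefined) \<rightarrow>\<^sub>M subprob_algebra (?M (Suc n))"
      using measurable_eP[of n] by (simp cong: measurable_cong_sets)
    then show ?thesis
      by (simp add: nn_integral_bind[OF G2])
  qed
  also have "\<dots> = (\<integral>\<^sup>+\<omega>. ?G \<omega> * (\<integral>\<^sup>+y. \<psi> y \<partial>jump_kernel R p n \<omega>) \<partial>C 0 n (\<lambda>_. undefined))"
  proof (rule nn_integral_cong)
    fix \<omega> assume "\<omega> \<in> space (C 0 n (\<lambda>_. undefined))"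
    then have w: "\<omega> \<in> space (?M n)"
      by (subst (asm) space_C) (auto simp: sp)
    have "(\<integral>\<^sup>+\<omega>'. ?G \<omega>' * \<psi> (\<omega>' n) \<partial>eP n \<omega>) =
        (\<integral>\<^sup>+y. ?G (fun_upd \<omega> n y) * \<psi> y \<partial>jump_kernel R p n \<omega>)"
      by (subst nn_integral_eP[OF w G2]) simp
    also have "\<dots> = (\<integral>\<^sup>+y. ?G \<omega> * \<psi> y \<partial>jump_kernel R p n \<omega>)"
      by (auto intro!: nn_integral_cong prod.cong arg_cong2[where f = "(*)"])
    also have "\<dots> = ?G \<omega> * (\<integral>\<^sup>+y. \<psi> y \<partial>jump_kernel R p n \<omega>)"
      using sets_P[OF w] by (intro nn_integral_cmult) (simp cong: measurable_cong_sets)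
    finally show "(\<integral>\<^sup>+\<omega>'. ?G \<omega>' * \<psi> (\<omega>' n) \<partial>eP n \<omega>) =
        ?G \<omega> * (\<integral>\<^sup>+y. \<psi> y \<partial>jump_kernel R p n \<omega>)" .
  qed
  also have "\<dots> = (\<integral>\<^sup>+\<omega>. (\<lambda>\<omega>. ?G \<omega> * (\<integral>\<^sup>+y. \<psi> y \<partial>jump_kernel R p n \<omega>)) (restrict \<omega> {0..<n}) \<partial>path_law R p)"
    by (rule lim[symmetric]) (rule G1)
  also have "\<dots> = (\<integral>\<^sup>+\<omega>. (\<Prod>i<n. f i (\<omega> i)) * (\<integral>\<^sup>+y. \<psi> y \<partial>jump_kernel R p n \<omega>) \<partial>path_law R p)"
    by (intro nn_integral_cong) (auto simp: jump_kernel_def split: nat.split)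
  finally show ?thesis .
qed

section \<open>The Markov property at the first jump\<close>

fun box_mass :: "('s \<Rightarrow> 's \<Rightarrow> real) \<Rightarrow> 's pmf \<Rightarrow> ('s \<times> real \<Rightarrow> ennreal) list \<Rightarrow> ennreal" where
  "box_mass R p [] = 1"
| "box_mass R p (f # fs) = (\<integral>\<^sup>+y. f y * box_mass R (jump_pmf R (fst y)) fs \<partial>stay_law R p)"

lemma measurable_fst_count [measurable]:
  "(\<lambda>y. g (fst y)) \<in> borel_measurable (count_space UNIV \<Otimes>\<^sub>M N)"
  by (rule measurable_compose[OF measurable_fst]) simp

text \<open>\<open>box_mass\<close> peels factors off at the front of the path,
  \<open>nn_integral_path_law_step\<close> at its end. Absorbing the last factor into the one before
  it is the move that reconciles the two.\<close>

lemma box_mass_snoc: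
  assumes "\<And>f. f \<in> set fs \<Longrightarrow> f \<in> borel_measurable stay_space"
    and [measurable]: "f \<in> borel_measurable stay_space" "h \<in> borel_measurable stay_space"
  shows "box_mass R p (fs @ [f, h]) =
    box_mass R p (fs @ [\<lambda>y. f y * (\<integral>\<^sup>+y'. h y' \<partial>stay_law R (jump_pmf R (fst y)))])"
  using assms(1)
proof (induction fs arbitrary: p)
  case Nil
  show ?case
    by (simp add: prob_space.emeasure_space_1[OF prob_space_stay_law, simplified])
qed simp

lemma nn_integral_path_law_prod:
  assumes "\<And>i. f i \<in> borel_measurable stay_space"
  shows "(\<integral>\<^sup>+\<omega>. (\<Prod>i<Suc n. f i (\<omega> i)) \<partial>path_law R p) = box_mass R p (map f [0..<Suc n])"
  using assms
proof (induction n arbitrary: f)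
  case 0
  have "(\<integral>\<^sup>+\<omega>. (\<Prod>i<Suc 0. f i (\<omega> i)) \<partial>path_law R p) =
      (\<integral>\<^sup>+\<omega>. (\<integral>\<^sup>+y. f 0 y \<partial>jump_kernel R p 0 \<omega>) \<partial>path_law R p)"
    using nn_integral_path_law_step[where f = f and \<psi> = "f 0" and n = 0] 0 by simp
  also have "\<dots> = (\<integral>\<^sup>+y. f 0 y \<partial>stay_law R p)"
    using prob_space.emeasure_space_1[OF prob_space_path_law[of R p]] by (simp add: jump_kernel_def)
  finally show ?case
    by simp
next
  case (Suc n)
  note [measurable] = Suc.prems
  define k where "k y = (\<integral>\<^sup>+y'. f (Suc n) y' \<partial>stay_law R (jump_pmf R (fst y)))" for y :: "'a \<times> real"
  have [measurable]: "k \<in> borel_measurable stay_space"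
    unfolding k_def by (rule measurable_fst_count)
  define g where "g = f(n := \<lambda>y. f n y * k y)"
  have g: "g i \<in> borel_measurable stay_space" for i
    by (auto simp: g_def)
  have "(\<integral>\<^sup>+\<omega>. (\<Prod>i<Suc (Suc n). f i (\<omega> i)) \<partial>path_law R p)
      = (\<integral>\<^sup>+\<omega>. (\<Prod>i<Suc n. f i (\<omega> i)) * k (\<omega> n) \<partial>path_law R p)"
    using nn_integral_path_law_step[where f = f and \<psi> = "f (Suc n)" and n = "Suc n"] Suc.prems
    by (simp add: jump_kernel_def k_def)
  also have "\<dots> = (\<integral>\<^sup>+\<omega>. (\<Prod>i<Suc n. g i (\<omega> i)) \<partial>path_law R p)"
    by (intro nn_integral_cong) (auto simp: g_def mult.assoc intro!: arg_cong2[where f = "(*)"] prod.cong)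
  also have "\<dots> = box_mass R p (map g [0..<Suc n])"
    by (rule Suc.IH) (rule g)
  also have "map g [0..<Suc n] = map f [0..<n] @ [\<lambda>y. f n y * k y]"
    by (auto simp: g_def)
  also have "box_mass R p \<dots> = box_mass R p (map f [0..<n] @ [f n, f (Suc n)])"
    unfolding k_def by (rule box_mass_snoc[symmetric]) (auto simp: Suc.prems)
  finally show ?case
    by simp
qed


lemma kernel_path_law [measurable]:
  "(\<lambda>s. path_law R (f s)) \<in> count_space UNIV \<rightarrow>\<^sub>M subprob_algebra (Pi\<^sub>M UNIV (\<lambda>_. stay_space))"
  by (simp add: space_subprob_algebra prob_space_imp_subprob_space prob_space_path_law sets_path_law)

text \<open>Markov property at the first jump. Both sides are integrals against measures on sequence
  space, so it suffices to compare these on cylinder sets, where the front recursion of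
  \<open>box_mass\<close> is the claimed identity.\<close>

lemma nn_integral_path_law_cons:
  assumes "F \<in> borel_measurable (Pi\<^sub>M UNIV (\<lambda>_. stay_space))"
  shows "(\<integral>\<^sup>+\<omega>. F \<omega> \<partial>path_law R p) =
    (\<integral>\<^sup>+y. (\<integral>\<^sup>+\<omega>. F (case_nat y \<omega>) \<partial>path_law R (jump_pmf R (fst y))) \<partial>stay_law R p)"
proof -
  let ?S = "Pi\<^sub>M UNIV (\<lambda>_::nat. stay_space) :: (nat \<Rightarrow> 'a \<times> real) measure"
  let ?K = "\<lambda>y. distr (path_law R (jump_pmf R (fst y))) ?S (case_nat y)"
  have pm: "path_law R q \<rightarrow>\<^sub>M N = ?S \<rightarrow>\<^sub>M N" for q N
    by (rule measurable_cong_sets[OF sets_path_law refl])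
  have K: "?K \<in> stay_space \<rightarrow>\<^sub>M subprob_algebra ?S"
    by (rule measurable_distr2[where M = ?S])
       (auto intro!: measurable_compose[OF measurable_fst kernel_path_law])
  then have K': "?K \<in> stay_law R p \<rightarrow>\<^sub>M subprob_algebra ?S"
    by (simp cong: measurable_cong_sets)
  have Q: "(\<integral>\<^sup>+\<omega>. F \<omega> \<partial>(stay_law R p \<bind> ?K)) =
    (\<integral>\<^sup>+y. (\<integral>\<^sup>+\<omega>. F (case_nat y \<omega>) \<partial>path_law R (jump_pmf R (fst y))) \<partial>stay_law R p)"
    if [measurable]: "F \<in> borel_measurable ?S" for F
    by (subst nn_integral_bind[OF that K']) (auto intro!: nn_integral_cong nn_integral_distr simp: pm)
  have Q_sets: "sets (stay_law R p \<bind> ?K) = sets ?S"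
    by (rule sets_bind) (auto simp: space_pair_measure)
  have eq: "path_law R p = stay_law R p \<bind> ?K"
  proof (rule measure_eqI_PiM_infinite[OF sets_path_law Q_sets])
    fix A :: "nat \<Rightarrow> ('a \<times> real) set" and J :: "nat set"
    assume J: "finite J" and A: "\<And>i. i \<in> J \<Longrightarrow> A i \<in> sets stay_space"
    \<comment> \<open>Coordinates outside \<open>J\<close> get a trivial factor, which makes the
      cylinder a product over an initial segment.\<close>
    define A' where "A' i = (if i \<in> J then A i else UNIV)" for i
    define f :: "nat \<Rightarrow> 'a \<times> real \<Rightarrow> ennreal" where "f i = indicator (A' i)" for i
    have f[measurable]: "f i \<in> borel_measurable stay_space" for i
      using A sets.top[of stay_space]
      by (auto simp: f_def A'_def space_pair_measure intro!: borel_measurable_indicator)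
    \<comment> \<open>Two successors: after coordinate 0 is split off,
      \<open>nn_integral_path_law_prod\<close> still expects a nonempty product.\<close>
    obtain k where k: "J \<subseteq> {..<Suc (Suc k)}"
      using finite_nat_set_iff_bounded[of J] J by (metis less_Suc_eq lessThan_iff subsetI)
    let ?X = "prod_emb UNIV (\<lambda>_. stay_space) J (Pi\<^sub>E J A)"
    have X: "?X \<in> sets ?S"
      using J A by (intro sets_PiM_I) auto
    have ind: "indicator ?X \<omega> = (\<Prod>i<Suc (Suc k). f i (\<omega> i))" for \<omega>
    proof -
      have "\<omega> \<in> ?X \<longleftrightarrow> (\<forall>i<Suc (Suc k). \<omega> i \<in> A' i)"
        using k by (auto simp: prod_emb_def space_PiM space_pair_measure A'_def PiE_iff)
      moreover have "(\<Prod>i<Suc (Suc k). f i (\<omega> i)) = 0" if "i < Suc (Suc k)" "\<omega> i \<notin> A' i" for i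
        using that by (intro prod_zero) (auto simp: f_def intro!: bexI[of _ i])
      ultimately show ?thesis
        by (cases "\<omega> \<in> ?X") (auto simp: f_def)
    qed
    have m: "(\<lambda>\<omega>. \<Prod>i<Suc k. f (Suc i) (\<omega> i)) \<in> borel_measurable (path_law R q)" for q
      unfolding pm by measurable
    have "emeasure (path_law R p) ?X = (\<integral>\<^sup>+\<omega>. indicator ?X \<omega> \<partial>path_law R p)"
      using X by (simp add: sets_path_law)
    also have "\<dots> = box_mass R p (map f [0..<Suc (Suc k)])"
      unfolding ind by (rule nn_integral_path_law_prod) (rule f)
    also have "map f [0..<Suc (Suc k)] = f 0 # map (\<lambda>i. f (Suc i)) [0..<Suc k]"
      by (subst upt_conv_Cons) (simp_all add: map_Suc_upt[symmetric] del: upt_Suc)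
    also have "box_mass R p \<dots> = (\<integral>\<^sup>+y. f 0 y *
        (\<integral>\<^sup>+\<omega>. (\<Prod>i<Suc k. f (Suc i) (\<omega> i)) \<partial>path_law R (jump_pmf R (fst y))) \<partial>stay_law R p)"
      by (subst nn_integral_path_law_prod) simp_all
    also have "\<dots> = (\<integral>\<^sup>+y. (\<integral>\<^sup>+\<omega>. indicator ?X (case_nat y \<omega>) \<partial>path_law R (jump_pmf R (fst y))) \<partial>stay_law R p)"
      unfolding ind prod.lessThan_Suc_shift[of _ "Suc k"]
      using m by (intro nn_integral_cong) (simp add: nn_integral_cmult del: prod.lessThan_Suc)
    also have "\<dots> = (\<integral>\<^sup>+\<omega>. indicator ?X \<omega> \<partial>(stay_law R p \<bind> ?K))"
      using X by (subst Q) auto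
    also have "\<dots> = emeasure (stay_law R p \<bind> ?K) ?X"
      using X by (simp add: Q_sets)
    finally show "emeasure (path_law R p) ?X = emeasure (stay_law R p \<bind> ?K) ?X" .
  next
    interpret prob_space "path_law R p"
      by (rule prob_space_path_law)
    show "finite_measure (path_law R p)"
      by unfold_locales
  qed
  show ?thesis
    by (subst eq) (rule Q[OF assms])
qed

lemma nn_integral_path_law_first:
  assumes F: "F \<in> borel_measurable (Pi\<^sub>M UNIV (\<lambda>_. stay_space))"
  shows "(\<integral>\<^sup>+\<omega>. F \<omega> \<partial>path_law R p) =
    (\<integral>\<^sup>+s. (\<integral>\<^sup>+x. ennreal (exponential_density (hold_rate R s) x) *
       (\<integral>\<^sup>+\<omega>. F (case_nat (s, x) \<omega>) \<partial>path_law R (jump_pmf R s)) \<partial>lborel) \<partial>measure_pmf p)"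
proof -
  let ?S = "Pi\<^sub>M UNIV (\<lambda>_::nat. stay_space) :: (nat \<Rightarrow> 'a \<times> real) measure"
  have pm: "path_law R q \<rightarrow>\<^sub>M N = ?S \<rightarrow>\<^sub>M N" for q N
    by (rule measurable_cong_sets[OF sets_path_law refl])
  have "(\<lambda>y. distr (path_law R (jump_pmf R (fst y))) ?S (case_nat y)) \<in> stay_space \<rightarrow>\<^sub>M subprob_algebra ?S"
    by (rule measurable_distr2[where M = ?S])
       (auto intro!: measurable_compose[OF measurable_fst kernel_path_law])
  from measurable_compose[OF this nn_integral_measurable_subprob_algebra[OF F]]
  have "(\<lambda>y. \<integral>\<^sup>+\<omega>. F \<omega> \<partial>distr (path_law R (jump_pmf R (fst y))) ?S (case_nat y)) \<in> borel_measurable stay_space" .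
  also have "(\<lambda>y. \<integral>\<^sup>+\<omega>. F \<omega> \<partial>distr (path_law R (jump_pmf R (fst y))) ?S (case_nat y)) =
     (\<lambda>y. \<integral>\<^sup>+\<omega>. F (case_nat y \<omega>) \<partial>path_law R (jump_pmf R (fst y)))"
    using F by (intro ext nn_integral_distr) (auto simp: pm space_pair_measure intro!: measurable_case_nat')
  finally show ?thesis
    by (simp add: nn_integral_path_law_cons[OF F] nn_integral_stay_law)
qed

lemma nn_integral_path_law_mixture:
  assumes F: "F \<in> borel_measurable (Pi\<^sub>M UNIV (\<lambda>_. stay_space))"
  shows "(\<integral>\<^sup>+\<omega>. F \<omega> \<partial>path_law R p) = (\<integral>\<^sup>+s. (\<integral>\<^sup>+\<omega>. F \<omega> \<partial>path_law R (return_pmf s)) \<partial>measure_pmf p)"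
  by (simp add: nn_integral_path_law_first[OF F])

section \<open>Non-explosion for bounded rates\<close>

lemma box_mass_exp_le:
  assumes le: "\<And>s. hold_rate R s \<le> L"
  shows "box_mass R p (replicate n (\<lambda>y. ennreal (exp (- snd y)))) \<le> ennreal (L / (L + 1)) ^ n"
proof (induction n arbitrary: p)
  case (Suc n)
  let ?f = "\<lambda>y::'a \<times> real. ennreal (exp (- snd y))"
  have L: "L > 0"
    using hold_rate_pos[of R undefined] le[of undefined] by linarith
  \<comment> \<open>The Laplace transform at 1 of the exponential law with rate \<open>r\<close> is
    \<open>r / (r + 1)\<close>, which increases with \<open>r\<close>. Multiplying the density by
    \<open>exp (- x)\<close> gives a multiple of the density with rate \<open>r + 1\<close>.\<close>
  have int: "(\<integral>\<^sup>+x. ennreal (exponential_density (hold_rate R s) x) * ennreal (exp (- x)) \<partial>lborel)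
      \<le> ennreal (L / (L + 1))" for s
  proof -
    let ?r = "hold_rate R s"
    have r: "?r > 0"
      by (rule hold_rate_pos)
    have "(\<integral>\<^sup>+x. ennreal (exponential_density ?r x) * ennreal (exp (- x)) \<partial>lborel)
        = (\<integral>\<^sup>+x. ennreal (?r / (?r + 1)) * ennreal (exponential_density (?r + 1) x) \<partial>lborel)"
    proof (intro nn_integral_cong)
      fix x
      have "?r / (?r + 1) * ((?r + 1) * exp (- x * (?r + 1))) = ?r * exp (- x * ?r) * exp (- x)"
        using r by (simp add: exp_add[symmetric] ring_distribs(1))
      then show "ennreal (exponential_density ?r x) * ennreal (exp (- x))
          = ennreal (?r / (?r + 1)) * ennreal (exponential_density (?r + 1) x)"
        using r by (simp add: exponential_density_def ennreal_mult[symmetric])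
    qed
    also have "\<dots> = ennreal (?r / (?r + 1))"
      using r prob_space.emeasure_space_1[OF prob_space_exponential_density[of "?r + 1"]]
      by (simp add: nn_integral_cmult emeasure_density)
    also have "\<dots> \<le> ennreal (L / (L + 1))"
      using r le[of s] L by (intro ennreal_leI) (simp add: field_simps)
    finally show ?thesis .
  qed
  have "box_mass R p (replicate (Suc n) ?f) \<le> (\<integral>\<^sup>+y. ennreal (L / (L + 1)) ^ n * ?f y \<partial>stay_law R p)"
    by (auto simp: mult.commute[of "_ ^ _"] intro!: nn_integral_mono mult_left_mono Suc)
  also have "\<dots> = ennreal (L / (L + 1)) ^ n * (\<integral>\<^sup>+y. ?f y \<partial>stay_law R p)"
    by (rule nn_integral_cmult) measurable
  finally have 1: "box_mass R p (replicate (Suc n) ?f) \<le>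
      ennreal (L / (L + 1)) ^ n * (\<integral>\<^sup>+y. ?f y \<partial>stay_law R p)" .
  have "(\<integral>\<^sup>+y. ?f y \<partial>stay_law R p) \<le> (\<integral>\<^sup>+s. ennreal (L / (L + 1)) \<partial>measure_pmf p)"
    by (subst nn_integral_stay_law) (simp, rule nn_integral_mono, simp add: int)
  then have "(\<integral>\<^sup>+y. ?f y \<partial>stay_law R p) \<le> ennreal (L / (L + 1))"
    by simp
  from order_trans[OF 1 mult_left_mono[OF this]] show ?case
    by (simp add: mult.commute)
qed simp

text \<open>Chernoff bound: the sum of \<open>Suc n\<close> holding times stays at or below
  \<open>N\<close> with probability at most \<open>exp N * (L / (L + 1)) ^ Suc n\<close>, which
  vanishes as \<open>n\<close> grows.\<close>

lemma AE_path_law_nonexplosive: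
  assumes le: "\<And>s. hold_rate R s \<le> L"
  shows "AE \<omega> in path_law R p. \<forall>t. \<exists>m. t < (\<Sum>k\<le>m. snd (\<omega> k))"
proof -
  have L: "L > 0"
    using hold_rate_pos[of R undefined] le[of undefined] by linarith
  interpret prob_space "path_law R p"
    by (rule prob_space_path_law)
  note [measurable] = measurable_path_law_component[of _ R p]
  have "AE \<omega> in path_law R p. \<exists>m. real N < (\<Sum>k\<le>m. snd (\<omega> k))" for N :: nat
  proof -
    let ?E = "{\<omega> \<in> space (path_law R p). \<not> (\<exists>m. real N < (\<Sum>k\<le>m. snd (\<omega> k)))}"
    have E: "?E \<in> events"
      by measurable
    have "prob ?E \<le> exp (real N) * (L / (L + 1)) ^ Suc n" for n
    proof -
      have "emeasure (path_law R p) ?E = (\<integral>\<^sup>+\<omega>. indicator ?E \<omega> \<partial>path_law R p)"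
        using E by simp
      also have "\<dots> \<le> (\<integral>\<^sup>+\<omega>. ennreal (exp (real N)) * (\<Prod>i<Suc n. ennreal (exp (- snd (\<omega> i)))) \<partial>path_law R p)"
      proof (intro nn_integral_mono)
        fix \<omega>
        have "1 \<le> exp (real N) * (\<Prod>i<Suc n. exp (- snd (\<omega> i)))" if "\<omega> \<in> ?E"
        proof -
          have "(\<Sum>k\<le>n. snd (\<omega> k)) \<le> real N"
            using that by (auto simp: not_less)
          moreover have "exp (real N) * (\<Prod>i<Suc n. exp (- snd (\<omega> i))) = exp (real N - (\<Sum>k\<le>n. snd (\<omega> k)))"
            by (simp add: exp_sum[symmetric] exp_add[symmetric] sum_negf
                lessThan_Suc_atMost del: prod.lessThan_Suc)
          ultimately show ?thesis
            by simp
        qed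
        then show "indicator ?E \<omega> \<le> ennreal (exp (real N)) * (\<Prod>i<Suc n. ennreal (exp (- snd (\<omega> i))))"
          by (auto simp: prod_ennreal ennreal_mult[symmetric] prod_nonneg split: split_indicator
              simp del: prod.lessThan_Suc)
      qed
      also have "\<dots> = ennreal (exp (real N)) * box_mass R p (map (\<lambda>i y. ennreal (exp (- snd y))) [0..<Suc n])"
        by (subst nn_integral_path_law_prod[symmetric]) (auto intro!: nn_integral_cmult)
      also have "map (\<lambda>i y. ennreal (exp (- snd y))) [0..<Suc n] = replicate (Suc n) (\<lambda>y::'a \<times> real. ennreal (exp (- snd y)))"
        by (simp add: map_replicate_const del: upt_Suc replicate_Suc)
      also have "ennreal (exp (real N)) * box_mass R p \<dots> \<le> ennreal (exp (real N)) * ennreal (L / (L + 1)) ^ Suc n"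
        by (intro mult_left_mono box_mass_exp_le le) simp
      also have "\<dots> = ennreal (exp (real N) * (L / (L + 1)) ^ Suc n)"
        using L by (simp only: ennreal_power ennreal_mult' divide_nonneg_nonneg exp_ge_zero less_imp_le
            add_nonneg_nonneg zero_le_one)
      finally show ?thesis
        using L by (simp add: emeasure_eq_measure ennreal_le_iff)
    qed
    moreover have "(\<lambda>n. exp (real N) * (L / (L + 1)) ^ Suc n) \<longlonglongrightarrow> exp (real N) * 0"
      using L by (intro tendsto_mult tendsto_const LIMSEQ_Suc LIMSEQ_power_zero) simp
    ultimately have "prob ?E \<le> 0"
      by (intro LIMSEQ_le_const[where X = "\<lambda>n. exp (real N) * (L / (L + 1)) ^ Suc n"]) auto
    then have "prob ?E = 0"
      by (simp add: measure_le_0_iff)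
    then show ?thesis
      using E by (subst AE_iff_measurable[OF E refl]) (simp add: emeasure_eq_measure)
  qed
  then have "AE \<omega> in path_law R p. \<forall>N::nat. \<exists>m. real N < (\<Sum>k\<le>m. snd (\<omega> k))"
    by (simp add: AE_all_countable)
  then show ?thesis
    by eventually_elim (metis reals_Archimedean2 less_trans)
qed

section \<open>Generator and transition probabilities\<close>

definition gen :: "('s \<Rightarrow> 's \<Rightarrow> real) \<Rightarrow> ('s \<Rightarrow> real) \<Rightarrow> 's \<Rightarrow> real" where
  "gen R f s = (\<Sum>s' | R s s' \<noteq> 0. R s s' * (f s' - f s))"

text \<open>The starting state comes last, so that \<open>at_prob R A t\<close> is a function of the
  state on which \<open>gen R\<close> can act.\<close>

definition at_prob :: "('s \<Rightarrow> 's \<Rightarrow> real) \<Rightarrow> 's set \<Rightarrow> real \<Rightarrow> 's \<Rightarrow> real" where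
  "at_prob R A t s = measure (path_law R (return_pmf s)) {\<omega>. state_at \<omega> t \<in> A}"

lemma at_prob_bounds: "0 \<le> at_prob R A t s" "at_prob R A t s \<le> 1"
  using prob_space.prob_le_1[OF prob_space_path_law] by (auto simp: at_prob_def)

lemma borel_measurable_state_at:
  "(\<lambda>\<omega>. indicator A (state_at \<omega> t) :: ennreal) \<in> borel_measurable (Pi\<^sub>M UNIV (\<lambda>_. stay_space))"
  using measurable_compose[OF measurable_state_at[of t _ undefined], of "indicator A :: _ \<Rightarrow> ennreal" borel undefined]
  unfolding measurable_cong_sets[OF sets_path_law refl] by simp

lemma state_at_event: "{\<omega>. state_at \<omega> t \<in> A} \<in> sets (path_law R p)"
  using measurable_sets[OF measurable_state_at[of t R p], of A] by (simp add: vimage_def)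

lemma emeasure_state_at:
  "emeasure (path_law R p) {\<omega>. state_at \<omega> t \<in> A} =
   (\<integral>\<^sup>+\<omega>. indicator A (state_at \<omega> t) \<partial>path_law R p)"
proof -
  have "emeasure (path_law R p) {\<omega>. state_at \<omega> t \<in> A} =
      (\<integral>\<^sup>+\<omega>. indicator {\<omega>. state_at \<omega> t \<in> A} \<omega> \<partial>path_law R p)"
    by (rule nn_integral_indicator[symmetric, OF state_at_event])
  then show ?thesis
    by (simp add: indicator_def)
qed

lemma prob_state_at:
  "measure (path_law R p) {\<omega>. state_at \<omega> t \<in> A} = (\<integral>s. at_prob R A t s \<partial>measure_pmf p)"
proof -
  interpret P: prob_space "path_law R q" for q
    by (rule prob_space_path_law)
  have "ennreal (measure (path_law R p) {\<omega>. state_at \<omega> t \<in> A}) =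
      (\<integral>\<^sup>+s. ennreal (at_prob R A t s) \<partial>measure_pmf p)"
    using nn_integral_path_law_mixture[OF borel_measurable_state_at[of A t], of R p]
    by (simp add: at_prob_def emeasure_state_at[symmetric] P.emeasure_eq_measure)
  also have "\<dots> = ennreal (\<integral>s. at_prob R A t s \<partial>measure_pmf p)"
    by (intro nn_integral_eq_integral measure_pmf.integrable_const_bound[of _ 1])
       (auto simp: at_prob_bounds)
  finally show ?thesis
    by (simp add: at_prob_bounds integral_nonneg_AE)
qed

text \<open>\<open>state_at\<close> is jointly measurable in time and path; integrating over the
  path leaves measurability in time.\<close>

lemma measurable_at_time: "(\<lambda>t. measure (path_law R p) {\<omega>. state_at \<omega> t \<in> A}) \<in> borel_measurable borel"
proof -
  interpret P: prob_space "path_law R p"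
    by (rule prob_space_path_law)
  note [measurable] = measurable_path_law_component[of _ R p]
  have [measurable]: "(\<lambda>z. snd (snd z k)) \<in> borel_measurable (borel \<Otimes>\<^sub>M path_law R p)"
    "(\<lambda>z. fst (snd z k)) \<in> borel \<Otimes>\<^sub>M path_law R p \<rightarrow>\<^sub>M count_space UNIV" for k :: nat
    by (auto intro!: measurable_compose[OF measurable_compose[OF measurable_snd measurable_path_law_component]])
  have "(\<lambda>z. state_at (snd z) (fst z)) \<in> borel \<Otimes>\<^sub>M path_law R p \<rightarrow>\<^sub>M count_space UNIV"
    unfolding state_at_def by (rule measurable_compose_countable) measurable
  then have "(\<lambda>z. indicator A (state_at (snd z) (fst z)) :: ennreal) \<in> borel_measurable (borel \<Otimes>\<^sub>M path_law R p)"
    by (rule measurable_compose) simp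
  then have "(\<lambda>t. \<integral>\<^sup>+\<omega>. indicator A (state_at \<omega> t) \<partial>path_law R p) \<in> borel_measurable borel"
    using P.borel_measurable_nn_integral[of "\<lambda>t \<omega>. indicator A (state_at \<omega> t)" borel]
    by (simp add: split_beta')
  then have "(\<lambda>t. enn2real (emeasure (path_law R p) {\<omega>. state_at \<omega> t \<in> A})) \<in> borel_measurable borel"
    unfolding emeasure_state_at by measurable
  then show ?thesis
    by (simp add: measure_def)
qed

text \<open>Removing the first stay shifts the \<open>LEAST\<close> in \<open>state_at\<close> by
  one. The second part asks that the remaining holding times pass \<open>t - x\<close>; otherwise
  this \<open>LEAST\<close> ranges over the empty set.\<close>

lemma state_at_case_nat:
  "t < x \<Longrightarrow> state_at (case_nat (s, x) \<omega>) t = s"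
  "\<not> t < x \<Longrightarrow> \<exists>m. t - x < (\<Sum>k\<le>m. snd (\<omega> k)) \<Longrightarrow> state_at (case_nat (s, x) \<omega>) t = state_at \<omega> (t - x)"
proof -
  let ?P = "\<lambda>m. t < (\<Sum>k\<le>m. snd (case_nat (s, x) \<omega> k))"
  show "state_at (case_nat (s, x) \<omega>) t = s" if "t < x"
    using that by (simp add: state_at_def Least_eq_0)
  have Suc: "?P (Suc m) \<longleftrightarrow> t - x < (\<Sum>k\<le>m. snd (\<omega> k))" for m
    by (subst sum.atMost_Suc_shift) auto
  assume t: "\<not> t < x" and "\<exists>m. t - x < (\<Sum>k\<le>m. snd (\<omega> k))"
  then obtain m where m: "?P (Suc m)"
    using Suc by blast
  then have "(LEAST m. ?P m) = Suc (LEAST m. ?P (Suc m))"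
    using t by (intro Least_Suc[of ?P, OF m]) auto
  then show "state_at (case_nat (s, x) \<omega>) t = state_at \<omega> (t - x)"
    unfolding state_at_def Suc by simp
qed

text \<open>The upper bound \<open>L\<close> excludes explosion; the lower bound \<open>l\<close>
  excludes absorbing states and bounds the mean holding times by \<open>1 / l\<close>.\<close>

locale jump_rates =
  fixes R :: "'s \<Rightarrow> 's \<Rightarrow> real" and l L :: real
  assumes rate_nonneg: "0 \<le> R s s'"
    and finite_rates: "finite {s'. R s s' \<noteq> 0}"
    and l_pos: "0 < l" and exit_ge: "l \<le> exit_rate R s" and exit_le: "exit_rate R s \<le> L"
begin

abbreviation r where "r \<equiv> exit_rate R"
abbreviation J where "J \<equiv> jump_pmf R"

lemma r_pos: "0 < r s"
  using l_pos exit_ge[of s] by linarith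

lemma hold_rate_eq: "hold_rate R s = r s"
  using r_pos by (simp add: hold_rate_def)

lemma pmf_J: "pmf (J s) s' = (if s' = s then 0 else R s s' / r s)"
  by (rule jump_pmf_eq) (use rate_nonneg finite_rates r_pos in auto)

lemma set_pmf_J: "set_pmf (J s) = {s'. s' \<noteq> s \<and> R s s' \<noteq> 0}"
  using r_pos[of s] by (auto simp: set_pmf_iff pmf_J split: if_splits)

lemma finite_set_J: "finite (set_pmf (J s))"
  unfolding set_pmf_J by (rule finite_subset[OF _ finite_rates[of s]]) auto

lemma integrable_J: "integrable (measure_pmf (J s)) (f :: 's \<Rightarrow> real)"
  by (rule integrable_measure_pmf_finite[OF finite_set_J])

lemma expectation_J: "(\<integral>s'. f s' \<partial>measure_pmf (J s)) = (\<Sum>s'\<in>set_pmf (J s). f s' * pmf (J s) s')"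
  by (rule integral_measure_pmf_real) (auto simp: finite_set_J)

lemma gen_eq_J: "gen R f s = r s * ((\<integral>s'. f s' \<partial>measure_pmf (J s)) - f s)"
proof -
  have one: "(\<Sum>s'\<in>set_pmf (J s). pmf (J s) s') = 1"
    using sum_pmf_eq_1[OF finite_set_J[of s]] by simp
  have "gen R f s = (\<Sum>s'\<in>set_pmf (J s). R s s' * (f s' - f s))"
    unfolding gen_def set_pmf_J by (rule sum.mono_neutral_right) (auto simp: finite_rates)
  also have "\<dots> = (\<Sum>s'\<in>set_pmf (J s). r s * (f s' * pmf (J s) s' - f s * pmf (J s) s'))"
    using r_pos[of s] by (intro sum.cong) (auto simp: pmf_J set_pmf_J algebra_simps)
  also have "\<dots> = r s * ((\<Sum>s'\<in>set_pmf (J s). f s' * pmf (J s) s') - f s)"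
    using one by (simp add: sum_distrib_left[symmetric] sum_subtractf)
  finally show ?thesis
    by (simp add: expectation_J)
qed

text \<open>Conditioning on the first jump: either it comes after \<open>t\<close>, or it comes at
  \<open>t - y\<close> and the process restarts from the law \<open>J s\<close> with time
  \<open>y\<close> left. The substitution to \<open>y\<close> frees the probability under the
  integral from \<open>t\<close>.\<close>

lemma renewal_nn:
  assumes "t \<ge> 0"
  shows "ennreal (at_prob R A t s) = ennreal (indicator A s * exp (- r s * t)) +
    (\<integral>\<^sup>+y. ennreal (r s * exp (- r s * (t - y)) * (\<integral>s'. at_prob R A y s' \<partial>measure_pmf (J s))) * indicator {0..t} y \<partial>lborel)"
proof -
  interpret P: prob_space "path_law R q" for q
    by (rule prob_space_path_law)
  define U where "U y = measure (path_law R (J s)) {\<omega>. state_at \<omega> y \<in> A}" for y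
  have U[measurable]: "U \<in> borel_measurable borel"
    unfolding U_def by (rule measurable_at_time)
  let ?a = "indicator A s :: ennreal"
  let ?e = "exponential_density (r s)"
  have inner: "(\<integral>\<^sup>+\<omega>. indicator A (state_at (case_nat (s, x) \<omega>) t) \<partial>path_law R (J s))
      = (if t < x then ?a else ennreal (U (t - x)))" for x
  proof (cases "t < x")
    case True
    then show ?thesis
      by (simp add: state_at_case_nat(1) P.emeasure_space_1[simplified])
  next
    case False
    have "AE \<omega> in path_law R (J s). \<forall>t. \<exists>m. t < (\<Sum>k\<le>m. snd (\<omega> k))"
      by (rule AE_path_law_nonexplosive[of R L]) (simp add: hold_rate_eq exit_le)
    then have "AE \<omega> in path_law R (J s).
        indicator A (state_at (case_nat (s, x) \<omega>) t) = (indicator A (state_at \<omega> (t - x)) :: ennreal)"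
      by eventually_elim (simp add: state_at_case_nat(2)[OF False])
    then have "(\<integral>\<^sup>+\<omega>. indicator A (state_at (case_nat (s, x) \<omega>) t) \<partial>path_law R (J s)) =
        (\<integral>\<^sup>+\<omega>. indicator A (state_at \<omega> (t - x)) \<partial>path_law R (J s))"
      by (rule nn_integral_cong_AE)
    then show ?thesis
      using False by (simp add: emeasure_state_at[symmetric] P.emeasure_eq_measure U_def)
  qed
  have "ennreal (at_prob R A t s) = (\<integral>\<^sup>+\<omega>. indicator A (state_at \<omega> t) \<partial>path_law R (return_pmf s))"
    by (simp add: at_prob_def emeasure_state_at[symmetric] P.emeasure_eq_measure)
  also have "\<dots> = (\<integral>\<^sup>+x. ennreal (?e x) * (if t < x then ?a else ennreal (U (t - x))) \<partial>lborel)"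
    by (simp add: nn_integral_path_law_first[OF borel_measurable_state_at] hold_rate_eq inner)
  also have "\<dots> = (\<integral>\<^sup>+x. ?a * (ennreal (r s * exp (- r s * x)) * indicator {t..} x) +
       ennreal (r s * exp (- r s * x) * U (t - x)) * indicator {0..t} x \<partial>lborel)"
  proof (intro nn_integral_cong_AE)
    have U0: "U y \<ge> 0" for y by (simp add: U_def)
    show "AE x in lborel. ennreal (?e x) * (if t < x then ?a else ennreal (U (t - x))) =
       ?a * (ennreal (r s * exp (- r s * x)) * indicator {t..} x) +
       ennreal (r s * exp (- r s * x) * U (t - x)) * indicator {0..t} x"
      \<comment> \<open>The two indicators overlap only at \<open>x = t\<close>, a null set.\<close>
      using AE_lborel_singleton[of t]
    proof eventually_elim
      case (elim x)
      then show ?case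
        using assms r_pos[of s] U0[of "t - x"]
        by (cases "x < 0"; cases "t < x")
          (auto simp: exponential_density_def ennreal_mult'[symmetric] mult_ac)
    qed
  qed
  also have "\<dots> = ?a * (\<integral>\<^sup>+x. ennreal (r s * exp (- r s * x)) * indicator {t..} x \<partial>lborel) +
      (\<integral>\<^sup>+x. ennreal (r s * exp (- r s * x) * U (t - x)) * indicator {0..t} x \<partial>lborel)"
    by (subst nn_integral_add) (simp_all add: nn_integral_cmult)
  also have "(\<integral>\<^sup>+x. ennreal (r s * exp (- r s * x)) * indicator {t..} x \<partial>lborel) = ennreal (0 - (- exp (- r s * t)))"
  proof (rule nn_integral_FTC_atLeast)
    show "((\<lambda>x. - exp (- r s * x)) \<longlongrightarrow> 0) at_top"
    proof -
      have "((\<lambda>x. - exp (- c * x)) \<longlongrightarrow> 0) at_top" if "c > 0" for c :: real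
        using that by real_asymp
      from this[OF r_pos] show ?thesis .
    qed
    show "((\<lambda>x. - exp (- r s * x)) has_real_derivative r s * exp (- r s * x)) (at x)" for x
      by (auto intro!: derivative_eq_intros)
  qed (use r_pos[of s] in auto)
  also have "(\<integral>\<^sup>+x. ennreal (r s * exp (- r s * x) * U (t - x)) * indicator {0..t} x \<partial>lborel) =
      (\<integral>\<^sup>+y. ennreal (r s * exp (- r s * (t - y)) * U y) * indicator {0..t} y \<partial>lborel)"
    by (subst nn_integral_real_affine[where c = "-1" and t = t])
       (auto intro!: nn_integral_cong split: split_indicator)
  finally show ?thesis
    by (simp add: U_def prob_state_at ennreal_mult' indicator_def)
qed

text \<open>Multiplying by \<open>exp (r s * t)\<close> removes \<open>t\<close> from the integrand
  altogether and leaves an indefinite integral.\<close>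

lemma renewal:
  assumes "t \<ge> 0"
  shows "((\<lambda>y. r s * exp (r s * y) * (\<integral>s'. at_prob R A y s' \<partial>measure_pmf (J s))) has_integral
     exp (r s * t) * at_prob R A t s - indicator A s) {0..t}"
proof -
  define U where "U y = (\<integral>s'. at_prob R A y s' \<partial>measure_pmf (J s))" for y
  have U': "U y = measure (path_law R (J s)) {\<omega>. state_at \<omega> y \<in> A}" for y
    by (simp add: U_def prob_state_at)
  have U[measurable]: "U \<in> borel_measurable borel"
    unfolding U' by (rule measurable_at_time)
  have U01: "0 \<le> U y" "U y \<le> 1" for y
    unfolding U' using prob_space.prob_le_1[OF prob_space_path_law] by auto
  define g where "g y = r s * exp (- r s * (t - y)) * U y" for y
  have [measurable]: "g \<in> borel_measurable borel"
    unfolding g_def by measurable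
  have g0: "g y \<ge> 0" for y
    using r_pos[of s] U01(1)[of y] by (simp add: g_def)
  have int: "set_integrable lborel {0..t} g"
    unfolding set_integrable_def
  proof (rule integrableI_bounded_set_indicator[where B = "r s"])
    show "AE x in lborel. x \<in> {0..t} \<longrightarrow> norm (g x) \<le> r s"
      using r_pos[of s] U01 by (auto simp: g_def abs_mult mult.assoc intro!: mult_le_one AE_I2 mult_left_le)
  qed (auto simp: emeasure_lborel_Icc_eq)
  have "ennreal (at_prob R A t s) = ennreal (indicator A s * exp (- r s * t)) +
      (\<integral>\<^sup>+y. ennreal (indicator {0..t} y *\<^sub>R g y) \<partial>lborel)"
    unfolding renewal_nn[OF assms] U_def[symmetric] g_def
    by (intro arg_cong2[where f = "(+)"] nn_integral_cong) (auto split: split_indicator)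
  also have "(\<integral>\<^sup>+y. ennreal (indicator {0..t} y *\<^sub>R g y) \<partial>lborel) = ennreal (LINT y:{0..t}|lborel. g y)"
    unfolding set_lebesgue_integral_def
    using int g0 by (intro nn_integral_eq_integral) (auto simp: set_integrable_def)
  also have "(LINT y:{0..t}|lborel. g y) = integral {0..t} g"
    by (rule set_borel_integral_eq_integral(2)[OF int])
  also have "ennreal (indicator A s * exp (- r s * t)) + ennreal (integral {0..t} g) =
      ennreal (indicator A s * exp (- r s * t) + integral {0..t} g)"
    using g0 set_borel_integral_eq_integral(1)[OF int]
    by (intro ennreal_plus[symmetric] integral_nonneg) auto
  finally have "at_prob R A t s = indicator A s * exp (- r s * t) + integral {0..t} g"
    using g0 set_borel_integral_eq_integral(1)[OF int] at_prob_bounds(1)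
    by (subst (asm) ennreal_inj) (auto intro!: add_nonneg_nonneg integral_nonneg)
  then have "(g has_integral at_prob R A t s - indicator A s * exp (- r s * t)) {0..t}"
    using set_borel_integral_eq_integral(1)[OF int] by (simp add: has_integral_integral)
  from has_integral_mult_right[OF this, of "exp (r s * t)"]
  have "((\<lambda>y. exp (r s * t) * g y) has_integral
      exp (r s * t) * (at_prob R A t s - indicator A s * exp (- r s * t))) {0..t}" .
  also have "(\<lambda>y. exp (r s * t) * g y) = (\<lambda>y. r s * exp (r s * y) * U y)"
    by (auto simp: g_def fun_eq_iff right_diff_distrib exp_diff exp_minus field_simps)
  also have "exp (r s * t) * (at_prob R A t s - indicator A s * exp (- r s * t)) =
      exp (r s * t) * at_prob R A t s - indicator A s"
    by (simp add: right_diff_distrib exp_minus)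
  finally show ?thesis
    by (simp add: U_def)
qed

lemma at_prob_0: "at_prob R A 0 s = indicator A s"
  using integral_unique[OF renewal[of 0 s A]] by simp

text \<open>By \<open>renewal\<close> the probability is an exponential times the sum of a constant
  and an indefinite integral, and the latter is continuous.\<close>

lemma continuous_on_at_prob: "continuous_on {0..T} (\<lambda>t. at_prob R A t s)"
proof (cases "T \<ge> 0")
  case True
  let ?h = "\<lambda>y. r s * exp (r s * y) * (\<integral>s'. at_prob R A y s' \<partial>measure_pmf (J s))"
  have "continuous_on {0..T} (\<lambda>t. exp (- r s * t) * (indicator A s + integral {0..t} ?h))"
    using renewal[OF True, of s A]
    by (intro continuous_intros indefinite_integral_continuous_1) (auto simp: integrable_on_def)
  moreover have "exp (- r s * t) * (indicator A s + integral {0..t} ?h) = at_prob R A t s"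
    if "t \<in> {0..T}" for t
    using integral_unique[OF renewal[of t s A]] that by (simp add: exp_minus)
  ultimately show ?thesis
    by (simp cong: continuous_on_cong_simp)
qed simp

lemma continuous_on_gen_at_prob: "continuous_on {0..T} (\<lambda>t. gen R (at_prob R A t) s)"
  unfolding gen_def by (intro continuous_intros continuous_on_at_prob)

text \<open>Integrated backward equation: the generator acts on the starting state. The integrand of
  \<open>renewal\<close> is now known to be continuous, so the identity can be differentiated in the
  upper limit; the exponential prefactor supplies the term \<open>- r s * at_prob R A t s\<close> of
  the generator.\<close>

lemma at_prob_forward:
  assumes "T \<ge> 0"
  shows "((\<lambda>t. gen R (at_prob R A t) s) has_integral at_prob R A T s - indicator A s) {0..T}"
proof -
  let ?U = "\<lambda>y. (\<integral>s'. at_prob R A y s' \<partial>measure_pmf (J s))"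
  let ?h = "\<lambda>y. r s * exp (r s * y) * ?U y"
  have U: "continuous_on {0..T} ?U"
    unfolding expectation_J by (intro continuous_intros continuous_on_at_prob)
  have "((\<lambda>t. at_prob R A t s) has_vector_derivative gen R (at_prob R A t) s) (at t within {0..T})"
    if t: "t \<in> {0..T}" for t
  proof -
    have "((\<lambda>t. integral {0..t} ?h) has_vector_derivative ?h t) (at t within {0..T})"
      by (rule integral_has_vector_derivative[OF _ t]) (intro continuous_intros U)
    then have "((\<lambda>t. exp (- r s * t) * (indicator A s + integral {0..t} ?h)) has_real_derivative
        exp (- r s * t) * ?h t - r s * exp (- r s * t) * (indicator A s + integral {0..t} ?h)) (at t within {0..T})"
      unfolding has_real_derivative_iff_has_vector_derivative[symmetric]
      by (auto intro!: derivative_eq_intros)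
    note D = this
    have eq: "exp (- r s * x) * (indicator A s + integral {0..x} ?h) = at_prob R A x s"
      if "x \<in> {0..T}" for x
      using integral_unique[OF renewal[of x s A]] that by (simp add: exp_minus)
    have G: "exp (- r s * t) * ?h t - r s * exp (- r s * t) * (indicator A s + integral {0..t} ?h)
        = gen R (at_prob R A t) s"
    proof -
      have "exp (- r s * t) * ?h t = (exp (- r s * t) * exp (r s * t)) * (r s * ?U t)"
        by (simp only: mult_ac)
      also have "\<dots> = r s * ?U t"
        by (simp add: exp_minus)
      finally have 1: "exp (- r s * t) * ?h t = r s * ?U t" .
      have 2: "r s * exp (- r s * t) * (indicator A s + integral {0..t} ?h) = r s * at_prob R A t s"
        unfolding eq[OF t, symmetric] by (simp only: mult.assoc)
      show ?thesis
        unfolding 1 2 gen_eq_J right_diff_distrib ..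
    qed
    show ?thesis
      unfolding has_real_derivative_iff_has_vector_derivative[symmetric]
      by (rule has_field_derivative_transform_within[OF D[unfolded G], of 1]) (use t eq in auto)
  qed
  from fundamental_theorem_of_calculus[OF assms this]
  show ?thesis
    by (simp add: at_prob_0)
qed

end

section \<open>Stationary distributions from a Lyapunov function\<close>

text \<open>The support of a pmf is countable, so this exchanges a sum with an integral, and
  measurability in \<open>t\<close> for each fixed state, here from continuity, suffices.\<close>

lemma expectation_integral_swap:
  fixes h :: "real \<Rightarrow> 's \<Rightarrow> real"
  assumes T: "T \<ge> 0" and h0: "\<And>t s. t \<in> {0..T} \<Longrightarrow> 0 \<le> h t s" and hK: "\<And>t s. t \<in> {0..T} \<Longrightarrow> h t s \<le> K"
    and cont: "\<And>s. continuous_on {0..T} (\<lambda>t. h t s)"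
    and c: "\<And>t. t \<in> {0..T} \<Longrightarrow> (\<integral>s. h t s \<partial>measure_pmf p) = c"
  shows "(\<integral>s. integral {0..T} (\<lambda>t. h t s) \<partial>measure_pmf p) = T * c"
proof -
  have K: "K \<ge> 0"
    using h0[of 0] hK[of 0] T by (meson atLeastAtMost_iff order_refl order_trans)
  have c0: "c \<ge> 0"
    using c[of 0] h0[of 0] T by (auto simp: integral_nonneg_AE)
  have mh: "(\<lambda>t. ennreal (h t s) * indicator {0..T} t) \<in> borel_measurable borel" for s
  proof -
    have "(\<lambda>t. indicator {0..T} t *\<^sub>R h t s) \<in> borel_measurable borel"
      by (rule borel_measurable_continuous_on_indicator) (auto intro: cont)
    then have "(\<lambda>t. ennreal (indicator {0..T} t *\<^sub>R h t s)) \<in> borel_measurable borel"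
      by measurable
    also have "(\<lambda>t. ennreal (indicator {0..T} t *\<^sub>R h t s)) = (\<lambda>t. ennreal (h t s) * indicator {0..T} t)"
      by (auto simp: fun_eq_iff split: split_indicator)
    finally show ?thesis .
  qed
  have int: "ennreal (integral {0..T} (\<lambda>t. h t s)) = (\<integral>\<^sup>+t. ennreal (h t s) * indicator {0..T} t \<partial>lborel)" for s
  proof -
    have si: "set_integrable lborel {0..T} (\<lambda>t. h t s)"
      by (rule borel_integrable_atLeastAtMost'[OF cont])
    have "(\<integral>\<^sup>+t. ennreal (h t s) * indicator {0..T} t \<partial>lborel) =
        (\<integral>\<^sup>+t. ennreal (indicator {0..T} t *\<^sub>R h t s) \<partial>lborel)"
      by (intro nn_integral_cong) (auto split: split_indicator)
    also have "\<dots> = ennreal (LINT t:{0..T}|lborel. h t s)"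
      unfolding set_lebesgue_integral_def using si h0
      by (intro nn_integral_eq_integral) (auto simp: set_integrable_def split: split_indicator)
    also have "(LINT t:{0..T}|lborel. h t s) = integral {0..T} (\<lambda>t. h t s)"
      by (rule set_borel_integral_eq_integral(2)[OF si])
    finally show ?thesis ..
  qed
  have i0: "0 \<le> integral {0..T} (\<lambda>t. h t s)" for s
    by (intro integral_nonneg integrable_continuous_real cont) (auto intro: h0)
  have iK: "integral {0..T} (\<lambda>t. h t s) \<le> T * K" for s
  proof -
    have "integral {0..T} (\<lambda>t. h t s) \<le> integral {0..T} (\<lambda>_. K)"
      by (intro integral_le integrable_continuous_real cont continuous_on_const) (auto intro: hK)
    then show ?thesis
      using T by simp
  qed
  have cs: "(\<integral>\<^sup>+s. g s \<partial>measure_pmf p) = (\<integral>\<^sup>+s. ennreal (pmf p s) * g s \<partial>count_space (set_pmf p))"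
    for g :: "'s \<Rightarrow> ennreal"
    unfolding nn_integral_measure_pmf
    by (rule nn_integral_count_space_eq) (auto simp: pmf_eq_0_set_pmf)
  have "(\<integral>\<^sup>+s. ennreal (integral {0..T} (\<lambda>t. h t s)) \<partial>measure_pmf p) =
     (\<integral>\<^sup>+s. (\<integral>\<^sup>+t. ennreal (pmf p s) * (ennreal (h t s) * indicator {0..T} t) \<partial>lborel) \<partial>count_space (set_pmf p))"
    unfolding cs int using mh by (intro nn_integral_cong) (simp add: nn_integral_cmult)
  also have "\<dots> = (\<integral>\<^sup>+t. (\<integral>\<^sup>+s. ennreal (pmf p s) * (ennreal (h t s) * indicator {0..T} t) \<partial>count_space (set_pmf p)) \<partial>lborel)"
    using mh by (intro nn_integral_count_space_nn_integral[symmetric]) simp_all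
  also have "\<dots> = (\<integral>\<^sup>+t. ennreal c * indicator {0..T} t \<partial>lborel)"
  proof (intro nn_integral_cong)
    fix t
    show "(\<integral>\<^sup>+s. ennreal (pmf p s) * (ennreal (h t s) * indicator {0..T} t) \<partial>count_space (set_pmf p)) =
        ennreal c * indicator {0..T} t"
    proof (cases "t \<in> {0..T}")
      case True
      have "(\<integral>\<^sup>+s. ennreal (h t s) \<partial>measure_pmf p) = ennreal (\<integral>s. h t s \<partial>measure_pmf p)"
        using True h0 hK
        by (intro nn_integral_eq_integral measure_pmf.integrable_const_bound[of _ K]) auto
      then show ?thesis
        using True by (simp add: cs[symmetric] c)
    qed simp
  qed
  also have "\<dots> = ennreal (T * c)"
    using T c0 by (simp add: nn_integral_cmult ennreal_mult' mult.commute)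
  also have "(\<integral>\<^sup>+s. ennreal (integral {0..T} (\<lambda>t. h t s)) \<partial>measure_pmf p) =
      ennreal (\<integral>s. integral {0..T} (\<lambda>t. h t s) \<partial>measure_pmf p)"
    using i0 iK by (intro nn_integral_eq_integral measure_pmf.integrable_const_bound[of _ "T * K"]) auto
  finally show ?thesis
    using T c0 i0 by (simp add: integral_nonneg_AE)
qed

context jump_rates
begin

lemma gen_add_const: "gen R (\<lambda>s. f s + c) = gen R f"
  by (simp add: gen_def fun_eq_iff)

lemma gen_cmult: "gen R (\<lambda>s. c * f s) s = c * gen R f s"
  by (simp add: gen_def sum_distrib_left algebra_simps)

lemma gen_diff: "gen R (\<lambda>s. f s - g s) s = gen R f s - gen R g s"
  by (simp add: gen_def sum_subtractf[symmetric] algebra_simps)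

lemma gen_add: "gen R (\<lambda>s. f s + g s) s = gen R f s + gen R g s"
  by (simp add: gen_def sum.distrib[symmetric] algebra_simps)

lemma gen_mono_on:
  assumes "\<And>s'. R s s' \<noteq> 0 \<Longrightarrow> f s' \<le> g s'" "f s = g s"
  shows "gen R f s \<le> gen R g s"
  unfolding gen_def using assms rate_nonneg by (intro sum_mono mult_left_mono) auto

lemma gen_nonpos_at_max:
  assumes "\<And>s'. R s s' \<noteq> 0 \<Longrightarrow> f s' \<le> f s"
  shows "gen R f s \<le> 0"
  unfolding gen_def using assms rate_nonneg by (intro sum_nonpos mult_nonneg_nonpos) auto

lemma abs_gen_le:
  assumes "\<And>s'. R s s' \<noteq> 0 \<Longrightarrow> \<bar>f s'\<bar> \<le> K" "\<bar>f s\<bar> \<le> K"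
  shows "\<bar>gen R f s\<bar> \<le> 2 * K * L"
proof -
  have "\<bar>\<integral>s'. f s' \<partial>measure_pmf (J s)\<bar> \<le> K"
  proof -
    have "\<bar>\<integral>s'. f s' \<partial>measure_pmf (J s)\<bar> \<le> (\<integral>s'. \<bar>f s'\<bar> \<partial>measure_pmf (J s))"
      by (rule integral_abs_bound)
    also have "\<dots> \<le> K"
      using assms(1) by (intro measure_pmf.integral_le_const integrable_J) (auto simp: AE_measure_pmf_iff set_pmf_J)
    finally show ?thesis .
  qed
  then have *: "\<bar>(\<integral>s'. f s' \<partial>measure_pmf (J s)) - f s\<bar> \<le> 2 * K"
    using assms(2) by linarith
  have "\<bar>gen R f s\<bar> = \<bar>(\<integral>s'. f s' \<partial>measure_pmf (J s)) - f s\<bar> * r s"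
    using r_pos[of s] by (simp add: gen_eq_J abs_mult)
  also have "\<dots> \<le> 2 * K * L"
    using * exit_le[of s] r_pos[of s] by (intro mult_mono) auto
  finally show ?thesis .
qed

lemma average_at_prob_bounds:
  assumes T: "T > 0"
  shows "0 \<le> integral {0..T} (\<lambda>t. at_prob R A t s) / T" "integral {0..T} (\<lambda>t. at_prob R A t s) / T \<le> 1"
proof -
  have i: "(\<lambda>t. at_prob R A t s) integrable_on {0..T}"
    by (intro integrable_continuous_real continuous_on_at_prob)
  show "0 \<le> integral {0..T} (\<lambda>t. at_prob R A t s) / T"
    using T by (intro divide_nonneg_pos integral_nonneg i) (auto simp: at_prob_bounds)
  have "integral {0..T} (\<lambda>t. at_prob R A t s) \<le> integral {0..T} (\<lambda>t. 1)"
    by (intro integral_le i) (auto simp: at_prob_bounds)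
  then show "integral {0..T} (\<lambda>t. at_prob R A t s) / T \<le> 1"
    using T by simp
qed

end

section \<open>Invariant distributions\<close>

locale closed_rates = jump_rates +
  fixes C :: "'a set"
  assumes closed: "s \<in> C \<Longrightarrow> R s s' \<noteq> 0 \<Longrightarrow> s' \<in> C"
begin

text \<open>The equation \<open>\<pi> Q = 0\<close> in weak form. Functions bounded on
  \<open>C\<close> have generators bounded on \<open>C\<close> by \<open>abs_gen_le_on\<close>, so
  all integrals exist; unbounded functions are reached by truncation in
  \<open>invariant_drift_bound\<close>.\<close>

definition invariant :: "'a pmf \<Rightarrow> bool" where
  "invariant \<pi> \<longleftrightarrow> set_pmf \<pi> \<subseteq> C \<and>
     (\<forall>f K. (\<forall>s\<in>C. \<bar>f s\<bar> \<le> K) \<longrightarrow> (\<integral>s. gen R f s \<partial>measure_pmf \<pi>) = 0)"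

lemma invariantD:
  assumes "invariant \<pi>"
  shows "set_pmf \<pi> \<subseteq> C" "(\<And>s. s \<in> C \<Longrightarrow> \<bar>f s\<bar> \<le> K) \<Longrightarrow> (\<integral>s. gen R f s \<partial>measure_pmf \<pi>) = 0"
  using assms unfolding invariant_def by blast+

lemma integrable_bounded_on:
  fixes f :: "'a \<Rightarrow> real"
  assumes "set_pmf \<pi> \<subseteq> C" "\<And>s. s \<in> C \<Longrightarrow> \<bar>f s\<bar> \<le> K"
  shows "integrable (measure_pmf \<pi>) f"
  using assms by (intro measure_pmf.integrable_const_bound[of _ K]) (auto simp: AE_measure_pmf_iff)

lemma abs_gen_le_on:
  assumes "\<And>s. s \<in> C \<Longrightarrow> \<bar>f s\<bar> \<le> K" "s \<in> C"
  shows "\<bar>gen R f s\<bar> \<le> 2 * K * L"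
  using assms closed by (intro abs_gen_le) auto

text \<open>Invariance restated for the embedded chain: the measure with density \<open>r\<close>
  with respect to \<open>\<pi>\<close> is stationary under \<open>J\<close>.\<close>

lemma invariant_expectation_J:
  assumes inv: "invariant \<pi>" and f: "\<And>s. s \<in> C \<Longrightarrow> \<bar>f s\<bar> \<le> K"
  shows "(\<integral>s. r s * (\<integral>s'. f s' \<partial>measure_pmf (J s)) \<partial>measure_pmf \<pi>) = (\<integral>s. r s * f s \<partial>measure_pmf \<pi>)"
proof -
  note C = invariantD(1)[OF inv]
  have "\<bar>r s * f s\<bar> \<le> L * K" if "s \<in> C" for s
    using f[OF that] exit_le[of s] r_pos[of s] by (auto simp: abs_mult intro!: mult_mono)
  then have i: "integrable (measure_pmf \<pi>) (\<lambda>s. r s * f s)"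
    by (rule integrable_bounded_on[OF C])
  have g: "integrable (measure_pmf \<pi>) (gen R f)"
    by (rule integrable_bounded_on[OF C]) (rule abs_gen_le_on[OF f])
  have "(\<integral>s. r s * (\<integral>s'. f s' \<partial>measure_pmf (J s)) \<partial>measure_pmf \<pi>)
      = (\<integral>s. gen R f s + r s * f s \<partial>measure_pmf \<pi>)"
    by (simp add: gen_eq_J algebra_simps)
  also have "\<dots> = (\<integral>s. r s * f s \<partial>measure_pmf \<pi>)"
    using i g invariantD(2)[OF inv f] by simp
  finally show ?thesis .
qed

text \<open>Balance at \<open>s'\<close>: testing on its indicator equates the flow into
  \<open>s'\<close>, which is at least the positive flow from \<open>s\<close>, with the outflow
  \<open>r s' * pmf \<pi> s'\<close>.\<close>

lemma invariant_pos_step: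
  assumes inv: "invariant \<pi>" and s: "pmf \<pi> s > 0" and R: "R s s' \<noteq> 0" "s \<noteq> s'"
  shows "pmf \<pi> s' > 0"
proof -
  let ?f = "indicator {s'} :: 'a \<Rightarrow> real"
  have J: "(\<integral>x. ?f x \<partial>measure_pmf (J q)) = pmf (J q) s'" for q
    by (simp add: measure_pmf_single)
  have pos: "r s * pmf (J s) s' > 0"
    using R r_pos[of s] rate_nonneg[of s s'] by (simp add: pmf_J less_le)
  have "0 < r s * pmf (J s) s' * pmf \<pi> s"
    using pos s by simp
  also have "\<dots> = (\<integral>x. r s * pmf (J s) s' * indicator {s} x \<partial>measure_pmf \<pi>)"
    by (simp add: measure_pmf_single)
  also have "\<dots> \<le> (\<integral>x. r x * (\<integral>s'. ?f s' \<partial>measure_pmf (J x)) \<partial>measure_pmf \<pi>)"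
  proof (rule integral_mono)
    have "r x * pmf (J x) s' \<le> L * 1" for x
      using exit_le r_pos[of x] by (intro mult_mono pmf_le_1) (auto intro: order_trans[OF less_imp_le[OF r_pos] exit_le])
    then show "integrable (measure_pmf \<pi>) (\<lambda>x. r x * (\<integral>s'. ?f s' \<partial>measure_pmf (J x)))"
      unfolding J using r_pos
      by (intro measure_pmf.integrable_const_bound[of _ L]) (auto simp: abs_mult less_imp_le)
    show "r s * pmf (J s) s' * indicator {s} x \<le> r x * (\<integral>s'. ?f s' \<partial>measure_pmf (J x))" for x
      unfolding J using r_pos[of x] by (auto simp: less_imp_le split: split_indicator)
    show "integrable (measure_pmf \<pi>) (\<lambda>x. r s * pmf (J s) s' * indicator {s} x)"
      using pos by (intro measure_pmf.integrable_const_bound[of _ "r s * pmf (J s) s'"])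
        (auto split: split_indicator)
  qed
  also have "\<dots> = (\<integral>s. r s * ?f s \<partial>measure_pmf \<pi>)"
    by (rule invariant_expectation_J[OF inv, of _ 1]) (simp split: split_indicator)
  also have "\<dots> = (\<integral>x. r s' * indicator {s'} x \<partial>measure_pmf \<pi>)"
    by (intro Bochner_Integration.integral_cong) (auto split: split_indicator)
  also have "\<dots> = r s' * pmf \<pi> s'"
    by (simp add: measure_pmf_single)
  finally show ?thesis
    using r_pos[of s'] by (simp add: zero_less_mult_iff)
qed

text \<open>The backward equation is integrated against \<open>\<pi>\<close>: at each time its
  integrand is the generator of a bounded function and has mean zero.\<close>

lemma invariant_at_prob:
  assumes inv: "invariant \<pi>" and T: "T \<ge> 0"
  shows "(\<integral>s. at_prob R A T s \<partial>measure_pmf \<pi>) = measure_pmf.prob \<pi> A"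
proof -
  note C = invariantD(1)[OF inv]
  have u: "\<bar>at_prob R A t s\<bar> \<le> 1" for t s
    using at_prob_bounds[of R A t s] by simp
  have g: "\<bar>gen R (at_prob R A t) s\<bar> \<le> 2 * L" for t s
    using abs_gen_le[of s "at_prob R A t" 1] u by simp
  \<comment> \<open>Adding the bound \<open>2 * L\<close> makes the integrand nonnegative, as
    \<open>expectation_integral_swap\<close> requires.\<close>
  let ?h = "\<lambda>t s. gen R (at_prob R A t) s + 2 * L"
  have I: "integral {0..T} (\<lambda>t. ?h t s) = at_prob R A T s - indicator A s + 2 * L * T" for s
    using has_integral_add[OF at_prob_forward[OF T, of A s] has_integral_const_real[of "2 * L" 0 T]] T
    by (simp add: integral_unique mult.commute)
  have "(\<integral>s. integral {0..T} (\<lambda>t. ?h t s) \<partial>measure_pmf \<pi>) = T * (2 * L)"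
  proof (rule expectation_integral_swap[OF T])
    fix t s
    show "0 \<le> ?h t s" "?h t s \<le> 4 * L"
      using g[of t s] by linarith+
    show "(\<integral>s. ?h t s \<partial>measure_pmf \<pi>) = 2 * L"
      using invariantD(2)[OF inv, of "at_prob R A t" 1] u integrable_bounded_on[OF C g]
      by simp
  qed (intro continuous_intros continuous_on_gen_at_prob)
  moreover have "(\<integral>s. integral {0..T} (\<lambda>t. ?h t s) \<partial>measure_pmf \<pi>) =
      (\<integral>s. at_prob R A T s \<partial>measure_pmf \<pi>) - measure_pmf.prob \<pi> A + 2 * L * T"
  proof -
    have "integrable (measure_pmf \<pi>) (at_prob R A T)"
      by (rule integrable_bounded_on[OF C u])
    moreover have "integrable (measure_pmf \<pi>) (indicat_real A)"
      by (rule measure_pmf.integrable_const_bound[of _ 1]) (auto split: split_indicator)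
    ultimately show ?thesis
      unfolding I by simp
  qed
  ultimately show ?thesis
    by simp
qed

text \<open>\<open>V\<close> may fail to be integrable, so \<open>min V M\<close> is tested instead.
  Below level \<open>M\<close> its generator is at most that of \<open>V\<close>; at or above the
  level \<open>min V M\<close> is at its maximum and the generator is nonpositive. Since
  \<open>\<phi>\<close> is bounded, dominated convergence lets \<open>M\<close> tend to
  infinity.\<close>

lemma invariant_drift_bound:
  assumes inv: "invariant \<pi>" and V: "\<And>s. s \<in> C \<Longrightarrow> V s \<ge> 0"
    and drift: "\<And>s. s \<in> C \<Longrightarrow> gen R V s \<le> \<phi> s" and \<phi>: "\<And>s. s \<in> C \<Longrightarrow> \<bar>\<phi> s\<bar> \<le> K"
  shows "0 \<le> (\<integral>s. \<phi> s \<partial>measure_pmf \<pi>)"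
proof -
  note C = invariantD(1)[OF inv]
  let ?I = "\<lambda>M s. if V s < real M then 1 else 0 :: real"
  have K: "K \<ge> 0"
  proof -
    obtain s where "s \<in> set_pmf \<pi>"
      using set_pmf_not_empty[of \<pi>] by blast
    then show ?thesis
      using C \<phi>[of s] by (auto intro: order_trans[OF abs_ge_zero])
  qed
  have le: "0 \<le> (\<integral>s. ?I M s * \<phi> s \<partial>measure_pmf \<pi>)" for M :: nat
  proof -
    let ?V = "\<lambda>s. min (V s) (real M)"
    have b: "\<bar>?V s\<bar> \<le> real M" if "s \<in> C" for s
      using V[OF that] by simp
    have "0 = (\<integral>s. gen R ?V s \<partial>measure_pmf \<pi>)"
      using invariantD(2)[OF inv b] by simp
    also have "\<dots> \<le> (\<integral>s. ?I M s * \<phi> s \<partial>measure_pmf \<pi>)"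
    proof (rule integral_mono_AE)
      show "integrable (measure_pmf \<pi>) (gen R ?V)"
        by (rule integrable_bounded_on[OF C]) (rule abs_gen_le_on[OF b])
      show "integrable (measure_pmf \<pi>) (\<lambda>s. ?I M s * \<phi> s)"
        using \<phi> K by (intro integrable_bounded_on[OF C, of _ K]) auto
      show "AE s in measure_pmf \<pi>. gen R ?V s \<le> ?I M s * \<phi> s"
        unfolding AE_measure_pmf_iff
      proof
        fix s assume "s \<in> set_pmf \<pi>"
        then have s: "s \<in> C" using C by auto
        show "gen R ?V s \<le> ?I M s * \<phi> s"
        proof (cases "V s < real M")
          case True
          then have "gen R ?V s \<le> gen R V s"
            by (intro gen_mono_on) auto
          then show ?thesis
            using True drift[OF s] by simp
        next
          case False
          then show ?thesis
            using gen_nonpos_at_max[of s ?V] by simp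
        qed
      qed
    qed
    finally show ?thesis .
  qed
  have "(\<lambda>M. \<integral>s. ?I M s * \<phi> s \<partial>measure_pmf \<pi>) \<longlonglongrightarrow> (\<integral>s. \<phi> s \<partial>measure_pmf \<pi>)"
  proof (rule integral_dominated_convergence[where w = "\<lambda>_. K"])
    show "AE s in measure_pmf \<pi>. (\<lambda>M. ?I M s * \<phi> s) \<longlonglongrightarrow> \<phi> s"
    proof (rule AE_I2)
      fix s
      obtain N where "V s < real N"
        using reals_Archimedean2 by blast
      then have "eventually (\<lambda>M. ?I M s * \<phi> s = \<phi> s) sequentially"
        unfolding eventually_sequentially by (intro exI[of _ N]) auto
      then show "(\<lambda>M. ?I M s * \<phi> s) \<longlonglongrightarrow> \<phi> s"
        by (rule tendsto_eventually)
    qed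
    show "AE s in measure_pmf \<pi>. norm (?I M s * \<phi> s) \<le> K" for M
      using C \<phi> K by (auto simp: AE_measure_pmf_iff)
  qed auto
  then show ?thesis
    using le by (intro LIMSEQ_le_const) auto
qed

end

section \<open>Uniqueness by a maximum principle and time averages\<close>

locale lyapunov_rates = closed_rates +
  fixes z :: 'a and W :: "'a \<Rightarrow> real" and e :: real
  assumes z: "z \<in> C" and W_nonneg: "s \<in> C \<Longrightarrow> 0 \<le> W s" and e: "0 < e"
    and drift: "s \<in> C \<Longrightarrow> s \<noteq> z \<Longrightarrow> gen R W s \<le> - e"
    and finite_sublevel: "finite {s \<in> C. W s \<le> c}"
begin

text \<open>Maximum principle: \<^term>\<open>\<lambda>s. h s - (2 * \<delta> / e) * W s\<close> can only attain its maximum at \<^term>\<open>z\<close>.\<close>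

lemma gen_small_imp_le:
  assumes h: "\<And>s. s \<in> C \<Longrightarrow> \<bar>h s\<bar> \<le> K" and hz: "h z = 0" and \<delta>: "\<delta> > 0"
    and g: "\<And>s. s \<in> C \<Longrightarrow> \<bar>gen R h s\<bar> \<le> \<delta>" and q: "q \<in> C"
  shows "h q \<le> 2 * \<delta> / e * W q"
proof -
  \<comment> \<open>The factor 2 leaves a strict surplus: away from \<open>z\<close> the generator
    of \<open>\<phi>\<close> is at least \<open>2 * \<delta> - \<delta> > 0\<close>, which a maximum
    forbids.\<close>
  define c where "c = 2 * \<delta> / e"
  have c: "c > 0" "c * e = 2 * \<delta>"
    using \<delta> e by (auto simp: c_def)
  define \<phi> where "\<phi> s = h s - c * W s" for s
  let ?S = "{s \<in> C. \<phi> z \<le> \<phi> s}"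
  \<comment> \<open>\<open>h\<close> is bounded, so \<open>W\<close> is bounded on the superlevel
    set of \<open>\<phi>\<close>; this makes the set finite and the maximum attained.\<close>
  have "?S \<subseteq> {s \<in> C. W s \<le> (K - \<phi> z) / c}"
  proof safe
    fix s assume s: "s \<in> C" "\<phi> z \<le> \<phi> s"
    then have "c * W s \<le> K - \<phi> z"
      using h[OF s(1)] by (simp add: \<phi>_def)
    then show "W s \<le> (K - \<phi> z) / c"
      using c by (simp add: pos_le_divide_eq mult.commute)
  qed
  then have fin: "finite ?S"
    by (rule finite_subset[OF _ finite_sublevel])
  have "z \<in> ?S"
    using z by simp
  with fin have "Max (\<phi> ` ?S) \<in> \<phi> ` ?S"
    by (intro Max_in) auto
  then obtain m where m: "m \<in> ?S" "\<phi> m = Max (\<phi> ` ?S)"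
    by (metis (no_types, lifting) imageE)
  have m2: "\<phi> s \<le> \<phi> m" if "s \<in> ?S" for s
    unfolding m(2) using fin that by (intro Max_ge) auto
  have max: "\<phi> s \<le> \<phi> m" if "s \<in> C" for s
    using m(1) m2[of s] that by (cases "\<phi> z \<le> \<phi> s") auto
  have "m = z"
  proof (rule ccontr)
    assume "m \<noteq> z"
    have mC: "m \<in> C"
      using m(1) by simp
    have "gen R \<phi> m \<le> 0"
      using max closed[OF mC] by (intro gen_nonpos_at_max) auto
    moreover have "gen R \<phi> m = gen R h m - c * gen R W m"
      unfolding \<phi>_def by (simp add: gen_diff gen_cmult)
    moreover have "c * gen R W m \<le> c * (- e)"
      using drift[OF mC \<open>m \<noteq> z\<close>] c by (intro mult_left_mono) auto
    ultimately show False
      using g[OF mC] c(2) \<delta> by auto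
  qed
  then have "\<phi> q \<le> \<phi> z"
    using max[OF q] by simp
  also have "\<dots> \<le> 0"
    using hz c W_nonneg[OF z] by (simp add: \<phi>_def)
  finally show ?thesis
    by (simp add: \<phi>_def c_def)
qed

text \<open>Averaging turns the backward equation into
  \<open>gen R g = (at_prob R A T - indicator A) / T\<close>, of size at most \<open>1 / T\<close>.
  The maximum principle is applied to the average and to its negative, both normalised to vanish at
  \<open>z\<close>.\<close>

lemma average_at_prob_close:
  assumes q: "q \<in> C" and T: "T > 0"
  shows "\<bar>integral {0..T} (\<lambda>t. at_prob R A t q) / T - integral {0..T} (\<lambda>t. at_prob R A t z) / T\<bar> \<le> 2 / (T * e) * W q"
proof -
  define g where "g s = integral {0..T} (\<lambda>t. at_prob R A t s) / T" for s
  have i: "(\<lambda>t. at_prob R A t s) integrable_on {0..T}" for s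
    by (intro integrable_continuous_real continuous_on_at_prob)
  have g01: "0 \<le> g s" "g s \<le> 1" for s
    unfolding g_def using average_at_prob_bounds[OF T] by auto
  have gen_g: "gen R g s = (at_prob R A T s - indicator A s) / T" for s
  proof -
    have "gen R g s = (\<Sum>s' | R s s' \<noteq> 0. R s s' * (integral {0..T} (\<lambda>t. at_prob R A t s') - integral {0..T} (\<lambda>t. at_prob R A t s)) / T)"
      unfolding gen_def g_def by (simp add: diff_divide_distrib[symmetric])
    also have "\<dots> = (\<Sum>s' | R s s' \<noteq> 0. integral {0..T} (\<lambda>t. R s s' * (at_prob R A t s' - at_prob R A t s))) / T"
      by (simp add: sum_divide_distrib integral_diff[OF i i])
    also have "\<dots> = integral {0..T} (\<lambda>t. gen R (at_prob R A t) s) / T"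
      unfolding gen_def
      by (subst integral_sum) (auto simp: finite_rates intro!: integrable_continuous_real continuous_intros continuous_on_at_prob)
    also have "\<dots> = (at_prob R A T s - indicator A s) / T"
      using integral_unique[OF at_prob_forward[of T A s]] T by simp
    finally show ?thesis .
  qed
  have gb: "\<bar>gen R g s\<bar> \<le> 1 / T" for s
    unfolding gen_g using T at_prob_bounds[of R A T s]
    by (auto simp: abs_le_iff divide_right_mono minus_divide_left split: split_indicator)
  have 1: "g q - g z \<le> 2 * (1 / T) / e * W q"
  proof (rule gen_small_imp_le[where h = "\<lambda>s. g s - g z" and K = 1])
    show "\<bar>gen R (\<lambda>s. g s - g z) s\<bar> \<le> 1 / T" for s
      using gb[of s] gen_add_const[of g "- g z"] by simp
    show "\<bar>g s - g z\<bar> \<le> 1" for s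
      using g01[of s] g01[of z] by simp
  qed (use T q in auto)
  have 2: "- g q - (- g z) \<le> 2 * (1 / T) / e * W q"
  proof (rule gen_small_imp_le[where h = "\<lambda>s. - g s - (- g z)" and K = 1])
    show "\<bar>gen R (\<lambda>s. - g s - (- g z)) s\<bar> \<le> 1 / T" for s
      using gb[of s] gen_cmult[of "-1" g s] gen_add_const[of "\<lambda>s. - g s" "g z"] by simp
    show "\<bar>- g s - (- g z)\<bar> \<le> 1" for s
      using g01[of s] g01[of z] by simp
  qed (use T q in auto)
  show ?thesis
    using 1 2 by (simp add: g_def abs_le_iff)
qed

text \<open>The averages from \<open>s\<close> and from \<open>z\<close> merge pointwise by
  \<open>average_at_prob_close\<close>. \<open>W\<close> may have infinite mean under
  \<open>p\<close>, but the differences are bounded by 1, so dominated convergence applies.\<close>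

lemma average_at_prob_limit:
  assumes p: "set_pmf p \<subseteq> C" and c: "\<And>t. t \<ge> 0 \<Longrightarrow> (\<integral>s. at_prob R A t s \<partial>measure_pmf p) = c"
  shows "(\<lambda>N. integral {0..real (Suc N)} (\<lambda>t. at_prob R A t z) / real (Suc N)) \<longlonglongrightarrow> c"
proof -
  define g where "g N s = integral {0..real (Suc N)} (\<lambda>t. at_prob R A t s) / real (Suc N)" for N s
  have g01: "0 \<le> g N s" "g N s \<le> 1" for N s
    unfolding g_def using average_at_prob_bounds[of "real (Suc N)"] by auto
  have Eg: "(\<integral>s. g N s \<partial>measure_pmf p) = c" for N
  proof -
    have "(\<integral>s. integral {0..real (Suc N)} (\<lambda>t. at_prob R A t s) \<partial>measure_pmf p) = real (Suc N) * c"
      by (rule expectation_integral_swap[where K = 1]) (auto simp: at_prob_bounds continuous_on_at_prob c)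
    then show ?thesis
      by (simp add: g_def)
  qed
  have "(\<lambda>N. \<integral>s. g N s - g N z \<partial>measure_pmf p) \<longlonglongrightarrow> (\<integral>s. 0 \<partial>measure_pmf p)"
  proof (rule integral_dominated_convergence[where w = "\<lambda>_. 1"])
    show "AE s in measure_pmf p. (\<lambda>N. g N s - g N z) \<longlonglongrightarrow> 0"
      unfolding AE_measure_pmf_iff
    proof
      fix s assume "s \<in> set_pmf p"
      then have s: "s \<in> C" using p by auto
      have "(\<lambda>N. 2 * W s / e * (1 / real (Suc N))) \<longlonglongrightarrow> 2 * W s / e * 0"
        by (intro tendsto_mult tendsto_const LIMSEQ_Suc lim_1_over_n)
      then have lim: "(\<lambda>N. 2 * W s / e * (1 / real (Suc N))) \<longlonglongrightarrow> 0"
        by simp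
      show "(\<lambda>N. g N s - g N z) \<longlonglongrightarrow> 0"
      proof (rule tendsto_0_le[OF lim, where K = 1], rule always_eventually, rule allI)
        fix N
        have "\<bar>g N s - g N z\<bar> \<le> 2 / (real (Suc N) * e) * W s"
          unfolding g_def by (rule average_at_prob_close[OF s]) simp
        also have "\<dots> = 2 * W s / e * (1 / real (Suc N))"
          by simp
        finally show "norm (g N s - g N z) \<le> norm (2 * W s / e * (1 / real (Suc N))) * 1"
          unfolding real_norm_def mult_1_right by (rule order_trans[OF _ abs_ge_self])
      qed
    qed
    have "norm (g N s - g N z) \<le> 1" for N s
      using g01[of N s] g01[of N z] by simp
    then show "AE s in measure_pmf p. norm (g N s - g N z) \<le> 1" for N
      by simp
  qed auto
  moreover have "(\<integral>s. g N s - g N z \<partial>measure_pmf p) = c - g N z" for N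
  proof -
    have "integrable (measure_pmf p) (g N)"
      using g01[of N] by (intro measure_pmf.integrable_const_bound[of _ 1]) auto
    then show ?thesis
      using Eg[of N] by simp
  qed
  ultimately have "(\<lambda>N. c - (c - g N z)) \<longlonglongrightarrow> c - 0"
    by (intro tendsto_diff tendsto_const) simp
  then show ?thesis
    by (simp add: g_def)
qed

text \<open>Both numbers are limits of the same averages started in \<open>z\<close>; the initial
  laws have dropped out.\<close>

lemma invariant_unique:
  assumes "invariant \<pi>" "set_pmf p \<subseteq> C" "\<And>t. t \<ge> 0 \<Longrightarrow> (\<integral>s. at_prob R A t s \<partial>measure_pmf p) = c"
  shows "c = measure_pmf.prob \<pi> A"
  using average_at_prob_limit[OF assms(2,3)]
    average_at_prob_limit[OF invariantD(1)[OF assms(1)] invariant_at_prob[OF assms(1)]]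
  by (rule LIMSEQ_unique)

end

lemma suminf_ennreal_Suc: "(\<Sum>n. f n :: ennreal) = (\<Sum>n. f (Suc n)) + f 0"
  by (rule sums_unique[symmetric], rule sums_Suc, rule summable_sums) simp

context lyapunov_rates
begin

subsection \<open>Existence\<close>

text \<open>
  The embedded jump chain started in \<^term>\<open>z\<close> and killed (state \<^term>\<open>None\<close>) when it
  returns there. Its expected occupation times, divided by the exit rates, are the invariant weights.
\<close>

definition excursion_step :: "'a option \<Rightarrow> 'a option pmf" where
  "excursion_step y = (case y of None \<Rightarrow> return_pmf None
     | Some s \<Rightarrow> map_pmf (\<lambda>s'. if s' = z then None else Some s') (J s))"

fun excursion :: "nat \<Rightarrow> 'a option pmf" where
  "excursion 0 = return_pmf (Some z)"
| "excursion (Suc m) = bind_pmf (excursion m) excursion_step"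

abbreviation lift_fun :: "('a \<Rightarrow> ennreal) \<Rightarrow> 'a option \<Rightarrow> ennreal" where
  "lift_fun f y \<equiv> (case y of None \<Rightarrow> 0 | Some s \<Rightarrow> f s)"

text \<open>Killed paths contribute zero, so \<open>mean_at m (\<lambda>_. 1)\<close> is the
  probability that the excursion is still running after \<open>m\<close> jumps.\<close>

definition mean_at :: "nat \<Rightarrow> ('a \<Rightarrow> ennreal) \<Rightarrow> ennreal" where
  "mean_at m f = (\<integral>\<^sup>+y. lift_fun f y \<partial>measure_pmf (excursion m))"

lemma set_excursion: "y \<in> set_pmf (excursion m) \<Longrightarrow> y = None \<or> (\<exists>s\<in>C. y = Some s \<and> (m > 0 \<longrightarrow> s \<noteq> z))"
proof (induction m arbitrary: y)
  case (Suc m)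
  then obtain x where x: "x \<in> set_pmf (excursion m)" "y \<in> set_pmf (excursion_step x)"
    by auto
  from Suc.IH[OF x(1)] x(2) show ?case
    using closed by (auto simp: excursion_step_def set_pmf_J split: if_splits)
qed (use z in auto)

lemma mean_at_Suc:
  "mean_at (Suc m) f = mean_at m (\<lambda>s. \<integral>\<^sup>+s'. (if s' = z then 0 else f s') \<partial>measure_pmf (J s))"
  unfolding mean_at_def excursion.simps nn_integral_bind_pmf
  by (intro nn_integral_cong) (auto simp: excursion_step_def if_distrib cong: if_cong split: option.split)

lemma mean_at_mono:
  assumes "\<And>s. s \<in> C \<Longrightarrow> (m > 0 \<Longrightarrow> s \<noteq> z) \<Longrightarrow> f s \<le> g s"
  shows "mean_at m f \<le> mean_at m g"
  unfolding mean_at_def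
  by (rule nn_integral_mono_AE) (use assms set_excursion[of _ m] in \<open>fastforce simp: AE_measure_pmf_iff\<close>)

lemma mean_at_add: "mean_at m (\<lambda>s. f s + g s) = mean_at m f + mean_at m g"
  unfolding mean_at_def by (subst nn_integral_add[symmetric]) (auto intro!: nn_integral_cong split: option.split)

lemma mean_at_cmult: "mean_at m (\<lambda>s. c * f s) = c * mean_at m f"
  unfolding mean_at_def by (subst nn_integral_cmult[symmetric]) (auto intro!: nn_integral_cong split: option.split)

lemma mean_at_0: "mean_at 0 f = f z"
  by (simp add: mean_at_def)

lemma mean_at_eq: "mean_at m f = (\<integral>\<^sup>+s. ennreal (pmf (excursion m) (Some s)) * f s \<partial>count_space UNIV)"
proof -
  have "mean_at m f = (\<integral>\<^sup>+y. ennreal (pmf (excursion m) y) * lift_fun f y \<partial>count_space UNIV)"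
    by (simp add: mean_at_def nn_integral_measure_pmf)
  also have "\<dots> = (\<integral>\<^sup>+y. ennreal (pmf (excursion m) y) * lift_fun f y \<partial>count_space (range Some))"
    by (rule nn_integral_count_space_eq) (auto simp: notin_range_Some)
  also have "\<dots> = (\<integral>\<^sup>+s. ennreal (pmf (excursion m) (Some s)) * f s \<partial>count_space UNIV)"
    by (subst nn_integral_bij_count_space[symmetric, of Some UNIV]) (auto simp: bij_betw_def)
  finally show ?thesis .
qed

text \<open>Drift per jump instead of per unit of time: dividing by \<open>r s\<close>, which is at
  most \<open>L\<close>, leaves a decrease of at least \<open>e / L\<close>. Killing at
  \<open>z\<close> can only lower the mean, since \<open>W\<close> is nonnegative.\<close>

lemma drift_J:
  assumes "s \<in> C" "s \<noteq> z"
  shows "(\<integral>\<^sup>+s'. (if s' = z then 0 else ennreal (W s')) \<partial>measure_pmf (J s)) + ennreal (e / L) \<le> ennreal (W s)"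
proof -
  have nn: "0 \<le> W s'" if "s' \<in> set_pmf (J s)" for s'
    using that closed[OF assms(1)] W_nonneg by (auto simp: set_pmf_J)
  have L: "L > 0"
    using exit_le[of z] r_pos[of z] by linarith
  have "(\<integral>\<^sup>+s'. (if s' = z then 0 else ennreal (W s')) \<partial>measure_pmf (J s)) \<le> (\<integral>\<^sup>+s'. ennreal (W s') \<partial>measure_pmf (J s))"
    by (intro nn_integral_mono) auto
  also have "\<dots> = ennreal (\<integral>s'. W s' \<partial>measure_pmf (J s))"
    by (intro nn_integral_eq_integral integrable_J) (auto simp: AE_measure_pmf_iff nn)
  finally have 1: "(\<integral>\<^sup>+s'. (if s' = z then 0 else ennreal (W s')) \<partial>measure_pmf (J s)) \<le> ennreal (\<integral>s'. W s' \<partial>measure_pmf (J s))" .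
  have "(\<integral>s'. W s' \<partial>measure_pmf (J s)) + e / L \<le> W s"
  proof -
    have "r s * ((\<integral>s'. W s' \<partial>measure_pmf (J s)) - W s) \<le> - e"
      using drift[OF assms] by (simp add: gen_eq_J)
    then have "e / r s \<le> W s - (\<integral>s'. W s' \<partial>measure_pmf (J s))"
      unfolding pos_divide_le_eq[OF r_pos] by (simp add: algebra_simps)
    moreover have "e / L \<le> e / r s"
      using e L r_pos[of s] exit_le[of s] by (intro divide_left_mono) auto
    ultimately show ?thesis by simp
  qed
  moreover have "0 \<le> (\<integral>s'. W s' \<partial>measure_pmf (J s))"
    by (intro integral_nonneg_AE) (auto simp: AE_measure_pmf_iff nn)
  ultimately have "ennreal (\<integral>s'. W s' \<partial>measure_pmf (J s)) + ennreal (e / L) \<le> ennreal (W s)"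
    using e L by (simp add: ennreal_plus[symmetric] ennreal_leI del: ennreal_plus)
  then show ?thesis
    using 1 by (meson add_right_mono order_trans)
qed

lemma excursion_length_finite: "(\<Sum>m. mean_at m (\<lambda>_. 1)) < \<infinity>"
proof -
  define w where "w m = mean_at (Suc m) (\<lambda>s. ennreal (W s))" for m
  define a where "a m = mean_at (Suc m) (\<lambda>_. 1)" for m
  define c where "c = ennreal (e / L)"
  have L: "L > 0"
    using exit_le[of z] r_pos[of z] by linarith
  have step: "w (Suc m) + c * a m \<le> w m" for m
  proof -
    have "w (Suc m) + c * a m = mean_at (Suc m) (\<lambda>s. (\<integral>\<^sup>+s'. (if s' = z then 0 else ennreal (W s')) \<partial>measure_pmf (J s)) + c * 1)"
      unfolding w_def a_def mean_at_Suc[of "Suc m"] by (simp only: mean_at_add mean_at_cmult)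
    also have "\<dots> \<le> w m"
      unfolding w_def by (rule mean_at_mono) (use drift_J in \<open>auto simp: c_def\<close>)
    finally show ?thesis .
  qed
  have sum: "w M + c * (\<Sum>m<M. a m) \<le> w 0" for M
  proof (induction M)
    case (Suc M)
    have "w (Suc M) + c * (\<Sum>m<Suc M. a m) = (w (Suc M) + c * a M) + c * (\<Sum>m<M. a m)"
      by (simp add: distrib_left ac_simps)
    also have "\<dots> \<le> w M + c * (\<Sum>m<M. a m)"
      by (intro add_right_mono step)
    finally show ?case
      using Suc by order
  qed simp
  have w0: "w 0 < \<infinity>"
  proof -
    have "w 0 = (\<integral>\<^sup>+s'. (if s' = z then 0 else ennreal (W s')) \<partial>measure_pmf (J z))"
      by (simp add: w_def mean_at_Suc mean_at_0)
    also have "\<dots> = (\<Sum>s'\<in>set_pmf (J z). (if s' = z then 0 else ennreal (W s')) * ennreal (pmf (J z) s'))"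
      by (rule nn_integral_measure_pmf_finite[OF finite_set_J]) simp
    also have "\<dots> < \<infinity>"
      by (auto simp: ennreal_mult_less_top finite_set_J)
    finally show ?thesis .
  qed
  have "c * (\<Sum>m<M. a m) \<le> w 0" for M
    using order_trans[OF _ sum[of M]] by simp
  then have "c * (\<Sum>m. a m) \<le> w 0"
    unfolding ennreal_suminf_cmult[symmetric]
    by (intro suminf_le_const) (simp_all add: sum_distrib_left[symmetric])
  then have "c * (\<Sum>m. a m) < \<infinity>"
    using w0 by order
  moreover have "c > 0"
    using e L by (simp add: c_def)
  ultimately have "(\<Sum>m. a m) < \<infinity>"
    by (auto simp: ennreal_mult_less_top less_top ennreal_mult_eq_top_iff)
  moreover have "(\<Sum>m. mean_at m (\<lambda>_. 1)) = (\<Sum>m. a m) + mean_at 0 (\<lambda>_. 1)"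
    unfolding a_def by (rule suminf_ennreal_Suc)
  ultimately show ?thesis
    by (simp add: mean_at_0)
qed

text \<open>Expected sum of \<open>f\<close> along one excursion, counting the start in
  \<open>z\<close> but not the return.\<close>

definition occupation :: "('a \<Rightarrow> ennreal) \<Rightarrow> ennreal" where
  "occupation f = (\<Sum>m. mean_at m f)"

text \<open>One more jump removes the initial visit to \<open>z\<close> from the cycle and adds the
  final return to \<open>z\<close>. The sum over the cycle is unchanged because the return happens
  almost surely.\<close>

lemma occupation_J: "occupation (\<lambda>s. \<integral>\<^sup>+s'. f s' \<partial>measure_pmf (J s)) = occupation f"
proof -
  let ?k = "\<lambda>s. ennreal (pmf (J s) z)"
  have split: "(\<integral>\<^sup>+s'. f s' \<partial>measure_pmf (J s)) =
      (\<integral>\<^sup>+s'. (if s' = z then 0 else f s') \<partial>measure_pmf (J s)) + f z * ?k s" for s f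
  proof -
    have "(\<integral>\<^sup>+s'. f s' \<partial>measure_pmf (J s)) =
        (\<integral>\<^sup>+s'. (if s' = z then 0 else f s') + f z * indicator {z} s' \<partial>measure_pmf (J s))"
      by (intro nn_integral_cong) auto
    then show ?thesis
      by (simp add: nn_integral_add nn_integral_cmult emeasure_pmf_single)
  qed
  have J: "mean_at m (\<lambda>s. \<integral>\<^sup>+s'. f s' \<partial>measure_pmf (J s)) = mean_at (Suc m) f + f z * mean_at m ?k" for m f
    unfolding split[where f = f] mean_at_Suc by (simp only: mean_at_add mean_at_cmult)
  have J1: "mean_at m (\<lambda>_. 1) = mean_at (Suc m) (\<lambda>_. 1) + mean_at m ?k" for m
    using J[of m "\<lambda>_. 1"] by simp
  have "(\<Sum>m. mean_at (Suc m) (\<lambda>_. 1)) < \<infinity>"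
  proof -
    have "(\<Sum>m. mean_at m (\<lambda>_. 1)) = (\<Sum>m. mean_at (Suc m) (\<lambda>_. 1)) + mean_at 0 (\<lambda>_. 1)"
      by (rule suminf_ennreal_Suc)
    then show ?thesis
      using excursion_length_finite by (auto simp: less_top)
  qed
  moreover have "(\<Sum>m. mean_at (Suc m) (\<lambda>_. 1)) + 1 = (\<Sum>m. mean_at (Suc m) (\<lambda>_. 1)) + (\<Sum>m. mean_at m ?k)"
  proof -
    have "(\<Sum>m. mean_at (Suc m) (\<lambda>_. 1)) + 1 = (\<Sum>m. mean_at m (\<lambda>_. 1))"
      by (subst (2) suminf_ennreal_Suc) (simp_all add: mean_at_0)
    also have "\<dots> = (\<Sum>m. mean_at (Suc m) (\<lambda>_. 1) + mean_at m ?k)"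
      by (rule suminf_cong) (rule J1)
    also have "\<dots> = (\<Sum>m. mean_at (Suc m) (\<lambda>_. 1)) + (\<Sum>m. mean_at m ?k)"
      by (rule suminf_add[symmetric]) auto
    finally show ?thesis .
  qed
  \<comment> \<open>Finiteness of the expected length licenses cancelling the series in
    \<open>ennreal\<close>; what remains says that the excursion returns with probability
    one.\<close>
  ultimately have k: "(\<Sum>m. mean_at m ?k) = 1"
    unfolding ennreal_add_left_cancel by auto
  have "occupation (\<lambda>s. \<integral>\<^sup>+s'. f s' \<partial>measure_pmf (J s)) = (\<Sum>m. mean_at (Suc m) f) + f z * (\<Sum>m. mean_at m ?k)"
    unfolding occupation_def J by (subst suminf_add[symmetric]) auto
  also have "\<dots> = occupation f"
    unfolding occupation_def k by (subst (2) suminf_ennreal_Suc) (simp_all add: mean_at_0)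
  finally show ?thesis .
qed

lemma occupation_cmult: "occupation (\<lambda>s. c * f s) = c * occupation f"
  by (simp add: occupation_def mean_at_cmult)

lemma occupation_mono: "(\<And>s. s \<in> C \<Longrightarrow> f s \<le> g s) \<Longrightarrow> occupation f \<le> occupation g"
  unfolding occupation_def by (intro suminf_le mean_at_mono) auto

definition weight :: "'a \<Rightarrow> ennreal" where
  "weight s = (\<Sum>m. ennreal (pmf (excursion m) (Some s))) / ennreal (r s)"

lemma occupation_eq: "occupation f = (\<integral>\<^sup>+s. weight s * (ennreal (r s) * f s) \<partial>count_space UNIV)"
proof -
  have "occupation f = (\<integral>\<^sup>+s. (\<Sum>m. ennreal (pmf (excursion m) (Some s)) * f s) \<partial>count_space UNIV)"
    unfolding occupation_def mean_at_eq by (rule nn_integral_suminf[symmetric]) simp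
  also have "\<dots> = (\<integral>\<^sup>+s. weight s * (ennreal (r s) * f s) \<partial>count_space UNIV)"
  proof (intro nn_integral_cong)
    fix s
    have "weight s * ennreal (r s) = (\<Sum>m. ennreal (pmf (excursion m) (Some s)))"
      using r_pos[of s] by (simp add: weight_def ennreal_times_divide mult.commute[of _ "ennreal (r s)"])
        (simp add: mult.commute[of "ennreal (r s)"] mult_divide_eq_ennreal)
    then show "(\<Sum>m. ennreal (pmf (excursion m) (Some s)) * f s) = weight s * (ennreal (r s) * f s)"
      by (simp add: mult.assoc[symmetric])
  qed
  finally show ?thesis .
qed

text \<open>\<open>Z\<close> is the mean duration of an excursion, finite by
  \<open>excursion_length_finite\<close> and the bound \<open>1 / l\<close> on mean holding times.
  After normalisation a factor \<open>r s\<close> cancels the division in \<open>weight\<close>, and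
  invariance becomes \<open>occupation_J\<close>.\<close>

lemma invariant_exists: "\<exists>\<pi>. invariant \<pi>"
proof -
  define Z where "Z = (\<integral>\<^sup>+s. weight s \<partial>count_space UNIV)"
  have Z: "Z = occupation (\<lambda>s. 1 / ennreal (r s))"
  proof -
    have "ennreal (r s) \<noteq> 0" for s
      using r_pos[of s] by simp
    then show ?thesis
      unfolding Z_def occupation_eq
      by (intro nn_integral_cong) (simp add: ennreal_times_divide mult_divide_eq_ennreal)
  qed
  have "Z \<le> occupation (\<lambda>s. ennreal (1 / l) * 1)"
    unfolding Z
  proof (rule occupation_mono)
    fix s
    have "1 / ennreal (r s) = ennreal (1 / r s)"
      using divide_ennreal[of 1 "r s"] r_pos[of s] by simp
    also have "\<dots> \<le> ennreal (1 / l)"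
      using exit_ge[of s] l_pos r_pos[of s] by (intro ennreal_leI divide_left_mono) auto
    finally show "1 / ennreal (r s) \<le> ennreal (1 / l) * 1"
      by simp
  qed
  also have "\<dots> < \<infinity>"
    unfolding occupation_cmult using excursion_length_finite
    by (simp add: occupation_def ennreal_mult_less_top)
  finally have Z_fin: "Z < \<infinity>" .
  have Z_pos: "Z > 0"
  proof -
    have "mean_at 0 (\<lambda>s. 1 / ennreal (r s)) \<le> Z"
      unfolding Z occupation_def by (subst suminf_ennreal_Suc) simp
    moreover have "0 < 1 / ennreal (r z)"
      by (simp add: ennreal_zero_less_divide)
    ultimately show ?thesis
      by (simp add: mean_at_0 order_less_le_trans)
  qed
  have w_fin: "weight s \<noteq> \<infinity>" for s
  proof -
    have "weight s \<le> Z"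
      unfolding Z_def by (rule nn_integral_ge_point) simp
    then show ?thesis
      using Z_fin by auto
  qed
  define \<pi> where "\<pi> = embed_pmf (\<lambda>s. enn2real (weight s / Z))"
  have wZ: "ennreal (enn2real (weight s / Z)) = weight s / Z" for s
  proof (rule ennreal_enn2real)
    have "weight s / Z \<noteq> top"
      using w_fin[of s] Z_pos by (auto simp: ennreal_divide_eq_top_iff)
    then show "weight s / Z < top"
      by (simp only: less_top)
  qed
  have pmf\<pi>: "ennreal (pmf \<pi> s) = weight s / Z" for s
  proof -
    have "(\<integral>\<^sup>+s. ennreal (enn2real (weight s / Z)) \<partial>count_space UNIV) = Z / Z"
      by (simp add: wZ nn_integral_divide Z_def[symmetric] del: ennreal_divide_self)
    then show ?thesis
      unfolding \<pi>_def using Z_pos Z_fin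
      by (subst pmf_embed_pmf) (simp_all add: wZ ennreal_divide_self)
  qed
  have E: "(\<integral>\<^sup>+s. ennreal (r s) * f s \<partial>measure_pmf \<pi>) = occupation f / Z" for f
  proof -
    have "(\<integral>\<^sup>+s. ennreal (r s) * f s \<partial>measure_pmf \<pi>) = (\<integral>\<^sup>+s. weight s * (ennreal (r s) * f s) / Z \<partial>count_space UNIV)"
      unfolding nn_integral_measure_pmf pmf\<pi>
      by (intro nn_integral_cong) (simp add: ennreal_divide_times ennreal_times_divide mult.commute)
    also have "\<dots> = occupation f / Z"
      unfolding occupation_eq by (rule nn_integral_divide) simp
    finally show ?thesis .
  qed
  have C: "set_pmf \<pi> \<subseteq> C"
  proof
    fix s assume "s \<in> set_pmf \<pi>"
    then have w: "weight s \<noteq> 0"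
      using pmf\<pi>[of s] by (auto simp: set_pmf_iff)
    have "\<exists>m. pmf (excursion m) (Some s) \<noteq> 0"
    proof (rule ccontr)
      assume "\<not> ?thesis"
      then have "weight s = 0"
        by (simp add: weight_def)
      with w show False ..
    qed
    then obtain m where "pmf (excursion m) (Some s) \<noteq> 0"
      by blast
    then show "s \<in> C"
      using set_excursion[of "Some s" m] by (auto simp: set_pmf_iff)
  qed
  have inv: "(\<integral>s. gen R f s \<partial>measure_pmf \<pi>) = 0" if f: "\<And>s. s \<in> C \<Longrightarrow> \<bar>f s\<bar> \<le> K" for f K
  proof -
    \<comment> \<open>The shift makes the function nonnegative on \<open>C\<close>, so that the
      \<open>ennreal\<close> identity for \<open>occupation\<close> applies; by
      \<open>gen_add_const\<close> the generator stays the same.\<close>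
    let ?f = "\<lambda>s. f s + K"
    have f0: "0 \<le> ?f s" "?f s \<le> 2 * K" if "s \<in> C" for s
      using f[OF that] by auto
    have Jf0: "0 \<le> (\<integral>s'. ?f s' \<partial>measure_pmf (J s))" "(\<integral>s'. ?f s' \<partial>measure_pmf (J s)) \<le> 2 * K" if "s \<in> C" for s
    proof -
      show "0 \<le> (\<integral>s'. ?f s' \<partial>measure_pmf (J s))"
        by (intro integral_nonneg_AE) (use f0 closed[OF that] in \<open>auto simp: AE_measure_pmf_iff set_pmf_J\<close>)
      show "(\<integral>s'. ?f s' \<partial>measure_pmf (J s)) \<le> 2 * K"
        by (intro measure_pmf.integral_le_const integrable_J)
           (use f0 closed[OF that] in \<open>auto simp: AE_measure_pmf_iff set_pmf_J\<close>)
    qed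
    have int: "integrable (measure_pmf \<pi>) (\<lambda>s. r s * h s) \<and>
        (\<integral>\<^sup>+s. ennreal (r s) * ennreal (h s) \<partial>measure_pmf \<pi>) = ennreal (\<integral>s. r s * h s \<partial>measure_pmf \<pi>) \<and>
        0 \<le> (\<integral>s. r s * h s \<partial>measure_pmf \<pi>)"
      if h: "\<And>s. s \<in> C \<Longrightarrow> 0 \<le> h s" "\<And>s. s \<in> C \<Longrightarrow> h s \<le> 2 * K" for h
    proof -
      have "\<bar>r s * h s\<bar> \<le> L * (2 * K)" if "s \<in> C" for s
        using h[OF that] r_pos[of s] exit_le[of s] by (auto simp: abs_mult intro!: mult_mono)
      then have i: "integrable (measure_pmf \<pi>) (\<lambda>s. r s * h s)"
        by (rule integrable_bounded_on[OF C])
      have rh0: "0 \<le> r s * h s" if "s \<in> set_pmf \<pi>" for s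
        using C h(1)[of s] r_pos[of s] that by (intro mult_nonneg_nonneg) (auto simp: less_imp_le)
      have "(\<integral>\<^sup>+s. ennreal (r s) * ennreal (h s) \<partial>measure_pmf \<pi>) = (\<integral>\<^sup>+s. ennreal (r s * h s) \<partial>measure_pmf \<pi>)"
        using r_pos by (intro nn_integral_cong) (simp add: ennreal_mult'' ennreal_mult' less_imp_le)
      also have "\<dots> = ennreal (\<integral>s. r s * h s \<partial>measure_pmf \<pi>)"
        using rh0 by (intro nn_integral_eq_integral i) (auto simp: AE_measure_pmf_iff)
      finally show ?thesis
        using i rh0 by (auto intro!: integral_nonneg_AE simp: AE_measure_pmf_iff)
    qed
    have "(\<integral>\<^sup>+s. ennreal (r s) * ennreal (\<integral>s'. ?f s' \<partial>measure_pmf (J s)) \<partial>measure_pmf \<pi>)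
        = (\<integral>\<^sup>+s. ennreal (r s) * (\<integral>\<^sup>+s'. ennreal (?f s') \<partial>measure_pmf (J s)) \<partial>measure_pmf \<pi>)"
    proof (rule nn_integral_cong_AE, unfold AE_measure_pmf_iff, rule ballI)
      fix s assume "s \<in> set_pmf \<pi>"
      then have s: "s \<in> C" using C by auto
      have "(\<integral>\<^sup>+s'. ennreal (?f s') \<partial>measure_pmf (J s)) = ennreal (\<integral>s'. ?f s' \<partial>measure_pmf (J s))"
        using f0 closed[OF s] by (intro nn_integral_eq_integral integrable_J) (auto simp: AE_measure_pmf_iff set_pmf_J)
      then show "ennreal (r s) * ennreal (\<integral>s'. ?f s' \<partial>measure_pmf (J s)) =
          ennreal (r s) * (\<integral>\<^sup>+s'. ennreal (?f s') \<partial>measure_pmf (J s))"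
        by simp
    qed
    also have "\<dots> = (\<integral>\<^sup>+s. ennreal (r s) * ennreal (?f s) \<partial>measure_pmf \<pi>)"
      unfolding E occupation_J ..
    finally have "(\<integral>s. r s * (\<integral>s'. ?f s' \<partial>measure_pmf (J s)) \<partial>measure_pmf \<pi>) = (\<integral>s. r s * ?f s \<partial>measure_pmf \<pi>)"
      using int[of "\<lambda>s. \<integral>s'. ?f s' \<partial>measure_pmf (J s)"] int[of ?f] f0 Jf0 by simp
    moreover have "gen R f s = r s * (\<integral>s'. ?f s' \<partial>measure_pmf (J s)) - r s * ?f s" for s
      by (subst gen_add_const[of f K, symmetric]) (simp only: gen_eq_J right_diff_distrib)
    ultimately show ?thesis
      using int[of "\<lambda>s. \<integral>s'. ?f s' \<partial>measure_pmf (J s)"] int[of ?f] f0 Jf0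
      by simp
  qed
  show ?thesis
    using C inv unfolding invariant_def by blast
qed

end

subsection \<open>Return times\<close>

lemma path_law_eq_0:
  assumes F: "F \<in> borel_measurable (Pi\<^sub>M UNIV (\<lambda>_. stay_space))"
    and z: "\<And>s x. s \<in> set_pmf p \<Longrightarrow> (\<integral>\<^sup>+\<omega>. F (case_nat (s, x) \<omega>) \<partial>path_law R (jump_pmf R s)) = 0"
  shows "(\<integral>\<^sup>+\<omega>. F \<omega> \<partial>path_law R p) = 0"
proof -
  have "(\<integral>\<^sup>+\<omega>. F \<omega> \<partial>path_law R p) = (\<integral>\<^sup>+s. 0 \<partial>measure_pmf p)"
    unfolding nn_integral_path_law_first[OF F]
    by (rule nn_integral_cong_AE) (simp add: AE_measure_pmf_iff z)
  then show ?thesis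
    by simp
qed

lemma AE_path_law_first_two:
  "AE \<omega> in path_law R (return_pmf q). fst (\<omega> 0) = q \<and> fst (\<omega> (Suc 0)) \<in> set_pmf (jump_pmf R q)"
proof -
  have m: "(\<lambda>\<omega>. g (fst (\<omega> i)) :: ennreal) \<in> borel_measurable (Pi\<^sub>M UNIV (\<lambda>_::nat. stay_space))"
    for g :: "'a \<Rightarrow> ennreal" and i
    by (intro measurable_compose[OF measurable_component_singleton]) auto
  let ?F = "\<lambda>\<omega> :: nat \<Rightarrow> 'a \<times> real. indicator (- {q}) (fst (\<omega> 0)) + indicator (- set_pmf (jump_pmf R q)) (fst (\<omega> (Suc 0))) :: ennreal"
  have 1: "(\<integral>\<^sup>+\<omega>. indicator (- set_pmf p) (fst (\<omega> 0)) \<partial>path_law R p) = 0" for p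
    by (rule path_law_eq_0[OF m]) auto
  have mF: "?F \<in> borel_measurable (Pi\<^sub>M UNIV (\<lambda>_. stay_space))"
    by (intro borel_measurable_add m)
  have "(\<integral>\<^sup>+\<omega>. ?F \<omega> \<partial>path_law R (return_pmf q)) = 0"
    by (rule path_law_eq_0[OF mF]) (auto simp: 1)
  then have "AE \<omega> in path_law R (return_pmf q). ?F \<omega> = 0"
    using mF by (subst (asm) nn_integral_0_iff_AE) (simp_all add: measurable_cong_sets[OF sets_path_law refl])
  then show ?thesis
    by eventually_elim (auto simp: indicator_eq_0_iff)
qed

lemma AE_path_law_holding_pos: "AE \<omega> in path_law R p. \<forall>k. 0 < snd (\<omega> k)"
proof -
  have "AE \<omega> in path_law R p. 0 < snd (\<omega> k)" for k
  proof -
    let ?\<psi> = "\<lambda>y :: 'a \<times> real. indicator {y. \<not> 0 < snd y} y :: ennreal"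
    have ms: "{y :: 'a \<times> real. \<not> 0 < snd y} \<in> sets stay_space"
    proof -
      have "{y \<in> space stay_space. \<not> 0 < snd (y :: 'a \<times> real)} \<in> sets stay_space"
        by measurable
      then show ?thesis
        by (simp add: space_pair_measure)
    qed
    have m: "?\<psi> \<in> borel_measurable stay_space"
      using ms by simp
    have z: "(\<integral>\<^sup>+y. ?\<psi> y \<partial>stay_law R p') = 0" for p'
    proof -
      have "AE y in stay_law R p'. ?\<psi> y = 0"
        using AE_stay_law_pos[of R p'] by eventually_elim simp
      from nn_integral_cong_AE[OF this] show ?thesis
        by simp
    qed
    have mk: "(\<lambda>\<omega>. ?\<psi> (\<omega> k)) \<in> borel_measurable (Pi\<^sub>M UNIV (\<lambda>_. stay_space))" for k :: nat
      by (rule measurable_compose[OF measurable_component_singleton[of k UNIV "\<lambda>_. stay_space"] m]) simp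
    have "(\<integral>\<^sup>+\<omega>. ?\<psi> (\<omega> k) \<partial>path_law R p) = 0"
    proof (induction k arbitrary: p)
      case 0
      show ?case
        unfolding nn_integral_path_law_cons[OF mk] nat.case
        using z by (simp add: prob_space.emeasure_space_1[OF prob_space_path_law, simplified] del: indicator_simps)
    next
      case (Suc k)
      then show ?case
        unfolding nn_integral_path_law_cons[OF mk] nat.case by simp
    qed
    moreover have "(\<lambda>\<omega>. ?\<psi> (\<omega> k)) \<in> borel_measurable (path_law R p)"
      by (rule measurable_compose[OF measurable_path_law_component m])
    ultimately have "AE \<omega> in path_law R p. ?\<psi> (\<omega> k) = 0"
      by (simp only: nn_integral_0_iff_AE)
    then show ?thesis
      by eventually_elim (auto split: split_indicator_asm)
  qed
  then show ?thesis
    by (simp add: AE_all_countable)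
qed

text \<open>The strict inequality in \<open>state_at\<close> makes paths right-continuous, so at a
  jump time the new state is already in force; positive holding times keep a state from being
  skipped.\<close>

lemma state_at_jump_time:
  assumes pos: "\<And>k. 0 < snd (\<omega> k)"
  shows "state_at \<omega> (\<Sum>i<k. snd (\<omega> i)) = fst (\<omega> k)"
proof -
  have "(LEAST m. (\<Sum>i<k. snd (\<omega> i)) < (\<Sum>i\<le>m. snd (\<omega> i))) = k"
  proof (rule Least_equality)
    show "(\<Sum>i<k. snd (\<omega> i)) < (\<Sum>i\<le>k. snd (\<omega> i))"
      using pos[of k] by (simp add: lessThan_Suc_atMost[symmetric])
    fix m assume m: "(\<Sum>i<k. snd (\<omega> i)) < (\<Sum>i\<le>m. snd (\<omega> i))"
    show "k \<le> m"
    proof (rule ccontr)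
      assume "\<not> k \<le> m"
      then have "(\<Sum>i\<le>m. snd (\<omega> i)) \<le> (\<Sum>i<k. snd (\<omega> i))"
        using pos by (intro sum_mono2) (auto simp: less_imp_le)
      with m show False by simp
    qed
  qed
  then show ?thesis
    by (simp add: state_at_def)
qed

text \<open>Summed over \<open>k\<close> this is the time that the path spends before it first
  visits \<open>q\<close>. Such a series can be integrated term by term, whereas
  \<open>return_time\<close> is an infimum over a continuum of times.\<close>

definition stay_away :: "'a \<Rightarrow> nat \<Rightarrow> (nat \<Rightarrow> 'a \<times> real) \<Rightarrow> ennreal" where
  "stay_away q k \<omega> = ennreal (snd (\<omega> k)) * (\<Prod>i\<le>k. indicator (- {q}) (fst (\<omega> i)))"

definition return_bound :: "'a \<Rightarrow> (nat \<Rightarrow> 'a \<times> real) \<Rightarrow> ennreal" where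
  "return_bound q \<omega> = ennreal (snd (\<omega> 0)) + (\<Sum>k. stay_away q k (\<lambda>i. \<omega> (Suc i)))"

lemma borel_measurable_stay_away:
  fixes q :: 'a and h :: "nat \<Rightarrow> nat"
  shows "(\<lambda>\<omega>. stay_away q k (\<lambda>i. \<omega> (h i))) \<in> borel_measurable (Pi\<^sub>M UNIV (\<lambda>_. stay_space))"
proof -
  have "(\<lambda>\<omega> :: nat \<Rightarrow> 'a \<times> real. ennreal (snd (\<omega> i))) \<in> borel_measurable (Pi\<^sub>M UNIV (\<lambda>_::nat. stay_space))" for i
    by (intro measurable_compose[OF measurable_component_singleton]) auto
  moreover have "(\<lambda>\<omega>. indicator (- {q}) (fst (\<omega> i)) :: ennreal) \<in> borel_measurable (Pi\<^sub>M UNIV (\<lambda>_::nat. stay_space))" for i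
    by (intro measurable_compose[OF measurable_component_singleton]) auto
  ultimately show ?thesis
    unfolding stay_away_def by (intro borel_measurable_times_ennreal borel_measurable_prod_ennreal)
qed

lemma return_bound_ge:
  assumes pos: "\<And>k. 0 < snd (\<omega> k)" and away: "\<And>j. 1 \<le> j \<Longrightarrow> j \<le> M \<Longrightarrow> fst (\<omega> j) \<noteq> q"
  shows "ennreal (\<Sum>i\<le>M. snd (\<omega> i)) \<le> return_bound q \<omega>"
proof -
  have "stay_away q i (\<lambda>i. \<omega> (Suc i)) = ennreal (snd (\<omega> (Suc i)))" if "i < M" for i
    using that away by (auto simp: stay_away_def)
  then have "(\<Sum>i<M. ennreal (snd (\<omega> (Suc i)))) = (\<Sum>i<M. stay_away q i (\<lambda>i. \<omega> (Suc i)))"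
    by simp
  also have "\<dots> \<le> (\<Sum>i. stay_away q i (\<lambda>i. \<omega> (Suc i)))"
    by (rule sum_le_suminf) auto
  finally have "ennreal (snd (\<omega> 0)) + (\<Sum>i<M. ennreal (snd (\<omega> (Suc i)))) \<le> return_bound q \<omega>"
    unfolding return_bound_def by (rule add_left_mono)
  also have "(\<Sum>i<M. ennreal (snd (\<omega> (Suc i)))) = ennreal (\<Sum>i<M. snd (\<omega> (Suc i)))"
    using pos by (intro sum_ennreal) (auto simp: less_imp_le)
  also have "ennreal (snd (\<omega> 0)) + \<dots> = ennreal (\<Sum>i\<le>M. snd (\<omega> i))"
    using pos by (subst sum.atMost_shift) (simp add: ennreal_plus sum_nonneg less_imp_le)
  finally show ?thesis .
qed

text \<open>The first jump changes \<open>f\<close>, so the observed path is elsewhere at time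
  \<open>snd (\<omega> 0)\<close>; it is back in \<open>f q\<close> at the latest when
  \<open>q\<close> itself is revisited. If \<open>q\<close> is never revisited, the unbounded sums
  of holding times make the bound infinite.\<close>

lemma return_time_le:
  assumes pos: "\<And>k. 0 < snd (\<omega> k)" and unb: "\<And>t. \<exists>m. t < (\<Sum>k\<le>m. snd (\<omega> k))"
    and q1: "f (fst (\<omega> (Suc 0))) \<noteq> f q"
  shows "return_time (\<lambda>t. f (state_at \<omega> t)) (f q) \<le> return_bound q \<omega>"
proof (cases "\<exists>k\<ge>1. fst (\<omega> k) = q")
  case True
  define k where "k = (LEAST k. 1 \<le> k \<and> fst (\<omega> k) = q)"
  have k: "1 \<le> k" "fst (\<omega> k) = q"
    using LeastI_ex[OF True] unfolding k_def by auto
  have less: "fst (\<omega> j) \<noteq> q" if "1 \<le> j" "j < k" for j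
    using not_less_Least[of j "\<lambda>k. 1 \<le> k \<and> fst (\<omega> k) = q"] that unfolding k_def by blast
  have "k \<noteq> 1"
    using k q1 by auto
  then obtain M where M: "k = Suc M" "1 \<le> M"
    using k(1) by (cases k) auto
  let ?t = "\<Sum>i<k. snd (\<omega> i)"
  have "snd (\<omega> 0) < ?t"
  proof -
    have "(\<Sum>i<Suc 0. snd (\<omega> i)) < (\<Sum>i<k. snd (\<omega> i))"
      using M pos by (intro sum_strict_mono2[where b = 1]) (auto simp: less_imp_le)
    then show ?thesis by simp
  qed
  moreover have "state_at \<omega> (snd (\<omega> 0)) = fst (\<omega> (Suc 0))"
    using state_at_jump_time[of \<omega> "Suc 0", OF pos] by simp
  moreover have "state_at \<omega> ?t = q"
    using state_at_jump_time[of \<omega> k, OF pos] k by simp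
  ultimately have "\<exists>t. ennreal ?t = ennreal t \<and> f (state_at \<omega> t) = f q \<and>
      (\<exists>s. 0 \<le> s \<and> s < t \<and> f (state_at \<omega> s) \<noteq> f q)"
    using q1 pos[of 0] by (intro exI[of _ ?t] conjI refl exI[of _ "snd (\<omega> 0)"]) simp_all
  then have "return_time (\<lambda>t. f (state_at \<omega> t)) (f q) \<le> ennreal ?t"
    unfolding return_time_def by (intro Inf_lower) (simp only: mem_Collect_eq)
  also have "?t = (\<Sum>i\<le>M. snd (\<omega> i))"
    by (simp add: M(1) lessThan_Suc_atMost)
  also have "ennreal \<dots> \<le> return_bound q \<omega>"
    using less M by (intro return_bound_ge pos) auto
  finally show ?thesis .
next
  case False
  have "return_bound q \<omega> = top"
  proof (rule ccontr)
    assume "return_bound q \<omega> \<noteq> top"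
    then obtain c where c: "return_bound q \<omega> = ennreal c" "0 \<le> c"
      by (cases "return_bound q \<omega>") auto
    obtain m where m: "c < (\<Sum>k\<le>m. snd (\<omega> k))"
      using unb by blast
    have "ennreal (\<Sum>k\<le>m. snd (\<omega> k)) \<le> ennreal c"
      unfolding c(1)[symmetric] using False by (intro return_bound_ge pos) auto
    with m c show False
      by (simp add: ennreal_le_iff)
  qed
  then show ?thesis by simp
qed

context jump_rates
begin

primrec avoid :: "'s \<Rightarrow> nat \<Rightarrow> 's \<Rightarrow> real" where
  "avoid q 0 s = 1"
| "avoid q (Suc k) s = (\<integral>s'. (if s' = q then 0 else avoid q k s') \<partial>measure_pmf (J s))"

text \<open>
  The starting state is not counted: \<^term>\<open>avoid q k q\<close> is the probability that the jump chain
  needs more than \<^term>\<open>k\<close> jumps to return to \<^term>\<open>q\<close>.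
\<close>

lemma avoid_bounds: "0 \<le> avoid q k s \<and> avoid q k s \<le> 1"
proof (induction k arbitrary: s)
  case (Suc k)
  show ?case
    using Suc by (auto intro!: integral_nonneg_AE measure_pmf.integral_le_const integrable_J)
qed simp

lemma nn_integral_avoid:
  "(\<integral>\<^sup>+s'. ennreal (if s' = q then 0 else avoid q k s') \<partial>measure_pmf (J s)) = ennreal (avoid q (Suc k) s)"
  by (simp, intro nn_integral_eq_integral integrable_J) (use avoid_bounds in auto)

lemma nn_integral_holding: "(\<integral>\<^sup>+x. ennreal (exponential_density (r s) x) * ennreal x \<partial>lborel) \<le> ennreal (1 / l)"
proof -
  have "(\<integral>\<^sup>+x. ennreal (exponential_density (r s) x) * ennreal x \<partial>lborel) =
      (\<integral>\<^sup>+x. ennreal (exponential_density (r s) x * x ^ 1) \<partial>lborel)"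
    using r_pos[of s] by (intro nn_integral_cong) (auto simp: ennreal_mult'' exponential_density_def ennreal_mult')
  also have "\<dots> = ennreal (1 / r s)"
    by (subst nn_integral_erlang_ith_moment[OF r_pos]) simp
  also have "\<dots> \<le> ennreal (1 / l)"
    using exit_ge[of s] l_pos r_pos[of s] by (intro ennreal_leI divide_left_mono) auto
  finally show ?thesis .
qed

lemma nn_integral_exponential: "(\<integral>\<^sup>+x. ennreal (exponential_density (r s) x) \<partial>lborel) = 1"
  using prob_space.emeasure_space_1[OF prob_space_exponential_density[OF r_pos[of s]]]
  by (simp add: emeasure_density)

text \<open>Induction over the first jump. Given the visited states, each holding time has mean at
  most \<open>1 / l\<close>, which separates the time from the avoidance probability of the jump
  chain.\<close>

lemma nn_integral_stay_away_le:
  "(\<integral>\<^sup>+\<omega>. stay_away q k \<omega> \<partial>path_law R p) \<le>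
    ennreal (1 / l) * (\<integral>\<^sup>+s. ennreal (if s = q then 0 else avoid q k s) \<partial>measure_pmf p)"
proof (induction k arbitrary: p)
  case 0
  have "(\<integral>\<^sup>+\<omega>. stay_away q 0 \<omega> \<partial>path_law R p) =
     (\<integral>\<^sup>+s. (\<integral>\<^sup>+x. ennreal (exponential_density (r s) x) * ennreal x * indicator (- {q}) s \<partial>lborel) \<partial>measure_pmf p)"
    by (subst nn_integral_path_law_first[OF borel_measurable_stay_away[of q 0 "\<lambda>i. i"]])
       (simp add: stay_away_def hold_rate_eq mult.assoc prob_space.emeasure_space_1[OF prob_space_path_law, simplified])
  also have "\<dots> \<le> (\<integral>\<^sup>+s. ennreal (1 / l) * ennreal (if s = q then 0 else avoid q 0 s) \<partial>measure_pmf p)"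
    using nn_integral_holding by (intro nn_integral_mono) auto
  finally show ?case
    by (simp add: nn_integral_cmult)
next
  case (Suc k)
  have shift: "stay_away q (Suc k) (case_nat (s, x) \<omega>) = indicator (- {q}) s * stay_away q k \<omega>" for s x \<omega>
    by (simp add: stay_away_def prod.atMost_Suc_shift mult_ac del: prod.atMost_Suc)
  have "(\<integral>\<^sup>+\<omega>. stay_away q (Suc k) \<omega> \<partial>path_law R p) =
     (\<integral>\<^sup>+s. (\<integral>\<^sup>+x. ennreal (exponential_density (r s) x) * (indicator (- {q}) s * (\<integral>\<^sup>+\<omega>. stay_away q k \<omega> \<partial>path_law R (J s))) \<partial>lborel) \<partial>measure_pmf p)"
    using borel_measurable_stay_away[of q k "\<lambda>i. i"]
    by (subst nn_integral_path_law_first[OF borel_measurable_stay_away[of q "Suc k" "\<lambda>i. i"]])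
       (simp add: shift hold_rate_eq nn_integral_cmult measurable_cong_sets[OF sets_path_law refl])
  also have "\<dots> = (\<integral>\<^sup>+s. indicator (- {q}) s * (\<integral>\<^sup>+\<omega>. stay_away q k \<omega> \<partial>path_law R (J s)) \<partial>measure_pmf p)"
    by (subst nn_integral_multc) (simp_all add: nn_integral_exponential)
  also have "\<dots> \<le> (\<integral>\<^sup>+s. ennreal (1 / l) * ennreal (if s = q then 0 else avoid q (Suc k) s) \<partial>measure_pmf p)"
  proof (rule nn_integral_mono)
    fix s
    show "indicator (- {q}) s * (\<integral>\<^sup>+\<omega>. stay_away q k \<omega> \<partial>path_law R (J s)) \<le>
        ennreal (1 / l) * ennreal (if s = q then 0 else avoid q (Suc k) s)"
      using Suc.IH[of "J s"] unfolding nn_integral_avoid by (simp del: avoid.simps)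
  qed
  also have "\<dots> = ennreal (1 / l) * (\<integral>\<^sup>+s. ennreal (if s = q then 0 else avoid q (Suc k) s) \<partial>measure_pmf p)"
    by (rule nn_integral_cmult) simp
  finally show ?case .
qed

lemma nn_integral_return_bound_le:
  assumes A: "\<And>M. (\<Sum>k<M. avoid q k q) \<le> A"
  shows "(\<integral>\<^sup>+\<omega>. return_bound q \<omega> \<partial>path_law R (return_pmf q)) < \<infinity>"
proof -
  have m: "(\<lambda>\<omega>. stay_away q k \<omega>) \<in> borel_measurable (path_law R p)" for k p
    unfolding measurable_cong_sets[OF sets_path_law refl] using borel_measurable_stay_away[of q k "\<lambda>i. i"] .
  have mF: "return_bound q \<in> borel_measurable (Pi\<^sub>M UNIV (\<lambda>_. stay_space))"
  proof -
    have "(\<lambda>\<omega> :: nat \<Rightarrow> 's \<times> real. ennreal (snd (\<omega> 0))) \<in> borel_measurable (Pi\<^sub>M UNIV (\<lambda>_::nat. stay_space))"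
      by (intro measurable_compose[OF measurable_component_singleton]) auto
    then have "(\<lambda>\<omega>. ennreal (snd (\<omega> 0)) + (\<Sum>k. stay_away q k (\<lambda>i. \<omega> (Suc i)))) \<in>
        borel_measurable (Pi\<^sub>M UNIV (\<lambda>_::nat. stay_space))"
      by (intro borel_measurable_add borel_measurable_suminf_order borel_measurable_stay_away)
    then show ?thesis
      unfolding return_bound_def .
  qed
  have inner: "(\<integral>\<^sup>+\<omega>. return_bound q (case_nat (q, x) \<omega>) \<partial>path_law R (J q)) =
      ennreal x + (\<Sum>k. \<integral>\<^sup>+\<omega>. stay_away q k \<omega> \<partial>path_law R (J q))" for x
    using m by (simp add: return_bound_def nn_integral_add borel_measurable_suminf_order
        nn_integral_suminf prob_space.emeasure_space_1[OF prob_space_path_law, simplified])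
  have "(\<integral>\<^sup>+\<omega>. return_bound q \<omega> \<partial>path_law R (return_pmf q)) =
      (\<integral>\<^sup>+x. ennreal (exponential_density (r q) x) * (ennreal x + (\<Sum>k. \<integral>\<^sup>+\<omega>. stay_away q k \<omega> \<partial>path_law R (J q))) \<partial>lborel)"
    by (simp add: nn_integral_path_law_first[OF mF] hold_rate_eq inner)
  also have "\<dots> = (\<integral>\<^sup>+x. ennreal (exponential_density (r q) x) * ennreal x \<partial>lborel) +
      (\<Sum>k. \<integral>\<^sup>+\<omega>. stay_away q k \<omega> \<partial>path_law R (J q))"
    by (simp add: distrib_left nn_integral_add nn_integral_multc nn_integral_exponential)
  also have "\<dots> \<le> ennreal (1 / l) + (\<Sum>k. ennreal (1 / l) * ennreal (avoid q (Suc k) q))"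
    using nn_integral_stay_away_le[where q = q and p = "J q"] unfolding nn_integral_avoid
    by (intro add_mono nn_integral_holding suminf_le) auto
  also have "\<dots> < \<infinity>"
  proof -
    have "(\<Sum>k. ennreal (avoid q (Suc k) q)) \<le> ennreal A"
    proof (rule suminf_le_const)
      fix M
      have "(\<Sum>k<M. avoid q (Suc k) q) \<le> (\<Sum>k<Suc M. avoid q k q)"
        using sum.lessThan_Suc_shift[of "\<lambda>k. avoid q k q" M] by (simp del: avoid.simps(2) sum.lessThan_Suc)
      also have "\<dots> \<le> A"
        by (rule A)
      finally have "ennreal (\<Sum>k<M. avoid q (Suc k) q) \<le> ennreal A"
        by (rule ennreal_leI)
      then show "(\<Sum>k<M. ennreal (avoid q (Suc k) q)) \<le> ennreal A"
        by (subst sum_ennreal) (use avoid_bounds[of q "Suc _"] in \<open>auto simp del: avoid.simps\<close>)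
    qed simp
    then have "ennreal (1 / l) + ennreal (1 / l) * (\<Sum>k. ennreal (avoid q (Suc k) q)) \<le>
        ennreal (1 / l) + ennreal (1 / l) * ennreal A"
      by (intro add_left_mono mult_left_mono) auto
    also have "\<dots> < \<infinity>"
      by (simp add: ennreal_mult_less_top)
    finally show ?thesis
      by (simp only: ennreal_suminf_cmult)
  qed
  finally show ?thesis .
qed

text \<open>Monotonicity of \<open>nn_integral\<close> holds for arbitrary functions, so an almost
  sure bound by the measurable \<open>return_bound\<close> is enough.\<close>

lemma nn_integral_return_time_finite:
  assumes A: "\<And>M. (\<Sum>k<M. avoid q k q) \<le> A"
    and f: "\<And>s. R q s \<noteq> 0 \<Longrightarrow> s \<noteq> q \<Longrightarrow> f s \<noteq> f q"
  shows "(\<integral>\<^sup>+\<omega>. return_time (\<lambda>t. f (state_at \<omega> t)) (f q) \<partial>path_law R (return_pmf q)) < \<infinity>"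
proof -
  have "AE \<omega> in path_law R (return_pmf q). \<forall>t. \<exists>m. t < (\<Sum>k\<le>m. snd (\<omega> k))"
    by (rule AE_path_law_nonexplosive[of R L]) (simp add: hold_rate_eq exit_le)
  then have "AE \<omega> in path_law R (return_pmf q).
      return_time (\<lambda>t. f (state_at \<omega> t)) (f q) \<le> return_bound q \<omega>"
    using AE_path_law_holding_pos[of R "return_pmf q"] AE_path_law_first_two[of q R]
  proof eventually_elim
    case (elim \<omega>)
    then show ?case
      using f[of "fst (\<omega> (Suc 0))"] by (intro return_time_le) (auto simp: set_pmf_J)
  qed
  then have "(\<integral>\<^sup>+\<omega>. return_time (\<lambda>t. f (state_at \<omega> t)) (f q) \<partial>path_law R (return_pmf q))
      \<le> (\<integral>\<^sup>+\<omega>. return_bound q \<omega> \<partial>path_law R (return_pmf q))"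
    by (rule nn_integral_mono_AE)
  also have "\<dots> < \<infinity>"
    by (rule nn_integral_return_bound_le) (rule A)
  finally show ?thesis .
qed

end

context closed_rates
begin

text \<open>Kac's formula: by invariance the sum of the avoidance probabilities telescopes.\<close>

lemma sum_avoid_le:
  assumes inv: "invariant \<pi>" and q: "pmf \<pi> q > 0"
  shows "(\<Sum>k<M. avoid q k q) \<le> L / (r q * pmf \<pi> q)"
proof -
  note C = invariantD(1)[OF inv]
  define a where "a k = (\<integral>s. r s * avoid q k s \<partial>measure_pmf \<pi>)" for k
  have b: "\<bar>r s * avoid q k s\<bar> \<le> L" for s k
    using avoid_bounds[of q k s] r_pos[of s] exit_le[of s] mult_mono[of "r s" L "avoid q k s" 1]
    by (simp add: abs_mult)
  have i: "integrable (measure_pmf \<pi>) (\<lambda>s. r s * avoid q k s)" for k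
    by (rule integrable_bounded_on[OF C b])
  \<comment> \<open>Invariance trades the mean over one jump for the function itself; that function
    is set to zero at \<open>q\<close>, which costs exactly the summand to be collected.\<close>
  have step: "a (Suc k) = a k - r q * pmf \<pi> q * avoid q k q" for k
  proof -
    have "a (Suc k) = (\<integral>s. r s * (if s = q then 0 else avoid q k s) \<partial>measure_pmf \<pi>)"
      unfolding a_def avoid.simps
      by (rule invariant_expectation_J[OF inv, of _ 1]) (use avoid_bounds[of q k] in auto)
    also have "\<dots> = (\<integral>s. r s * avoid q k s - r q * avoid q k q * indicator {q} s \<partial>measure_pmf \<pi>)"
      by (intro Bochner_Integration.integral_cong) (auto split: split_indicator)
    also have "\<dots> = a k - r q * avoid q k q * pmf \<pi> q"
    proof -
      have "integrable (measure_pmf \<pi>) (\<lambda>s. r q * avoid q k q * indicator {q} s)"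
        by (intro measure_pmf.integrable_const_bound[of _ "\<bar>r q * avoid q k q\<bar>"]) (auto split: split_indicator)
      then show ?thesis
        by (subst Bochner_Integration.integral_diff[OF i]) (simp_all add: a_def measure_pmf_single)
    qed
    finally show ?thesis
      by simp
  qed
  have "r q * pmf \<pi> q * (\<Sum>k<M. avoid q k q) = a 0 - a M"
    by (induction M) (simp_all add: step algebra_simps)
  also have "\<dots> \<le> L"
  proof -
    have "0 \<le> a M"
      unfolding a_def using avoid_bounds r_pos by (intro integral_nonneg_AE) (auto simp: less_imp_le)
    moreover have "a 0 \<le> L"
      unfolding a_def using i[of 0] exit_le by (intro measure_pmf.integral_le_const) auto
    ultimately show ?thesis by simp
  qed
  finally show ?thesis
    unfolding pos_le_divide_eq[OF mult_pos_pos[OF r_pos q]] by (simp only: mult.commute)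
qed

end

section \<open>The PULL generator\<close>

locale pull =
  fixes lam :: real and \<beta> \<mu> :: "'p::finite \<Rightarrow> real" and B :: "'p \<Rightarrow> enat" and n :: nat
  assumes lam_pos: "lam > 0" and \<beta>_pos: "\<beta> j > 0" and \<mu>_pos: "\<mu> j > 0" and B_ge: "B j \<ge> 1"
    and sum_\<beta>: "(\<Sum>j\<in>UNIV. \<beta> j) = 1" and n_sizes: "n \<in> sizes \<beta>"
begin

abbreviation "R \<equiv> pull_rate lam \<beta> \<mu> B n"
abbreviation "S \<equiv> servers \<beta> n"
abbreviation "I q \<equiv> idle \<beta> n q"

definition targets :: "'p config \<Rightarrow> ('p \<times> nat) set" where
  "targets q = (if I q \<noteq> {} then I q else S)"

definition \<mu>min :: real where "\<mu>min = Min (range \<mu>)"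
definition \<mu>max :: real where "\<mu>max = Max (range \<mu>)"

text \<open>A departure from \<open>single\<close> creates an idle server, a departure from
  \<open>multi\<close> leaves the idle set unchanged; together with \<open>idle\<close> these sets
  partition the servers.\<close>

definition single :: "'p config \<Rightarrow> ('p \<times> nat) set" where "single q = {s \<in> S. q s = 1}"
definition multi :: "'p config \<Rightarrow> ('p \<times> nat) set" where "multi q = {s \<in> S. q s \<ge> 2}"

lemma n_pos: "n > 0"
  using n_sizes by (simp add: sizes_def)

lemma \<mu>min_pos: "\<mu>min > 0"
  unfolding \<mu>min_def using \<mu>_pos by (subst Min_gr_iff) auto

lemma \<mu>min_le: "\<mu>min \<le> \<mu> j"
  unfolding \<mu>min_def by (rule Min_le) auto

lemma \<mu>max_ge: "\<mu> j \<le> \<mu>max"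
  unfolding \<mu>max_def by (rule Max_ge) auto

lemma \<mu>max_pos: "\<mu>max > 0"
  using \<mu>_pos \<mu>max_ge by (rule less_le_trans)

lemma finite_sets [simp]: "finite (I q)" "finite (targets q)" "finite (single q)" "finite (multi q)"
  by (simp_all add: idle_def targets_def single_def multi_def)

lemma S_nonempty: "S \<noteq> {}"
  by (rule servers_nonempty[OF n_sizes \<beta>_pos])

lemma targets_nonempty: "targets q \<noteq> {}"
  using S_nonempty by (simp add: targets_def)

lemma targets_subset: "targets q \<subseteq> S"
  by (auto simp: targets_def idle_def)

lemma card_targets_pos: "card (targets q) > 0"
  using targets_nonempty by (simp add: card_gt_0_iff)

lemma card_S: "card S = n"
  by (rule card_servers[OF n_sizes \<beta>_pos sum_\<beta>])

lemma pull_rate_eq: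
  "R q q' = (\<Sum>s\<in>targets q. lam * real n / real (card (targets q)) * (if q' = join B q s then 1 else 0)) +
     (\<Sum>s\<in>single q \<union> multi q. \<mu> (fst s) * (if q' = q(s := q s - 1) then 1 else 0))"
proof -
  have r: "route \<beta> n q = pmf_of_set (targets q)"
    by (simp add: route_def targets_def)
  have "pmf (map_pmf (join B q) (route \<beta> n q)) q' = real (card (targets q \<inter> join B q -` {q'})) / real (card (targets q))"
    unfolding r by (simp add: pmf_map measure_pmf_of_set targets_nonempty)
  also have "real (card (targets q \<inter> join B q -` {q'})) = (\<Sum>s\<in>targets q. if q' = join B q s then 1 else 0)"
    by (simp add: sum.If_cases Int_def vimage_def eq_commute)
  finally have P: "pmf (map_pmf (join B q) (route \<beta> n q)) q' =
      (\<Sum>s\<in>targets q. if q' = join B q s then 1 else 0) / real (card (targets q))" .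
  have 1: "lam * real n * pmf (map_pmf (join B q) (route \<beta> n q)) q' =
      (\<Sum>s\<in>targets q. lam * real n / real (card (targets q)) * (if q' = join B q s then 1 else 0))"
    unfolding sum_distrib_left[symmetric] P by simp
  have "(\<Sum>s\<in>S. (if q s > 0 \<and> q' = q(s := q s - 1) then \<mu> (fst s) else 0)) =
     (\<Sum>s\<in>single q \<union> multi q. (if q s > 0 \<and> q' = q(s := q s - 1) then \<mu> (fst s) else 0))"
    by (intro sum.mono_neutral_right) (auto simp: single_def multi_def)
  also have "\<dots> = (\<Sum>s\<in>single q \<union> multi q. \<mu> (fst s) * (if q' = q(s := q s - 1) then 1 else 0))"
    by (intro sum.cong) (auto simp: single_def multi_def)
  finally show ?thesis
    unfolding pull_rate_def 1 by simp
qed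

text \<open>Events are indexed by servers, the generator by target states. Both index sets are
  finite, so the sums can be exchanged even when several servers lead to the same state, as all lost
  arrivals do.\<close>

lemma gen_pull:
  "gen R f q = (\<Sum>s\<in>targets q. lam * real n / real (card (targets q)) * (f (join B q s) - f q)) +
     (\<Sum>s\<in>single q. \<mu> (fst s) * (f (q(s := 0)) - f q)) +
     (\<Sum>s\<in>multi q. \<mu> (fst s) * (f (q(s := q s - 1)) - f q))"
proof -
  define c where "c = lam * real n / real (card (targets q))"
  let ?D = "\<lambda>s. q(s := q s - 1)" and ?T = "single q \<union> multi q"
  let ?Q = "join B q ` targets q \<union> ?D ` ?T \<union> {q'. R q q' \<noteq> 0}"
  have fQ: "finite ?Q"
    using finite_pull_rate[OF n_sizes \<beta>_pos] by auto
  have "gen R f q = (\<Sum>q'\<in>?Q. R q q' * (f q' - f q))"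
    unfolding gen_def using fQ by (intro sum.mono_neutral_left) auto
  also have "\<dots> = (\<Sum>q'\<in>?Q. \<Sum>s\<in>targets q. c * (if q' = join B q s then f q' - f q else 0)) +
     (\<Sum>q'\<in>?Q. \<Sum>s\<in>?T. \<mu> (fst s) * (if q' = ?D s then f q' - f q else 0))"
    unfolding pull_rate_eq c_def[symmetric] sum.distrib[symmetric] distrib_right sum_distrib_right
    by (intro sum.cong arg_cong2[where f = "(+)"]) auto
  also have "(\<Sum>q'\<in>?Q. \<Sum>s\<in>targets q. c * (if q' = join B q s then f q' - f q else 0)) =
     (\<Sum>s\<in>targets q. c * (f (join B q s) - f q))"
    using fQ by (subst sum.swap) (simp add: sum_distrib_left[symmetric])
  also have "(\<Sum>q'\<in>?Q. \<Sum>s\<in>?T. \<mu> (fst s) * (if q' = ?D s then f q' - f q else 0)) =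
     (\<Sum>s\<in>?T. \<mu> (fst s) * (f (?D s) - f q))"
    using fQ by (subst sum.swap) (simp add: sum_distrib_left[symmetric])
  also have "\<dots> = (\<Sum>s\<in>single q. \<mu> (fst s) * (f (?D s) - f q)) + (\<Sum>s\<in>multi q. \<mu> (fst s) * (f (?D s) - f q))"
    by (rule sum.union_disjoint) (auto simp: single_def multi_def)
  also have "(\<Sum>s\<in>single q. \<mu> (fst s) * (f (?D s) - f q)) = (\<Sum>s\<in>single q. \<mu> (fst s) * (f (q(s := 0)) - f q))"
    by (intro sum.cong) (auto simp: single_def)
  finally show ?thesis
    by (simp add: c_def fun_upd_def)
qed

definition rate_single :: "'p config \<Rightarrow> real" where "rate_single q = (\<Sum>s\<in>single q. \<mu> (fst s))"
definition rate_multi :: "'p config \<Rightarrow> real" where "rate_multi q = (\<Sum>s\<in>multi q. \<mu> (fst s))"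

lemma gen_pull_le:
  assumes "\<And>s. s \<in> targets q \<Longrightarrow> f (join B q s) - f q \<le> a"
    and "\<And>s. s \<in> single q \<Longrightarrow> f (q(s := 0)) - f q \<le> d1"
    and "\<And>s. s \<in> multi q \<Longrightarrow> f (q(s := q s - 1)) - f q \<le> d2"
  shows "gen R f q \<le> lam * real n * a + d1 * rate_single q + d2 * rate_multi q"
proof -
  have "(\<Sum>s\<in>targets q. lam * real n / real (card (targets q)) * (f (join B q s) - f q)) \<le>
      (\<Sum>s\<in>targets q. lam * real n / real (card (targets q)) * a)"
    using assms(1) lam_pos by (intro sum_mono mult_left_mono) auto
  also have "\<dots> = lam * real n * a"
    using card_targets_pos[of q] targets_nonempty[of q] by simp
  finally have 1: "(\<Sum>s\<in>targets q. lam * real n / real (card (targets q)) * (f (join B q s) - f q)) \<le> lam * real n * a" .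
  have "(\<Sum>s\<in>single q. \<mu> (fst s) * (f (q(s := 0)) - f q)) \<le> (\<Sum>s\<in>single q. \<mu> (fst s) * d1)"
    using assms(2) \<mu>_pos by (intro sum_mono mult_left_mono) (auto simp: less_imp_le)
  also have "\<dots> = d1 * rate_single q"
    by (simp add: rate_single_def sum_distrib_left mult.commute)
  finally have 2: "(\<Sum>s\<in>single q. \<mu> (fst s) * (f (q(s := 0)) - f q)) \<le> d1 * rate_single q" .
  have "(\<Sum>s\<in>multi q. \<mu> (fst s) * (f (q(s := q s - 1)) - f q)) \<le> (\<Sum>s\<in>multi q. \<mu> (fst s) * d2)"
    using assms(3) \<mu>_pos by (intro sum_mono mult_left_mono) (auto simp: less_imp_le)
  also have "\<dots> = d2 * rate_multi q"
    by (simp add: rate_multi_def sum_distrib_left mult.commute)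
  finally show ?thesis
    using 1 2 unfolding gen_pull by linarith
qed

lemma total_rate: "(\<Sum>s\<in>S. \<mu> (fst s)) = real n * (\<Sum>j\<in>UNIV. \<beta> j * \<mu> j)"
proof -
  have "(\<Sum>s\<in>S. \<mu> (fst s)) = (\<Sum>j\<in>UNIV. \<Sum>i<pool_size \<beta> n j. \<mu> j)"
    unfolding servers_def by (subst sum.Sigma) (auto simp: split_beta')
  also have "\<dots> = (\<Sum>j\<in>UNIV. real n * (\<beta> j * \<mu> j))"
    using pool_size_eq(1)[OF n_sizes \<beta>_pos] by (simp add: mult_ac)
  finally show ?thesis
    by (simp add: sum_distrib_left)
qed

lemma rate_split: "rate_single q + rate_multi q + (\<Sum>s\<in>I q. \<mu> (fst s)) = real n * (\<Sum>j\<in>UNIV. \<beta> j * \<mu> j)"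
proof -
  have "S = (single q \<union> multi q) \<union> I q"
    by (auto simp: single_def multi_def idle_def)
  then have "(\<Sum>s\<in>S. \<mu> (fst s)) = (\<Sum>s\<in>single q \<union> multi q. \<mu> (fst s)) + (\<Sum>s\<in>I q. \<mu> (fst s))"
    by (simp only:) (rule sum.union_disjoint, auto simp: single_def multi_def idle_def)
  moreover have "(\<Sum>s\<in>single q \<union> multi q. \<mu> (fst s)) = rate_single q + rate_multi q"
    unfolding rate_single_def rate_multi_def
    by (rule sum.union_disjoint) (auto simp: single_def multi_def)
  ultimately show ?thesis
    using total_rate by simp
qed

lemma rates_nonneg: "0 \<le> rate_single q" "0 \<le> rate_multi q" "0 \<le> (\<Sum>s\<in>I q. \<mu> (fst s))"
  unfolding rate_single_def rate_multi_def using \<mu>_pos by (auto intro!: sum_nonneg simp: less_imp_le)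

lemma idle_rate_le: "(\<Sum>s\<in>I q. \<mu> (fst s)) \<le> real (card (I q)) * \<mu>max"
  by (rule sum_bounded_above) (rule \<mu>max_ge)

lemma rate_multi_ge: "\<mu>min * real (card (multi q)) \<le> rate_multi q"
  unfolding rate_multi_def using sum_bounded_below[of "multi q" \<mu>min "\<lambda>s. \<mu> (fst s)"] \<mu>min_le
  by (simp add: mult.commute)

lemma rate_multi_le: "rate_multi q \<le> real n * \<mu>max"
proof -
  have "rate_multi q \<le> real (card (multi q)) * \<mu>max"
    unfolding rate_multi_def by (rule sum_bounded_above) (rule \<mu>max_ge)
  also have "card (multi q) \<le> card S"
    by (rule card_mono) (auto simp: multi_def)
  then have "real (card (multi q)) * \<mu>max \<le> real n * \<mu>max"
    using \<mu>max_pos by (simp add: card_S)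
  finally show ?thesis .
qed

lemma rate_busy_ge: "s \<in> S \<Longrightarrow> q s > 0 \<Longrightarrow> \<mu>min \<le> rate_single q + rate_multi q"
proof -
  assume s: "s \<in> S" "q s > 0"
  have "\<mu>min \<le> \<mu> (fst s)"
    by (rule \<mu>min_le)
  also have "\<dots> \<le> (\<Sum>s\<in>single q \<union> multi q. \<mu> (fst s))"
    using s \<mu>_pos by (intro member_le_sum) (auto simp: single_def multi_def less_imp_le)
  also have "\<dots> = rate_single q + rate_multi q"
    unfolding rate_single_def rate_multi_def by (rule sum.union_disjoint) (auto simp: single_def multi_def)
  finally show ?thesis .
qed

lemma join_idle: "s \<in> I q \<Longrightarrow> join B q s = q(s := 1)"
  using B_ge[of "fst s"] by (auto simp: join_def idle_def zero_enat_def[symmetric])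

lemma idle_join: "s \<in> I q \<Longrightarrow> I (q(s := 1)) = I q - {s}"
  by (auto simp: idle_def)

lemma idle_join_full: "I q = {} \<Longrightarrow> s \<in> S \<Longrightarrow> I (join B q s) = {}"
  by (auto simp: idle_def join_def)

lemma idle_single: "s \<in> single q \<Longrightarrow> I (q(s := 0)) = insert s (I q)"
  by (auto simp: idle_def single_def)

lemma idle_multi: "s \<in> multi q \<Longrightarrow> I (q(s := q s - 1)) = I q"
  by (auto simp: idle_def multi_def)

lemma rate_cases:
  assumes "R q q' \<noteq> 0"
  obtains (arrival) s where "s \<in> targets q" "q' = join B q s"
  | (departure) s where "s \<in> S" "q s > 0" "q' = q(s := q s - 1)"
proof -
  have "(\<exists>s\<in>targets q. q' = join B q s) \<or> (\<exists>s\<in>single q \<union> multi q. q' = q(s := q s - 1))"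
  proof (rule ccontr)
    assume "\<not> ?thesis"
    then have "(\<Sum>s\<in>targets q. lam * real n / real (card (targets q)) * (if q' = join B q s then 1 else 0)) = 0"
      "(\<Sum>s\<in>single q \<union> multi q. \<mu> (fst s) * (if q' = q(s := q s - 1) then 1 else 0)) = 0"
      by (auto intro!: sum.neutral)
    with assms show False
      unfolding pull_rate_eq by simp
  qed
  then show thesis
    using arrival departure by (fastforce simp: single_def multi_def)
qed

lemma rate_departure: "s \<in> S \<Longrightarrow> q s > 0 \<Longrightarrow> R q (q(s := q s - 1)) > 0"
proof -
  assume s: "s \<in> S" "q s > 0"
  have "0 < (\<Sum>s'\<in>single q \<union> multi q. \<mu> (fst s') * (if q(s := q s - 1) = q(s' := q s' - 1) then 1 else 0))"
    using s \<mu>_pos by (intro sum_pos2[of _ s]) (auto simp: single_def multi_def less_imp_le)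
  then show ?thesis
    unfolding pull_rate_eq using lam_pos by (intro add_nonneg_pos sum_nonneg) auto
qed

lemma rate_arrival: "s \<in> targets q \<Longrightarrow> R q (join B q s) > 0"
proof -
  assume s: "s \<in> targets q"
  have "0 < (\<Sum>s'\<in>targets q. lam * real n / real (card (targets q)) * (if join B q s = join B q s' then 1 else 0))"
    using s lam_pos n_pos card_targets_pos[of q] by (intro sum_pos2[of _ s]) auto
  then show ?thesis
    unfolding pull_rate_eq using \<mu>_pos by (intro add_pos_nonneg sum_nonneg) (auto simp: less_imp_le)
qed

text \<open>Exit rates become generators of a function, so \<open>gen_pull_le\<close> and
  \<open>gen_pull\<close> yield their upper and lower bounds.\<close>

lemma exit_rate_eq_gen: "exit_rate R q = gen R (\<lambda>q'. if q' = q then 0 else 1) q"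
proof -
  let ?A = "{q'. R q q' \<noteq> 0}"
  have fin: "finite ?A"
    by (rule finite_pull_rate[OF n_sizes \<beta>_pos])
  have "exit_rate R q = infsum (R q) (?A - {q})"
    unfolding exit_rate_def by (rule infsum_cong_neutral) auto
  also have "\<dots> = sum (R q) (?A - {q})"
    using fin by simp
  also have "\<dots> = (\<Sum>q'\<in>?A - {q}. R q q' * (if q' = q then 0 else 1))"
    by (intro sum.cong) auto
  also have "\<dots> = gen R (\<lambda>q'. if q' = q then 0 else 1) q"
    unfolding gen_def using fin by (intro sum.mono_neutral_cong_left) auto
  finally show ?thesis .
qed

lemma exit_rate_upper: "exit_rate R q \<le> lam * real n + real n * (\<Sum>j\<in>UNIV. \<beta> j * \<mu> j)"
proof -
  have "exit_rate R q \<le> lam * real n * 1 + 1 * rate_single q + 1 * rate_multi q"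
    unfolding exit_rate_eq_gen by (rule gen_pull_le) auto
  then show ?thesis
    using rate_split[of q] rates_nonneg[of q] by simp
qed

text \<open>An arrival that finds an idle server always changes the state, because every buffer
  holds at least one customer. If no server is idle, all are busy and services complete at total
  rate at least \<open>\<mu>min\<close>.\<close>

lemma exit_rate_lower: "min (lam * real n) \<mu>min \<le> exit_rate R q"
proof -
  let ?f = "\<lambda>q'. if q' = q then 0 else 1 :: real"
  have g: "exit_rate R q = (\<Sum>s\<in>targets q. lam * real n / real (card (targets q)) * ?f (join B q s)) +
     (\<Sum>s\<in>single q. \<mu> (fst s) * ?f (q(s := 0))) + (\<Sum>s\<in>multi q. \<mu> (fst s) * ?f (q(s := q s - 1)))"
    unfolding exit_rate_eq_gen gen_pull by simp
  have s1: "(\<Sum>s\<in>single q. \<mu> (fst s) * ?f (q(s := 0))) = rate_single q"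
    unfolding rate_single_def
  proof (intro sum.cong refl)
    fix s assume "s \<in> single q"
    then have "q(s := 0) \<noteq> q"
      by (auto simp: single_def dest!: fun_cong[of _ _ s])
    then show "\<mu> (fst s) * ?f (q(s := 0)) = \<mu> (fst s)"
      by simp
  qed
  have s2: "(\<Sum>s\<in>multi q. \<mu> (fst s) * ?f (q(s := q s - 1))) = rate_multi q"
    unfolding rate_multi_def
  proof (intro sum.cong refl)
    fix s assume "s \<in> multi q"
    then have "q(s := q s - 1) \<noteq> q"
      by (auto simp: multi_def dest!: fun_cong[of _ _ s])
    then show "\<mu> (fst s) * ?f (q(s := q s - 1)) = \<mu> (fst s)"
      by simp
  qed
  show ?thesis
  proof (cases "I q = {}")
    case True
    obtain s where s: "s \<in> S" using S_nonempty by auto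
    then have "q s > 0"
      using True by (cases s) (auto simp: idle_def)
    then have "\<mu>min \<le> rate_single q + rate_multi q"
      by (rule rate_busy_ge[OF s])
    moreover have "0 \<le> (\<Sum>s\<in>targets q. lam * real n / real (card (targets q)) * ?f (join B q s))"
      using lam_pos by (intro sum_nonneg) auto
    ultimately show ?thesis
      unfolding g s1 s2 by linarith
  next
    case False
    have "(\<Sum>s\<in>targets q. lam * real n / real (card (targets q)) * ?f (join B q s)) =
        (\<Sum>s\<in>targets q. lam * real n / real (card (targets q)))"
    proof (intro sum.cong refl)
      fix s assume "s \<in> targets q"
      then have s: "s \<in> I q"
        using False by (simp add: targets_def)
      then have "join B q s \<noteq> q"
        using join_idle[OF s] by (auto simp: idle_def dest!: fun_cong[of _ _ s])
      then show "lam * real n / real (card (targets q)) * ?f (join B q s) = lam * real n / real (card (targets q))"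
        by simp
    qed
    also have "\<dots> = lam * real n"
      using card_targets_pos[of q] targets_nonempty[of q] by simp
    finally show ?thesis
      unfolding g s1 s2 using rates_nonneg[of q] by linarith
  qed
qed

lemma configs_closed: "q \<in> configs \<beta> B n \<Longrightarrow> R q q' \<noteq> 0 \<Longrightarrow> q' \<in> configs \<beta> B n"
proof -
  assume q: "q \<in> configs \<beta> B n" and R: "R q q' \<noteq> 0"
  from R show ?thesis
  proof (cases rule: rate_cases)
    case (arrival s)
    then have s: "s \<in> S"
      using targets_subset by auto
    have "enat (q s) \<le> B (fst s)"
      using q s by (auto simp: configs_def)
    then have "enat (q s) \<noteq> B (fst s) \<Longrightarrow> enat (Suc (q s)) \<le> B (fst s)"
      by (cases "B (fst s)") auto
    then show ?thesis
      using q s arrival by (auto simp: configs_def join_def)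
  next
    case (departure s)
    have "enat (q s - 1) \<le> enat (q s)"
      by simp
    also have "enat (q s) \<le> B (fst s)"
      using q departure by (auto simp: configs_def)
    finally show ?thesis
      using q departure by (auto simp: configs_def)
  qed
qed

end

sublocale pull \<subseteq> closed_rates "pull_rate lam \<beta> \<mu> B n" "min (lam * real n) \<mu>min"
  "lam * real n + real n * (\<Sum>j\<in>UNIV. \<beta> j * \<mu> j)" "configs \<beta> B n"
proof
  show "0 \<le> R s s'" for s s'
    by (rule pull_rate_nonneg) (use lam_pos \<mu>_pos in auto)
  show "finite {s'. R s s' \<noteq> 0}" for s
    by (rule finite_pull_rate[OF n_sizes \<beta>_pos])
  show "0 < min (lam * real n) \<mu>min"
    using lam_pos n_pos \<mu>min_pos by simp
qed (rule exit_rate_lower exit_rate_upper configs_closed; assumption?)+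

section \<open>Lyapunov functions and ergodicity\<close>

lemma (in pull) configs_servers: "q \<in> configs \<beta> B n \<Longrightarrow> q s \<noteq> 0 \<Longrightarrow> s \<in> S"
  unfolding configs_def mem_Collect_eq by metis

text \<open>
  The weights \<^term>\<open>\<theta> ^ k\<close> make the drift contributed by the number of idle servers negative
  whenever at most \<^term>\<open>m\<close> servers are idle; above that level the only upward drift is the
  boundary term \<^term>\<open>lam * real n * \<theta> ^ m\<close>, which is exponentially small in \<^term>\<open>n\<close>.
\<close>

locale pull_lyapunov = pull +
  fixes \<theta> \<eta> \<kappa> :: real and m :: nat
  assumes \<theta>: "0 < \<theta>" "\<theta> < 1" and \<eta>: "0 < \<eta>" and \<kappa>: "0 < \<kappa>" "\<kappa> \<le> 1" "\<kappa> * \<mu>max \<le> \<eta>"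
    and slack: "lam * real n / \<theta> + real m * \<mu>max + real n * \<eta> \<le> real n * (\<Sum>j\<in>UNIV. \<beta> j * \<mu> j)"
    and small: "lam * real n * \<theta> ^ m \<le> \<kappa> * \<mu>min / 2"
begin

definition H :: "nat \<Rightarrow> real" where "H i = (\<Sum>k=i..m. \<theta> ^ k)"
definition V :: "'a config \<Rightarrow> real" where "V q = (\<Sum>s\<in>S. real (q s - 1)) + H (card (I q))"

lemma H_step: "H i - H (Suc i) = (if i \<le> m then \<theta> ^ i else 0)"
  by (simp add: H_def sum.atLeast_Suc_atMost)

lemma sum_update:
  fixes h :: "nat \<Rightarrow> real"
  assumes "s \<in> S"
  shows "(\<Sum>t\<in>S. h ((q(s := x)) t)) = (\<Sum>t\<in>S. h (q t)) + (h x - h (q s))"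
proof -
  have "(\<Sum>t\<in>S. h ((q(s := x)) t)) = h x + (\<Sum>t\<in>S - {s}. h (q t))"
    using assms by (subst sum.remove[of S s]) (auto intro!: sum.cong)
  moreover have "(\<Sum>t\<in>S. h (q t)) = h (q s) + (\<Sum>t\<in>S - {s}. h (q t))"
    using assms by (subst sum.remove[of S s]) auto
  ultimately show ?thesis by simp
qed

lemma V_nonneg: "V q \<ge> 0"
  unfolding V_def H_def using \<theta> by (intro add_nonneg_nonneg sum_nonneg) auto

text \<open>Without idle servers the customer waits, at cost 1, or is lost and changes nothing.
  Otherwise the customer is served at once and only \<open>H\<close> moves, by the term in
  \<open>H_step\<close>.\<close>

lemma V_arrival:
  assumes s: "s \<in> targets q"
  shows "V (join B q s) - V q \<le> (if card (I q) = 0 then 1 else if card (I q) - 1 \<le> m then \<theta> ^ (card (I q) - 1) else 0)"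
proof (cases "I q = {}")
  case True
  then have sS: "s \<in> S"
    using s by (simp add: targets_def)
  have "(\<Sum>t\<in>S. real (join B q s t - 1)) \<le> (\<Sum>t\<in>S. real (q t - 1)) + 1"
  proof (cases "enat (q s) = B (fst s)")
    case False
    then show ?thesis
      using sum_update[OF sS, of "\<lambda>x. real (x - 1)" q "q s + 1"] by (simp add: join_def)
  qed (simp add: join_def)
  then show ?thesis
    using True idle_join_full[OF True sS] by (simp add: V_def)
next
  case False
  then have sI: "s \<in> I q" and sS: "s \<in> S"
    using s by (auto simp: targets_def idle_def)
  define k where "k = card (I q) - 1"
  have k: "card (I q) = Suc k"
  proof -
    have "card (I q) > 0"
      using False by (simp add: card_gt_0_iff)
    then show ?thesis
      by (simp add: k_def)
  qed
  have "card (I (q(s := 1))) = k"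
    using idle_join[OF sI] sI by (simp add: k_def)
  moreover have "q s = 0"
    using sI by (simp add: idle_def)
  ultimately show ?thesis
    using sum_update[OF sS, of "\<lambda>x. real (x - 1)" q 1] H_step[of k] join_idle[OF sI]
    by (simp add: V_def k)
qed

lemma V_single:
  assumes s: "s \<in> single q"
  shows "V (q(s := 0)) - V q = - (if card (I q) \<le> m then \<theta> ^ card (I q) else 0)"
proof -
  have sS: "s \<in> S" "q s = 1" "s \<notin> I q"
    using s by (auto simp: single_def idle_def)
  then have "card (I (q(s := 0))) = Suc (card (I q))"
    using idle_single[OF s] by simp
  then show ?thesis
    using sum_update[OF sS(1), of "\<lambda>x. real (x - 1)" q 0] H_step[of "card (I q)"] sS(2)
    by (simp add: V_def)
qed

lemma V_multi:
  assumes s: "s \<in> multi q"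
  shows "V (q(s := q s - 1)) - V q = - 1"
proof -
  have sS: "s \<in> S" "q s \<ge> 2"
    using s by (auto simp: multi_def)
  then show ?thesis
    using sum_update[OF sS(1), of "\<lambda>x. real (x - 1)" q "q s - 1"] idle_multi[OF s]
    by (simp add: V_def of_nat_diff)
qed

text \<open>With \<open>i \<le> m\<close> idle servers, arrivals raise \<open>V\<close> at rate at
  most \<open>\<theta> ^ i * (lam * real n / \<theta>)\<close> and departures from
  \<open>single\<close> lower it at rate \<open>\<theta> ^ i * rate_single q\<close>. By
  \<open>slack\<close> the balance is at most
  \<open>\<theta> ^ i * (rate_multi q - real n * \<eta>)\<close>. Departures from
  \<open>multi\<close> lower \<open>V\<close> by a full 1 and absorb the first term, since
  \<open>\<theta> ^ i \<le> 1\<close>; the term with \<open>\<eta>\<close> pays for the surviving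
  \<open>\<kappa> * rate_multi q\<close>. With more than \<open>m\<close> idle servers only the step
  from \<open>m + 1\<close> to \<open>m\<close> raises \<open>V\<close>.\<close>

lemma gen_V_le: "gen R V q \<le> lam * real n * \<theta> ^ m - \<kappa> * rate_multi q"
proof -
  define i where "i = card (I q)"
  define up where "up = (if i = 0 then 1 else if i - 1 \<le> m then \<theta> ^ (i - 1) else 0)"
  define dn where "dn = (if i \<le> m then \<theta> ^ i else 0)"
  have g: "gen R V q \<le> lam * real n * up + (- dn) * rate_single q + (- 1) * rate_multi q"
  proof (rule gen_pull_le)
    show "V (join B q s) - V q \<le> up" if "s \<in> targets q" for s
      using V_arrival[OF that] by (simp only: up_def i_def)
    show "V (q(s := 0)) - V q \<le> - dn" if "s \<in> single q" for s
      using V_single[OF that] by (simp only: dn_def i_def)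
    show "V (q(s := q s - 1)) - V q \<le> - 1" if "s \<in> multi q" for s
      using V_multi[OF that] by (simp only:)
  qed
  have ln: "0 < lam * real n"
    using lam_pos n_pos by simp
  have km: "\<kappa> * rate_multi q \<le> rate_multi q"
    using \<kappa> rates_nonneg(2)[of q] by (simp add: mult_left_le_one_le)
  have e: "0 \<le> lam * real n * \<theta> ^ m"
    using lam_pos \<theta> by (intro mult_nonneg_nonneg) auto
  show ?thesis
  proof (cases "i \<le> m")
    case True
    \<comment> \<open>At \<open>i = 0\<close> a waiting customer costs 1, which
      \<open>1 / \<theta>\<close> covers; for \<open>i > 0\<close> equality holds.\<close>
    have "up \<le> \<theta> ^ i / \<theta>"
    proof (cases i)
      case 0
      then show ?thesis
        using \<theta> by (simp add: up_def)
    next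
      case (Suc k)
      then show ?thesis
        using True \<theta> by (simp add: up_def)
    qed
    then have "lam * real n * up \<le> lam * real n * (\<theta> ^ i / \<theta>)"
      using ln by (intro mult_left_mono) auto
    with g True have g2: "gen R V q \<le> \<theta> ^ i * (lam * real n / \<theta> - rate_single q) - rate_multi q"
      by (simp add: dn_def algebra_simps)
    have "real i * \<mu>max \<le> real m * \<mu>max"
      using True \<mu>max_pos by simp
    then have "lam * real n / \<theta> - rate_single q \<le> rate_multi q - real n * \<eta>"
      using slack rate_split[of q] idle_rate_le[of q] by (simp add: i_def)
    also have "\<dots> \<le> rate_multi q - \<kappa> * rate_multi q"
    proof -
      have "\<kappa> * rate_multi q \<le> \<kappa> * (real n * \<mu>max)"
        using \<kappa> rate_multi_le by (intro mult_left_mono) auto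
      also have "\<dots> = real n * (\<kappa> * \<mu>max)"
        by simp
      also have "\<dots> \<le> real n * \<eta>"
        using \<kappa>(3) by (intro mult_left_mono) auto
      finally show ?thesis by simp
    qed
    finally have "\<theta> ^ i * (lam * real n / \<theta> - rate_single q) \<le> \<theta> ^ i * (rate_multi q - \<kappa> * rate_multi q)"
      using \<theta> by (intro mult_left_mono) auto
    also have "\<dots> \<le> 1 * (rate_multi q - \<kappa> * rate_multi q)"
      using km \<theta> by (intro mult_right_mono power_le_one) auto
    finally show ?thesis
      using g2 e by simp
  next
    case False
    then have "up \<le> \<theta> ^ m"
      using \<theta> by (cases "i = Suc m") (auto simp: up_def)
    then have "lam * real n * up \<le> lam * real n * \<theta> ^ m"
      using ln by (intro mult_left_mono) auto
    then show ?thesis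
      using g False km by (simp add: dn_def)
  qed
qed

text \<open>
  \<^term>\<open>g\<close> has negative drift away from the empty system; it removes the finitely many
  configurations without waiting customers from the exceptional set of \<^term>\<open>V\<close>.
\<close>

definition a :: real where "a = \<mu>min / (2 * (lam * real n + \<mu>min))"
definition total :: "'a config \<Rightarrow> nat" where "total q = (\<Sum>s\<in>S. q s)"
definition g :: "'a config \<Rightarrow> real" where "g q = 1 - a ^ total q"

lemma a_bounds: "0 < a" "a < 1"
  using \<mu>min_pos lam_pos n_pos by (auto simp: a_def divide_simps add_pos_pos intro: add_pos_pos)

lemma total_update: "s \<in> S \<Longrightarrow> total (q(s := x)) + q s = total q + x"
  using sum_update[of s real q x] unfolding total_def
  by (simp add: of_nat_sum[symmetric] del: of_nat_sum)

lemma total_pos: "s \<in> S \<Longrightarrow> q s > 0 \<Longrightarrow> total q > 0"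
  unfolding total_def by (rule sum_pos2[of _ s]) auto

text \<open>The geometric form makes a departure worth \<open>1 / a\<close> times an arrival, and a
  nonempty system has departure rate at least \<open>\<mu>min\<close>.\<close>

lemma gen_g_le:
  assumes "s \<in> S" "q s > 0"
  shows "gen R g q \<le> - (a ^ total q * (1 - a) * (lam * real n))"
proof -
  let ?N = "total q"
  have N: "?N > 0"
    by (rule total_pos[of s q, OF assms])
  have d: "g q' - g q = - (a ^ ?N * (1 - a) / a)" if "Suc (total q') = ?N" for q'
  proof -
    have "a ^ ?N = a * a ^ total q'"
      using that by (metis power_Suc)
    then have "a ^ ?N * (1 - a) / a = a ^ total q' * (1 - a)" "g q = 1 - a * a ^ total q'"
      using a_bounds by (simp_all add: g_def)
    then show ?thesis
      by (simp add: g_def algebra_simps)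
  qed
  have "gen R g q \<le> lam * real n * (a ^ ?N * (1 - a)) + (- (a ^ ?N * (1 - a) / a)) * rate_single q
      + (- (a ^ ?N * (1 - a) / a)) * rate_multi q"
  proof (rule gen_pull_le)
    fix s assume "s \<in> targets q"
    then have "s \<in> S"
      using targets_subset by auto
    then have "total (join B q s) = ?N \<or> total (join B q s) = Suc ?N"
      using total_update[of s q "q s + 1"] by (auto simp: join_def)
    then show "g (join B q s) - g q \<le> a ^ ?N * (1 - a)"
      using a_bounds by (auto simp: g_def algebra_simps)
  next
    fix s assume "s \<in> single q"
    then show "g (q(s := 0)) - g q \<le> - (a ^ ?N * (1 - a) / a)"
      using total_update[of s q 0] by (subst d) (auto simp: single_def)
  next
    fix s assume "s \<in> multi q"
    then show "g (q(s := q s - 1)) - g q \<le> - (a ^ ?N * (1 - a) / a)"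
      using total_update[of s q "q s - 1"] by (subst d) (auto simp: multi_def)
  qed
  also have "\<dots> = a ^ ?N * (1 - a) * (lam * real n - (rate_single q + rate_multi q) / a)"
  proof -
    have "y * x + - (x / a) * u + - (x / a) * v = x * (y - (u + v) / a)" for x y u v :: real
      by (simp add: right_diff_distrib distrib_left add_divide_distrib mult.commute)
    then show ?thesis .
  qed
  also have "\<dots> \<le> a ^ ?N * (1 - a) * (- (lam * real n))"
  proof (rule mult_left_mono)
    have "\<mu>min / a \<le> (rate_single q + rate_multi q) / a"
      using rate_busy_ge[of s q, OF assms] a_bounds by (intro divide_right_mono) auto
    \<comment> \<open>This equation dictates the choice of \<open>a\<close>: departures then
      outweigh arrivals twice over.\<close>
    moreover have "\<mu>min / a = 2 * (lam * real n + \<mu>min)"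
      using \<mu>min_pos by (simp add: a_def)
    ultimately have "2 * (lam * real n + \<mu>min) \<le> (rate_single q + rate_multi q) / a"
      by simp
    moreover have "y - x \<le> - y" if "2 * (y + \<mu>min) \<le> x" for x y :: real
      using that \<mu>min_pos by (simp add: distrib_left)
    ultimately show "lam * real n - (rate_single q + rate_multi q) / a \<le> - (lam * real n)"
      by blast
  qed (use a_bounds in auto)
  finally show ?thesis
    by simp
qed

text \<open>If no server holds two customers, there are at most \<open>n\<close> customers, so away
  from the empty system \<open>g\<close> falls at rate at least
  \<open>a ^ n * (1 - a) * (lam * real n)\<close>. \<open>K\<close> scales this up to exceed the
  worst upward drift of \<open>V\<close> by 1.\<close>

definition K :: real where "K = (lam * real n * \<theta> ^ m + 1) / (a ^ n * (1 - a) * (lam * real n))"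
definition W :: "'a config \<Rightarrow> real" where "W q = V q + K * g q"
definition \<epsilon> :: real where "\<epsilon> = min 1 (\<kappa> * \<mu>min / 2)"

lemma K_pos: "K > 0"
  unfolding K_def using lam_pos n_pos a_bounds \<theta> by (intro divide_pos_pos add_nonneg_pos mult_pos_pos) auto

lemma g_nonneg: "0 \<le> g q"
  using a_bounds by (simp add: g_def power_le_one)

lemma W_ge: "V q \<le> W q"
  using K_pos g_nonneg[of q] by (simp add: W_def)

text \<open>If some server holds two customers, \<open>V\<close> alone has drift at most
  \<open>- (\<kappa> * \<mu>min / 2)\<close> by \<open>small\<close>, and the drift of
  \<open>g\<close> is nonpositive; otherwise the choice of \<open>K\<close> decides.\<close>

lemma gen_W_le:
  assumes q: "q \<in> configs \<beta> B n" "q \<noteq> (\<lambda>_. 0)"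
  shows "gen R W q \<le> - \<epsilon>"
proof -
  have "\<exists>s. q s \<noteq> 0"
    using q(2) by (rule contrapos_np) (simp add: fun_eq_iff)
  then obtain s where "q s \<noteq> 0"
    by blast
  then have s: "s \<in> S" "q s > 0"
    using configs_servers[OF q(1)] by auto
  have W: "gen R W q = gen R V q + K * gen R g q"
    unfolding W_def by (simp add: gen_add gen_cmult)
  have g0: "gen R g q \<le> 0"
    using gen_g_le[of s q, OF s] a_bounds lam_pos by (smt (verit) mult_nonneg_nonneg of_nat_0_le_iff zero_le_power)
  show ?thesis
  proof (cases "multi q = {}")
    case False
    then have "1 \<le> card (multi q)"
      by (simp add: Suc_le_eq card_gt_0_iff)
    then have "\<mu>min * 1 \<le> \<mu>min * real (card (multi q))"
      using \<mu>min_pos by (intro mult_left_mono) auto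
    also have "\<dots> \<le> rate_multi q"
      by (rule rate_multi_ge)
    finally have "\<kappa> * \<mu>min \<le> \<kappa> * rate_multi q"
      using \<kappa> by (intro mult_left_mono) auto
    then have "gen R V q \<le> - (\<kappa> * \<mu>min / 2)"
      using gen_V_le[of q] small by linarith
    moreover have "K * gen R g q \<le> 0"
      using K_pos g0 by (simp add: mult_nonneg_nonpos)
    ultimately show ?thesis
      unfolding W \<epsilon>_def by linarith
  next
    case True
    have "q s \<le> 1" if "s \<in> S" for s
      using True that by (fastforce simp: multi_def)
    then have "total q \<le> (\<Sum>s\<in>S. 1)"
      unfolding total_def by (intro sum_mono) auto
    then have "total q \<le> n"
      by (simp add: card_S)
    then have "a ^ n \<le> a ^ total q"
      using a_bounds by (intro power_decreasing) auto
    then have "a ^ n * (1 - a) * (lam * real n) \<le> a ^ total q * (1 - a) * (lam * real n)"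
      using a_bounds lam_pos by (intro mult_right_mono) auto
    then have "gen R g q \<le> - (a ^ n * (1 - a) * (lam * real n))"
      using gen_g_le[of s q, OF s] by linarith
    then have "K * gen R g q \<le> K * (- (a ^ n * (1 - a) * (lam * real n)))"
      using K_pos by (intro mult_left_mono) auto
    also have "\<dots> = - (lam * real n * \<theta> ^ m + 1)"
      using a_bounds lam_pos n_pos by (simp add: K_def)
    finally have "K * gen R g q \<le> - (lam * real n * \<theta> ^ m + 1)" .
    moreover have "gen R V q \<le> lam * real n * \<theta> ^ m"
      using gen_V_le[of q] True by (simp add: rate_multi_def)
    ultimately show ?thesis
      unfolding W \<epsilon>_def by linarith
  qed
qed

lemma finite_sublevel_W: "finite {q \<in> configs \<beta> B n. W q \<le> c}"
proof (rule finite_subset)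
  let ?M = "nat \<lceil>c\<rceil> + 1"
  show "{q \<in> configs \<beta> B n. W q \<le> c} \<subseteq> {q. \<forall>s. (s \<in> S \<longrightarrow> q s \<in> {..?M}) \<and> (s \<notin> S \<longrightarrow> q s = 0)}"
  proof safe
    fix q s assume q: "W q \<le> c" "s \<in> S"
    have "real (q s - 1) \<le> (\<Sum>s\<in>S. real (q s - 1))"
      using q(2) by (intro member_le_sum) auto
    also have "\<dots> \<le> V q"
      unfolding V_def H_def using \<theta> by (auto intro!: sum_nonneg)
    also have "\<dots> \<le> c"
      using W_ge[of q] q(1) by linarith
    finally show "q s \<le> ?M"
      by linarith
  qed (auto simp: configs_def)
  show "finite {q. \<forall>s. (s \<in> S \<longrightarrow> q s \<in> {..?M}) \<and> (s \<notin> S \<longrightarrow> q s = (0::nat))}"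
    by (rule finite_set_of_finite_funs) auto
qed

end

sublocale pull_lyapunov \<subseteq> lyapunov_rates "pull_rate lam \<beta> \<mu> B n" "min (lam * real n) \<mu>min"
  "lam * real n + real n * (\<Sum>j\<in>UNIV. \<beta> j * \<mu> j)" "configs \<beta> B n" "\<lambda>_. 0" W \<epsilon>
proof
  show "(\<lambda>_. 0) \<in> configs \<beta> B n"
    by (auto simp: configs_def zero_enat_def[symmetric])
  show "0 \<le> W s" for s
    using W_ge[of s] V_nonneg[of s] by linarith
  show "0 < \<epsilon>"
    using \<kappa> \<mu>min_pos by (simp add: \<epsilon>_def)
qed (rule gen_W_le finite_sublevel_W; assumption?)+

section \<open>Irreducibility and positive recurrence\<close>

context pull
begin

text \<open>Irreducibility. PULL never lets a queue of length 2 form while a server is idle, so a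
  configuration with both long queues and idle servers is reached by a detour: empty the system,
  occupy all servers, build up the queues, and let the servers that should be idle finish.\<close>

lemma invariant_pos:
  assumes inv: "invariant \<pi>" and q: "q \<in> configs \<beta> B n"
  shows "pmf \<pi> q > 0"
proof -
  let ?P = "\<lambda>q. pmf \<pi> q > 0"
  let ?N = "\<lambda>q. \<Sum>s\<in>S. q s"
  note C = invariantD(1)[OF inv]
  have N_less: "?N (q(s := x)) < ?N q" if "s \<in> S" "x < q s" for q :: "'p config" and s x
    using sum_strict_mono_ex1[of S "q(s := x)" q] that by (auto split: if_splits)
  have down: "?P (q(s := q s - 1))" if "?P q" "s \<in> S" "q s > 0" for q s
  proof -
    have "q(s := q s - 1) \<noteq> q"
      using that(3) by (auto dest!: fun_cong[of _ _ s])
    then show ?thesis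
      using invariant_pos_step[OF inv that(1), of "q(s := q s - 1)"] rate_departure[of s q] that by auto
  qed
  have up: "?P (join B q s)" if "?P q" "s \<in> targets q" "join B q s \<noteq> q" for q s
    using invariant_pos_step[OF inv that(1), of "join B q s"] rate_arrival[OF that(2)] that(3) by auto
  have up_idle: "?P (q(s := 1))" if "?P q" "s \<in> I q" for q s
  proof -
    have "q(s := 1) \<noteq> q"
      using that(2) by (auto simp: idle_def dest!: fun_cong[of _ _ s])
    moreover have "s \<in> targets q"
      using that(2) by (auto simp: targets_def)
    ultimately show ?thesis
      using up[OF that(1), of s] join_idle[OF that(2)] by simp
  qed
  have zero: "?P (\<lambda>_. 0)"
  proof -
    have "?P q \<Longrightarrow> ?P (\<lambda>_. 0)" for q
    proof (induction "?N q" arbitrary: q rule: less_induct)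
      case less
      show ?case
      proof (cases "\<exists>s. q s \<noteq> 0")
        case True
        then obtain s where s: "q s > 0" by auto
        have "q \<in> configs \<beta> B n"
          using less.prems C by (auto simp: set_pmf_iff)
        then have sS: "s \<in> S"
          using s configs_servers by simp
        show ?thesis
          by (rule less.hyps[OF N_less[OF sS] down[OF less.prems sS s]]) (use s in simp)
      next
        case False
        then have "q = (\<lambda>_. 0)" by auto
        then show ?thesis using less.prems by simp
      qed
    qed
    moreover obtain q where "q \<in> set_pmf \<pi>"
      using set_pmf_not_empty[of \<pi>] by blast
    ultimately show ?thesis
      by (simp add: pmf_positive_iff)
  qed
  have small: "?P q" if "q \<in> configs \<beta> B n" "\<And>s. q s \<le> 1" for q
    using that
  proof (induction "?N q" arbitrary: q rule: less_induct)
    case less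
    show ?case
    proof (cases "\<exists>s. q s \<noteq> 0")
      case True
      then obtain s where s: "q s > 0" by auto
      then have s1: "q s = 1"
        using less.prems(2)[of s] by simp
      have sS: "s \<in> S"
        using s configs_servers[OF less.prems(1), of s] by simp
      have "?P (q(s := 0))"
      proof (rule less.hyps)
        show "?N (q(s := 0)) < ?N q"
          using N_less[OF sS, of 0 q] s by simp
        show "q(s := 0) \<in> configs \<beta> B n"
          using less.prems(1) by (auto simp: configs_def zero_enat_def[symmetric])
        show "(q(s := 0)) t \<le> 1" for t
          using less.prems(2)[of t] by simp
      qed
      then have "?P ((q(s := 0))(s := 1))"
        by (rule up_idle) (use sS in \<open>simp add: idle_def\<close>)
      also have "(q(s := 0))(s := 1) = q"
        using s1 by auto
      finally show ?thesis .
    next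
      case False
      then have "q = (\<lambda>_. 0)" by auto
      then show ?thesis using zero by simp
    qed
  qed
  \<comment> \<open>Without idle servers an arrival may join any server, so a queue of length at
    least 2 can have grown last; its predecessor has room because \<open>q\<close> respects the
    buffers.\<close>
  have full: "?P q" if "q \<in> configs \<beta> B n" "I q = {}" for q
    using that
  proof (induction "?N q" arbitrary: q rule: less_induct)
    case less
    show ?case
    proof (cases "\<exists>s. q s \<ge> 2")
      case True
      then obtain s where s: "q s \<ge> 2" by auto
      have sS: "s \<in> S"
        using s configs_servers[OF less.prems(1), of s] by simp
      let ?q = "q(s := q s - 1)"
      have qB: "enat (q s) \<le> B (fst s)"
        using less.prems(1) sS by (auto simp: configs_def)
      have lt: "enat (q s - 1) < enat (q s)"
        using s by simp
      have I: "I ?q = {}"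
        using less.prems(2) s by (auto simp: idle_def)
      have "?P ?q"
      proof (rule less.hyps[OF N_less[OF sS]])
        show "?q \<in> configs \<beta> B n"
          using less.prems(1) order_trans[OF less_imp_le[OF lt] qB] sS by (auto simp: configs_def)
        show "I ?q = {}"
          by (rule I)
      qed (use s in simp)
      moreover have "join B ?q s = q"
        using s order_less_le_trans[OF lt qB] by (auto simp: join_def)
      moreover have "s \<in> targets ?q"
        using I sS by (simp add: targets_def)
      moreover have "q \<noteq> ?q"
        using s by (auto dest!: fun_cong[of _ _ s])
      ultimately show ?thesis
        using up[of ?q s] by simp
    next
      case False
      have "q s \<le> 1" for s
      proof -
        have "\<not> 2 \<le> q s"
          using False by blast
        then show ?thesis by linarith
      qed
      then show ?thesis
        by (rule small[OF less.prems(1)])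
    qed
  qed
  show ?thesis
    using q
  proof (induction "card (I q)" arbitrary: q rule: less_induct)
    case less
    show ?case
    proof (cases "I q = {}")
      case True
      then show ?thesis by (rule full[OF less.prems])
    next
      case False
      then obtain s where s: "s \<in> I q" by auto
      then have sS: "s \<in> S" "q s = 0"
        by (auto simp: idle_def)
      \<comment> \<open>Any idle server of \<open>q\<close> may have been the last to finish; before
        that there was one idle server fewer.\<close>
      have "?P (q(s := 1))"
      proof (rule less.hyps)
        show "card (I (q(s := 1))) < card (I q)"
          unfolding idle_join[OF s] using s by (intro card_Diff1_less) auto
        show "q(s := 1) \<in> configs \<beta> B n"
          using less.prems sS B_ge[of "fst s"] by (auto simp: configs_def one_enat_def)
      qed
      then have "?P ((q(s := 1))(s := (q(s := 1)) s - 1))"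
        by (rule down) (use sS in auto)
      also have "(q(s := 1))(s := (q(s := 1)) s - 1) = q"
        using sS by auto
      finally show ?thesis .
    qed
  qed
qed

text \<open>Level \<open>Suc (q s)\<close> in the pool of \<open>s\<close> gains exactly one
  server.\<close>

lemma occupancy_increment:
  assumes "s \<in> S"
  shows "occupancy \<beta> n (q(s := Suc (q s))) \<noteq> occupancy \<beta> n q"
proof
  obtain j i where s: "s = (j, i)" "i < pool_size \<beta> n j"
    using assms by (auto simp: servers_def)
  let ?A = "\<lambda>q. {i. i < pool_size \<beta> n j \<and> Suc (q s) \<le> q (j, i)}"
  let ?q = "q(s := Suc (q s))"
  let ?k = "Suc (q s)"
  assume "occupancy \<beta> n ?q = occupancy \<beta> n q"
  then have "occupancy \<beta> n ?q ?k j = occupancy \<beta> n q ?k j"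
    by simp
  then have "card {i. i < pool_size \<beta> n j \<and> ?k \<le> ?q (j, i)} = card {i. i < pool_size \<beta> n j \<and> ?k \<le> q (j, i)}"
    using n_pos by (simp add: occupancy_def)
  also have "{i. i < pool_size \<beta> n j \<and> ?k \<le> ?q (j, i)} = insert i {i. i < pool_size \<beta> n j \<and> ?k \<le> q (j, i)}"
    using s by auto
  also have "card \<dots> = Suc (card {i. i < pool_size \<beta> n j \<and> ?k \<le> q (j, i)})"
    using s by (subst card_insert_disjoint) auto
  finally show False by simp
qed

text \<open>Every jump is thus visible in the occupancy, as
  \<open>nn_integral_return_time_finite\<close> asks.\<close>

lemma occupancy_changes: "R q q' \<noteq> 0 \<Longrightarrow> q' \<noteq> q \<Longrightarrow> occupancy \<beta> n q' \<noteq> occupancy \<beta> n q"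
proof -
  assume R: "R q q' \<noteq> 0" and ne: "q' \<noteq> q"
  from R show ?thesis
  proof (cases rule: rate_cases)
    case (arrival s)
    then have "q' = q(s := Suc (q s))" "s \<in> S"
      using ne targets_subset by (auto simp: join_def split: if_splits)
    then show ?thesis
      using occupancy_increment by simp
  next
    case (departure s)
    then have "q = q'(s := Suc (q' s))"
      by (auto simp: fun_eq_iff)
    then show ?thesis
      using occupancy_increment[OF departure(1), of q'] by metis
  qed
qed

lemma pull_ergodic_if_invariant:
  assumes inv: "invariant \<pi>"
  shows "pull_ergodic lam \<beta> \<mu> B n"
  unfolding pull_ergodic_def
proof
  fix q assume q: "q \<in> configs \<beta> B n"
  show "(\<integral>\<^sup>+\<omega>. return_time (occ_path \<beta> n \<omega>) (occupancy \<beta> n q) \<partial>path_law R (return_pmf q)) < \<infinity>"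
    unfolding occ_path_def[abs_def]
    by (rule nn_integral_return_time_finite[OF sum_avoid_le[OF inv invariant_pos[OF inv q]]])
       (rule occupancy_changes)
qed

section \<open>Stationary occupancy laws\<close>

definition occ_law :: "'p config pmf \<Rightarrow> 'p occ measure" where
  "occ_law \<pi> = distr (measure_pmf \<pi>) (occ_borel \<beta>) (occupancy \<beta> n)"

lemma measurable_occupancy: "occupancy \<beta> n \<in> count_space UNIV \<rightarrow>\<^sub>M occ_borel \<beta>"
proof -
  have "space (occ_borel \<beta>) = occ_space \<beta>"
    by (simp add: occ_borel_def space_measure_of_conv)
  then show ?thesis
    using occupancy_in_occ_space[OF n_sizes \<beta>_pos] by auto
qed

lemma emeasure_occ_path:
  assumes "X \<in> sets (occ_borel \<beta>)"
  shows "emeasure (distr (path_law R p) (occ_borel \<beta>) (\<lambda>\<omega>. occ_path \<beta> n \<omega> t)) X =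
     ennreal (\<integral>s. at_prob R (occupancy \<beta> n -` X) t s \<partial>measure_pmf p)"
proof -
  interpret P: prob_space "path_law R p"
    by (rule prob_space_path_law)
  have "emeasure (distr (path_law R p) (occ_borel \<beta>) (\<lambda>\<omega>. occ_path \<beta> n \<omega> t)) X =
      emeasure (path_law R p) {\<omega>. state_at \<omega> t \<in> occupancy \<beta> n -` X}"
    using assms measurable_occ_path[OF n_sizes \<beta>_pos]
    by (subst emeasure_distr) (auto simp: occ_path_def vimage_def)
  then show ?thesis
    by (simp add: P.emeasure_eq_measure prob_state_at[symmetric])
qed

lemma emeasure_occ_law:
  "X \<in> sets (occ_borel \<beta>) \<Longrightarrow> emeasure (occ_law \<pi>) X = ennreal (measure_pmf.prob \<pi> (occupancy \<beta> n -` X))"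
  unfolding occ_law_def using measurable_occupancy
  by (subst emeasure_distr) (simp_all add: measure_pmf.emeasure_eq_measure)

lemma invariant_stationary:
  assumes inv: "invariant \<pi>"
  shows "pull_stationary lam \<beta> \<mu> B n (occ_law \<pi>)"
  unfolding pull_stationary_def
proof (intro exI[of _ \<pi>] conjI allI impI)
  show "set_pmf \<pi> \<subseteq> configs \<beta> B n"
    by (rule invariantD(1)[OF inv])
  fix t :: real assume t: "0 \<le> t"
  show "distr (path_law R \<pi>) (occ_borel \<beta>) (\<lambda>\<omega>. occ_path \<beta> n \<omega> t) = occ_law \<pi>"
  proof (rule measure_eqI)
    fix X assume "X \<in> sets (distr (path_law R \<pi>) (occ_borel \<beta>) (\<lambda>\<omega>. occ_path \<beta> n \<omega> t))"
    then have "X \<in> sets (occ_borel \<beta>)" by simp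
    then show "emeasure (distr (path_law R \<pi>) (occ_borel \<beta>) (\<lambda>\<omega>. occ_path \<beta> n \<omega> t)) X = emeasure (occ_law \<pi>) X"
      by (simp add: emeasure_occ_path emeasure_occ_law invariant_at_prob[OF inv t])
  qed (simp add: occ_law_def)
qed

end

context pull_lyapunov
begin

text \<open>Constancy in time is known only for events determined by the occupancy, and the initial
  law on configurations may fail to be invariant; \<open>invariant_unique\<close> works event by
  event and copes with both.\<close>

lemma stationary_eq_occ_law:
  assumes inv: "invariant \<pi>" and st: "pull_stationary lam \<beta> \<mu> B n P"
  shows "P = occ_law \<pi>"
proof -
  obtain p where p: "set_pmf p \<subseteq> configs \<beta> B n"
    "\<And>t. t \<ge> 0 \<Longrightarrow> distr (path_law R p) (occ_borel \<beta>) (\<lambda>\<omega>. occ_path \<beta> n \<omega> t) = P"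
    using st unfolding pull_stationary_def by blast
  have sets: "sets P = sets (occ_borel \<beta>)"
    using p(2)[of 0] by (metis order_refl sets_distr)
  show ?thesis
  proof (rule measure_eqI)
    fix X assume "X \<in> sets P"
    then have X: "X \<in> sets (occ_borel \<beta>)"
      using sets by simp
    have E: "emeasure P X = ennreal (\<integral>s. at_prob R (occupancy \<beta> n -` X) t s \<partial>measure_pmf p)" if "t \<ge> 0" for t
      unfolding p(2)[OF that, symmetric] by (rule emeasure_occ_path[OF X])
    have nn: "0 \<le> (\<integral>s. at_prob R (occupancy \<beta> n -` X) t s \<partial>measure_pmf p)" for t
      by (intro integral_nonneg_AE) (simp add: at_prob_bounds)
    have "(\<integral>s. at_prob R (occupancy \<beta> n -` X) t s \<partial>measure_pmf p) =
        (\<integral>s. at_prob R (occupancy \<beta> n -` X) 0 s \<partial>measure_pmf p)" if "t \<ge> 0" for t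
      using E[OF that] E[of 0] nn by simp
    from invariant_unique[OF inv p(1) this]
    show "emeasure P X = emeasure (occ_law \<pi>) X"
      using E[of 0] by (simp add: emeasure_occ_law[OF X])
  qed (simp add: sets occ_law_def)
qed

lemma stationary_law_eq:
  assumes inv: "invariant \<pi>"
  shows "\<exists>!P. pull_stationary lam \<beta> \<mu> B n P" "stationary_law lam \<beta> \<mu> B n = occ_law \<pi>"
proof -
  show "\<exists>!P. pull_stationary lam \<beta> \<mu> B n P"
    using invariant_stationary[OF inv] stationary_eq_occ_law[OF inv] by (intro ex1I[of _ "occ_law \<pi>"])
  then show "stationary_law lam \<beta> \<mu> B n = occ_law \<pi>"
    unfolding stationary_law_def using invariant_stationary[OF inv] by (rule the1_equality)
qed

lemma invariant_multi_le:
  assumes inv: "invariant \<pi>"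
  shows "(\<integral>q. real (card (multi q)) \<partial>measure_pmf \<pi>) \<le> lam * real n * \<theta> ^ m / (\<kappa> * \<mu>min)"
proof -
  have cm: "real (card (multi q)) \<le> real n" for q
    using card_mono[of S "multi q"] by (simp add: multi_def card_S)
  have int: "integrable (measure_pmf \<pi>) (\<lambda>q. real (card (multi q)))"
    using cm by (intro measure_pmf.integrable_const_bound[of _ "real n"]) auto
  have "0 \<le> (\<integral>q. lam * real n * \<theta> ^ m - \<kappa> * \<mu>min * real (card (multi q)) \<partial>measure_pmf \<pi>)"
  proof (rule invariant_drift_bound[OF inv])
    fix q
    show "V q \<ge> 0"
      by (rule V_nonneg)
    have "\<kappa> * (\<mu>min * real (card (multi q))) \<le> \<kappa> * rate_multi q"
      using \<kappa> rate_multi_ge by (intro mult_left_mono) auto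
    then show "gen R V q \<le> lam * real n * \<theta> ^ m - \<kappa> * \<mu>min * real (card (multi q))"
      using gen_V_le[of q] by (simp add: mult.assoc)
    have "0 \<le> lam * real n * \<theta> ^ m" "0 \<le> \<kappa> * \<mu>min * real (card (multi q))"
      "\<kappa> * \<mu>min * real (card (multi q)) \<le> \<kappa> * \<mu>min * real n"
      using lam_pos \<theta> \<kappa> \<mu>min_pos cm[of q] by (auto intro!: mult_nonneg_nonneg mult_left_mono)
    then show "\<bar>lam * real n * \<theta> ^ m - \<kappa> * \<mu>min * real (card (multi q))\<bar> \<le>
        lam * real n * \<theta> ^ m + \<kappa> * \<mu>min * real n"
      by linarith
  qed
  also have "\<dots> = lam * real n * \<theta> ^ m - \<kappa> * \<mu>min * (\<integral>q. real (card (multi q)) \<partial>measure_pmf \<pi>)"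
    using int by simp
  finally show ?thesis
    using \<kappa> \<mu>min_pos by (simp add: pos_le_divide_eq mult.commute)
qed

end

section \<open>Concentration of the idle fractions\<close>

locale pull_equilibrium = pull +
  fixes \<nu> :: "'a \<Rightarrow> real"
  assumes eq: "equilibrium lam \<beta> \<mu> \<nu>"
begin

definition us :: "'a \<Rightarrow> real" where "us j = \<beta> j - \<nu> j"
text \<open>By \<open>lam_eq\<close> this is the arrival rate per idle server in equilibrium; the
  pool \<open>undefined\<close> stands for all pools, which share this value by
  \<open>\<nu>_eq\<close>.\<close>

definition w :: real where "w = \<nu> undefined * \<mu> undefined / us undefined"
definition cnt :: "'a config \<Rightarrow> 'a \<Rightarrow> nat" where "cnt q j = card {i. i < pool_size \<beta> n j \<and> q (j, i) = 0}"
definition D :: "'a config \<Rightarrow> 'a \<Rightarrow> real" where "D q j = real (cnt q j) / real n - us j"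
definition F :: "'a config \<Rightarrow> real" where "F q = (\<Sum>j\<in>UNIV. (D q j)\<^sup>2 / us j)"
definition C0 :: real where "C0 = lam * (\<Sum>j\<in>UNIV. 1 / us j) + 4 * (\<Sum>j\<in>UNIV. \<mu> j / us j)"

lemma \<nu>_bounds: "0 < \<nu> j" "\<nu> j < \<beta> j"
  using eq by (auto simp: equilibrium_def)

lemma us_pos: "0 < us j"
  using \<nu>_bounds by (simp add: us_def)

lemma \<beta>_le_1: "\<beta> j \<le> 1"
proof -
  have "\<beta> j \<le> (\<Sum>j\<in>UNIV. \<beta> j)"
    using \<beta>_pos by (intro member_le_sum) (auto simp: less_imp_le)
  then show ?thesis
    by (simp add: sum_\<beta>)
qed

lemma us_le_1: "us j \<le> 1"
  using \<beta>_le_1[of j] \<nu>_bounds[of j] by (simp add: us_def)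

lemma \<nu>_eq: "\<nu> j * \<mu> j = w * us j"
proof -
  have "\<nu> j * \<mu> j / us j = w"
    using eq unfolding equilibrium_def w_def us_def by blast
  then show ?thesis
    using us_pos[of j] by (simp add: field_simps)
qed

lemma lam_eq: "lam = w * (\<Sum>j\<in>UNIV. us j)"
  using eq by (simp add: equilibrium_def \<nu>_eq sum_distrib_left)

lemma w_pos: "w > 0"
  using \<nu>_bounds \<mu>_pos us_pos by (simp add: w_def)

lemma pool_size_real: "real (pool_size \<beta> n j) = \<beta> j * real n"
  by (rule pool_size_eq(1)[OF n_sizes \<beta>_pos])

lemma cnt_le: "real (cnt q j) / real n \<le> \<beta> j"
proof -
  have "cnt q j \<le> card {..<pool_size \<beta> n j}"
    unfolding cnt_def by (intro card_mono) auto
  then have "real (cnt q j) \<le> \<beta> j * real n"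
    by (simp add: pool_size_real[symmetric])
  then show ?thesis
    using n_pos by (simp add: pos_divide_le_eq)
qed

lemma D_bound: "\<bar>D q j\<bar> \<le> 1"
proof -
  have "0 \<le> real (cnt q j) / real n"
    by simp
  then show ?thesis
    using cnt_le[of q j] \<beta>_le_1[of j] us_pos[of j] us_le_1[of j]
    unfolding D_def abs_le_iff by linarith
qed

lemma sum_idle: "(\<Sum>s\<in>I q. G (fst s)) = (\<Sum>j\<in>UNIV. real (cnt q j) * G j)"
proof -
  have "I q = (SIGMA j:UNIV. {i. i < pool_size \<beta> n j \<and> q (j, i) = 0})"
    by (auto simp: idle_def servers_def)
  then have "(\<Sum>s\<in>I q. G (fst s)) = (\<Sum>j\<in>UNIV. \<Sum>i | i < pool_size \<beta> n j \<and> q (j, i) = 0. G j)"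
    by (simp only:) (subst sum.Sigma, auto simp: split_beta')
  then show ?thesis
    by (simp add: cnt_def)
qed

lemma sum_servers: "(\<Sum>s\<in>S. G (fst s)) = (\<Sum>j\<in>UNIV. real n * \<beta> j * G j)"
proof -
  have "(\<Sum>s\<in>S. G (fst s)) = (\<Sum>j\<in>UNIV. \<Sum>i<pool_size \<beta> n j. G j)"
    unfolding servers_def by (subst sum.Sigma) (auto simp: split_beta')
  then show ?thesis
    by (simp add: pool_size_real mult_ac)
qed

lemma card_idle: "real (card (I q)) = (\<Sum>j\<in>UNIV. real (cnt q j))"
  using sum_idle[of "\<lambda>_. 1" q] by simp

lemma F_diff:
  assumes "\<And>j'. real (cnt q' j') = real (cnt q j') + (if j' = j then e else 0)"
  shows "F q' - F q = (2 * D q j * (e / real n) + (e / real n)\<^sup>2) / us j"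
proof -
  have D: "D q' j' = D q j' + (if j' = j then e / real n else 0)" for j'
    using assms[of j'] by (simp add: D_def add_divide_distrib)
  have "F q' - F q = (\<Sum>j'\<in>UNIV. if j' = j then (2 * D q j * (e / real n) + (e / real n)\<^sup>2) / us j else 0)"
    unfolding F_def sum_subtractf[symmetric] D
    by (intro sum.cong) (auto simp: power2_sum diff_divide_distrib[symmetric] algebra_simps)
  then show ?thesis
    by simp
qed

lemma cnt_idle:
  assumes "s \<in> I q"
  shows "real (cnt (q(s := 1)) j) = real (cnt q j) + (if j = fst s then -1 else 0)"
proof -
  obtain j' i where s: "s = (j', i)" by (cases s)
  let ?A = "{k. k < pool_size \<beta> n j' \<and> q (j', k) = 0}"
  have i: "i \<in> ?A" "finite ?A"
    using assms s by (auto simp: idle_def servers_def)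
  have "{k. k < pool_size \<beta> n j' \<and> (q(s := 1)) (j', k) = 0} = ?A - {i}"
    using s by auto
  then have "cnt (q(s := 1)) j' = card ?A - 1"
    using i by (simp add: cnt_def)
  moreover have "card ?A > 0"
    using i by (auto simp: card_gt_0_iff)
  ultimately have "real (cnt (q(s := 1)) j') = real (cnt q j') - 1"
    by (simp add: cnt_def)
  moreover have "cnt (q(s := 1)) j = cnt q j" if "j \<noteq> j'"
    using that s by (auto simp: cnt_def)
  ultimately show ?thesis
    using s by auto
qed

lemma cnt_single:
  assumes "s \<in> single q"
  shows "real (cnt (q(s := 0)) j) = real (cnt q j) + (if j = fst s then 1 else 0)"
proof -
  have "s \<in> I (q(s := 0))"
    using assms by (auto simp: single_def idle_def)
  moreover have "(q(s := 0))(s := 1) = q"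
    using assms by (auto simp: single_def)
  ultimately show ?thesis
    using cnt_idle[of s "q(s := 0)" j] by simp
qed

lemma cnt_multi:
  assumes "s \<in> multi q"
  shows "cnt (q(s := q s - 1)) j = cnt q j"
  unfolding cnt_def using assms by (intro arg_cong[where f = card]) (auto simp: multi_def)

lemma cnt_no_idle: "I q = {} \<Longrightarrow> cnt q j = 0"
  using card_idle[of q] by (simp add: sum_nonneg_eq_0_iff)

text \<open>
  Cauchy-Schwarz in the form \<^prop>\<open>(\<Sum>j\<in>UNIV. D q j)\<^sup>2 \<le> (\<Sum>j\<in>UNIV. us j) * F q\<close> shows that routing
  to idle servers pulls the idle fractions towards the equilibrium proportions.
\<close>

lemma routing_drift:
  assumes "I q \<noteq> {}"
  shows "w * (\<Sum>j\<in>UNIV. D q j) \<le> lam * (\<Sum>j\<in>UNIV. real (cnt q j) / real (card (I q)) * (D q j / us j))"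
proof -
  define U where "U = (\<Sum>j\<in>UNIV. us j)"
  define \<Delta> where "\<Delta> = (\<Sum>j\<in>UNIV. D q j)"
  have U: "U > 0"
    unfolding U_def using us_pos by (intro sum_pos) auto
  have N: "real (card (I q)) / real n = U + \<Delta>"
    unfolding card_idle U_def \<Delta>_def by (simp add: D_def sum_subtractf sum_divide_distrib)
  have cI: "card (I q) > 0"
    using assms by (simp add: card_gt_0_iff)
  then have UD: "U + \<Delta> > 0"
    unfolding N[symmetric] using n_pos by simp
  have cs: "\<Delta>\<^sup>2 \<le> U * F q"
  proof -
    have "(\<Sum>j\<in>UNIV. sqrt (us j) * (D q j / sqrt (us j)))\<^sup>2 \<le>
        (\<Sum>j\<in>UNIV. (sqrt (us j))\<^sup>2) * (\<Sum>j\<in>UNIV. (D q j / sqrt (us j))\<^sup>2)"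
      by (rule Cauchy_Schwarz_ineq_sum)
    moreover have "sqrt (us j) * (D q j / sqrt (us j)) = D q j" "(sqrt (us j))\<^sup>2 = us j"
      "(D q j / sqrt (us j))\<^sup>2 = (D q j)\<^sup>2 / us j" for j
      using us_pos[of j] by (simp_all add: power_divide)
    ultimately show ?thesis
      by (simp add: \<Delta>_def U_def F_def)
  qed
  have "real (cnt q j) / real (card (I q)) * (D q j / us j) = (D q j + (D q j)\<^sup>2 / us j) / (U + \<Delta>)" for j
  proof -
    have 1: "real (cnt q j) / real (card (I q)) = (us j + D q j) / (U + \<Delta>)"
      unfolding N[symmetric] using n_pos cI by (simp add: D_def)
    have 2: "(us j + D q j) * (D q j / us j) = D q j + (D q j)\<^sup>2 / us j"
      using us_pos[of j] by (simp add: distrib_right power2_eq_square add_divide_distrib)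
    show ?thesis
      unfolding 1 2[symmetric] by simp
  qed
  then have "(\<Sum>j\<in>UNIV. real (cnt q j) / real (card (I q)) * (D q j / us j)) = (\<Delta> + F q) / (U + \<Delta>)"
    by (simp add: sum_divide_distrib[symmetric] sum.distrib \<Delta>_def F_def)
  \<comment> \<open>Clearing the denominator leaves \<open>\<Delta>\<^sup>2 \<le> U * F q\<close>,
    which is \<open>cs\<close>.\<close>
  moreover have "\<Delta> \<le> U * ((\<Delta> + F q) / (U + \<Delta>))"
  proof -
    have "\<Delta> * (U + \<Delta>) \<le> U * (\<Delta> + F q)"
      using cs by (simp add: algebra_simps power2_eq_square)
    then show ?thesis
      using UD by (simp add: pos_le_divide_eq)
  qed
  ultimately show ?thesis
    using w_pos mult_left_mono[of \<Delta> "U * ((\<Delta> + F q) / (U + \<Delta>))" w]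
    unfolding lam_eq U_def[symmetric] \<Delta>_def[symmetric] by (simp add: mult.assoc)
qed

text \<open>Pretend that every busy server, also one in \<open>multi\<close>, becomes idle when it
  completes a service: then the idle counts follow a closed equation, and the correction, bounded
  through \<open>G_abs\<close>, is the term with \<open>card (multi q)\<close>. In the closed
  equation the linear part \<open>2 * w * (\<Sum>j\<in>UNIV. D q j)\<close> of the services is
  cancelled by the arrivals through \<open>routing_drift\<close>, which leaves the negative sum of
  squares. Second-order terms of the jumps add up to order \<open>1 / n\<close>.\<close>

lemma gen_F_le:
  "gen R F q \<le> C0 * (1 + real (card (multi q))) / real n - 2 * \<mu>min * (\<Sum>j\<in>UNIV. (D q j)\<^sup>2)"
proof -
  \<comment> \<open>Rate times increment of \<open>F\<close> when a server of pool \<open>j\<close>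
    becomes idle.\<close>
  define G where "G j = \<mu> j * ((2 * D q j / real n + 1 / (real n)\<^sup>2) / us j)" for j
  define G0 where "G0 = (\<Sum>j\<in>UNIV. \<mu> j / us j)"
  define A where "A = (\<Sum>s\<in>targets q. lam * real n / real (card (targets q)) * (F (join B q s) - F q))"
  have rn: "real n \<ge> 1" "real n > 0"
    using n_pos by auto
  have G0: "G0 \<ge> 0"
    unfolding G0_def using \<mu>_pos us_pos by (intro sum_nonneg) (simp add: less_imp_le)
  have G0_ge: "\<mu> j / us j \<le> G0" for j
    unfolding G0_def using \<mu>_pos us_pos by (intro member_le_sum) (auto simp: less_imp_le)
  have multi0: "(\<Sum>s\<in>multi q. \<mu> (fst s) * (F (q(s := q s - 1)) - F q)) = 0"
    by (intro sum.neutral ballI) (simp add: F_def D_def cnt_multi del: One_nat_def)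
  have single: "(\<Sum>s\<in>single q. \<mu> (fst s) * (F (q(s := 0)) - F q)) = (\<Sum>s\<in>single q. G (fst s))"
  proof (intro sum.cong refl)
    fix s assume s: "s \<in> single q"
    show "\<mu> (fst s) * (F (q(s := 0)) - F q) = G (fst s)"
      using F_diff[of "q(s := 0)" q "fst s" 1] cnt_single[OF s] by (simp add: G_def power_divide)
  qed
  have "S = (single q \<union> multi q) \<union> I q"
    by (auto simp: single_def multi_def idle_def)
  then have "(\<Sum>s\<in>S. G (fst s)) = (\<Sum>s\<in>single q \<union> multi q. G (fst s)) + (\<Sum>s\<in>I q. G (fst s))"
    by (simp only:) (rule sum.union_disjoint, auto simp: single_def multi_def idle_def)
  also have "(\<Sum>s\<in>single q \<union> multi q. G (fst s)) = (\<Sum>s\<in>single q. G (fst s)) + (\<Sum>s\<in>multi q. G (fst s))"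
    by (rule sum.union_disjoint) (auto simp: single_def multi_def)
  finally have split: "(\<Sum>s\<in>single q. G (fst s)) =
      (\<Sum>j\<in>UNIV. (real n * \<beta> j - real (cnt q j)) * G j) - (\<Sum>s\<in>multi q. G (fst s))"
    unfolding sum_servers sum_idle by (simp add: left_diff_distrib sum_subtractf)
  have G_abs: "\<bar>G j\<bar> \<le> 3 * G0 / real n" for j
  proof -
    have "\<bar>2 * D q j / real n + 1 / (real n)\<^sup>2\<bar> \<le> \<bar>2 * D q j / real n\<bar> + \<bar>1 / (real n)\<^sup>2\<bar>"
      by (rule abs_triangle_ineq)
    also have "\<dots> \<le> 2 / real n + 1 / real n"
    proof (rule add_mono)
      show "\<bar>2 * D q j / real n\<bar> \<le> 2 / real n"
        using D_bound[of q j] rn by (simp add: abs_mult divide_right_mono)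
      show "\<bar>1 / (real n)\<^sup>2\<bar> \<le> 1 / real n"
        using rn by (simp add: power2_eq_square frac_le)
    qed
    also have "\<dots> = 3 / real n"
      by simp
    finally have b: "\<bar>2 * D q j / real n + 1 / (real n)\<^sup>2\<bar> \<le> 3 / real n" .
    have "\<bar>G j\<bar> = \<mu> j / us j * \<bar>2 * D q j / real n + 1 / (real n)\<^sup>2\<bar>"
      using \<mu>_pos[of j] us_pos[of j] by (simp add: G_def abs_mult)
    also have "\<dots> \<le> G0 * (3 / real n)"
      using b G0_ge[of j] G0 by (intro mult_mono) auto
    finally show ?thesis by (simp add: mult.commute)
  qed
  have multi: "- (\<Sum>s\<in>multi q. G (fst s)) \<le> real (card (multi q)) * (3 * G0 / real n)"
    unfolding sum_negf[symmetric] by (rule sum_bounded_above) (use G_abs in \<open>auto simp: abs_le_iff\<close>)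
  have busy: "(\<Sum>j\<in>UNIV. (real n * \<beta> j - real (cnt q j)) * G j) \<le>
      2 * w * (\<Sum>j\<in>UNIV. D q j) - 2 * \<mu>min * (\<Sum>j\<in>UNIV. (D q j)\<^sup>2) + G0 / real n"
  proof -
    have "(real n * \<beta> j - real (cnt q j)) * G j \<le> 2 * w * D q j - 2 * \<mu>min * (D q j)\<^sup>2 + \<mu> j / us j / real n" for j
    proof -
      have c: "real n * \<beta> j - real (cnt q j) = real n * (\<nu> j - D q j)"
        using rn by (simp add: D_def us_def right_diff_distrib)
      have e: "real n * (2 * D q j / real n + 1 / (real n)\<^sup>2) = 2 * D q j + 1 / real n"
        using rn by (simp add: distrib_left right_diff_distrib power2_eq_square)
      have "real n * (\<nu> j - D q j) * G j =
          (\<nu> j - D q j) * (\<mu> j / us j) * (real n * (2 * D q j / real n + 1 / (real n)\<^sup>2))"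
        by (simp add: G_def mult_ac)
      also have "\<dots> = 2 * (\<nu> j * \<mu> j / us j) * D q j - 2 * (\<mu> j / us j) * (D q j)\<^sup>2 +
          (\<nu> j - D q j) * (\<mu> j / us j / real n)"
      proof -
        have "(\<nu> j - y) * k * (2 * y + 1 / real n) = 2 * (\<nu> j * k) * y - 2 * k * y\<^sup>2 + (\<nu> j - y) * (k / real n)" for y k
          by (simp add: algebra_simps power2_eq_square diff_divide_distrib)
        from this[of "D q j" "\<mu> j / us j"] show ?thesis
          unfolding e by simp
      qed
      also have "\<nu> j * \<mu> j / us j = w"
        using \<nu>_eq[of j] us_pos[of j] by (simp add: field_simps)
      also have "2 * w * D q j - 2 * (\<mu> j / us j) * (D q j)\<^sup>2 + (\<nu> j - D q j) * (\<mu> j / us j / real n)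
          \<le> 2 * w * D q j - 2 * \<mu>min * (D q j)\<^sup>2 + 1 * (\<mu> j / us j / real n)"
      proof (intro add_mono diff_left_mono mult_right_mono)
        have "\<mu>min * us j \<le> \<mu>min * 1"
          using us_le_1[of j] \<mu>min_pos by (intro mult_left_mono) auto
        then have "\<mu>min \<le> \<mu> j / us j"
          using \<mu>min_le[of j] us_pos[of j] by (simp add: pos_le_divide_eq)
        then show "2 * \<mu>min \<le> 2 * (\<mu> j / us j)"
          by simp
        have "0 \<le> real (cnt q j) / real n"
          by simp
        then show "\<nu> j - D q j \<le> 1"
          using \<beta>_le_1[of j] unfolding D_def us_def by linarith
      qed (use \<mu>_pos[of j] us_pos[of j] in auto)
      finally show ?thesis
        unfolding c by simp
    qed
    then have "(\<Sum>j\<in>UNIV. (real n * \<beta> j - real (cnt q j)) * G j) \<le>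
        (\<Sum>j\<in>UNIV. 2 * w * D q j - 2 * \<mu>min * (D q j)\<^sup>2 + \<mu> j / us j / real n)"
      by (rule sum_mono)
    then show ?thesis
      by (simp only: sum.distrib sum_subtractf sum_distrib_left sum_divide_distrib G0_def)
  qed
  have arrivals: "A + 2 * w * (\<Sum>j\<in>UNIV. D q j) \<le> lam * (\<Sum>j\<in>UNIV. 1 / us j) / real n"
  proof (cases "I q = {}")
    \<comment> \<open>Without idle servers arrivals leave \<open>F\<close> alone, and every
      \<open>D q j\<close> equals \<open>- us j\<close>, so the left-hand side is
      nonpositive.\<close>
    case True
    have "F (join B q s) = F q" if "s \<in> targets q" for s
    proof -
      have "I (join B q s) = {}"
        using True that by (intro idle_join_full) (auto simp: targets_def)
      then show ?thesis
        using True by (simp add: F_def D_def cnt_no_idle)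
    qed
    then have "A = 0"
      by (simp add: A_def)
    moreover have "(\<Sum>j\<in>UNIV. D q j) \<le> 0"
      using True us_pos by (intro sum_nonpos) (simp add: D_def cnt_no_idle less_imp_le)
    moreover have "0 \<le> lam * (\<Sum>j\<in>UNIV. 1 / us j) / real n"
      using lam_pos us_pos by (intro divide_nonneg_nonneg mult_nonneg_nonneg sum_nonneg) (auto simp: less_imp_le)
    ultimately show ?thesis
      using w_pos mult_nonneg_nonpos[of "2 * w" "\<Sum>j\<in>UNIV. D q j"] by linarith
  next
    case False
    define P where "P j = real (cnt q j) / real (card (I q))" for j
    have cI: "card (I q) > 0"
      using False by (simp add: card_gt_0_iff)
    have P: "P j \<le> 1" "0 \<le> P j" for j
    proof -
      have "real (cnt q j) \<le> real (card (I q))"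
        unfolding card_idle by (intro member_le_sum) auto
      then show "P j \<le> 1" "0 \<le> P j"
        using cI by (simp_all add: P_def)
    qed
    have "A = (\<Sum>s\<in>I q. lam * real n / real (card (I q)) * ((- (2 * D q (fst s) / real n) + 1 / (real n)\<^sup>2) / us (fst s)))"
      unfolding A_def
    proof (intro sum.cong)
      show t: "targets q = I q"
        using False by (simp add: targets_def)
      fix s assume "s \<in> I q"
      then show "lam * real n / real (card (targets q)) * (F (join B q s) - F q) =
          lam * real n / real (card (I q)) * ((- (2 * D q (fst s) / real n) + 1 / (real n)\<^sup>2) / us (fst s))"
        using F_diff[of "q(s := 1)" q "fst s" "- 1"] cnt_idle[of s q] join_idle[of s q] t
        by (simp add: power_divide)
    qed
    also have "\<dots> = (\<Sum>j\<in>UNIV. real (cnt q j) * (lam * real n / real (card (I q)) * ((- (2 * D q j / real n) + 1 / (real n)\<^sup>2) / us j)))"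
      by (rule sum_idle)
    also have "\<dots> = (\<Sum>j\<in>UNIV. - 2 * lam * (P j * (D q j / us j)) + lam / real n * (P j / us j))"
    proof (intro sum.cong refl)
      fix j
      have e: "real n * (- (2 * D q j / real n) + 1 / (real n)\<^sup>2) = - 2 * D q j + 1 / real n"
        using rn by (simp add: distrib_left right_diff_distrib power2_eq_square)
      have "real (cnt q j) * (lam * real n / real (card (I q)) * ((- (2 * D q j / real n) + 1 / (real n)\<^sup>2) / us j)) =
          lam * P j * (real n * (- (2 * D q j / real n) + 1 / (real n)\<^sup>2)) / us j"
        by (simp add: P_def mult_ac)
      also have "\<dots> = - 2 * lam * (P j * (D q j / us j)) + lam / real n * (P j / us j)"
        unfolding e by (simp add: distrib_left add_divide_distrib mult_ac diff_divide_distrib right_diff_distrib)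
      finally show "real (cnt q j) * (lam * real n / real (card (I q)) * ((- (2 * D q j / real n) + 1 / (real n)\<^sup>2) / us j)) =
          - 2 * lam * (P j * (D q j / us j)) + lam / real n * (P j / us j)" .
    qed
    also have "\<dots> = - 2 * lam * (\<Sum>j\<in>UNIV. P j * (D q j / us j)) + lam / real n * (\<Sum>j\<in>UNIV. P j / us j)"
      by (simp only: sum.distrib sum_distrib_left)
    also have "lam / real n * (\<Sum>j\<in>UNIV. P j / us j) \<le> lam / real n * (\<Sum>j\<in>UNIV. 1 / us j)"
      using P us_pos lam_pos by (intro mult_left_mono sum_mono divide_right_mono) (auto simp: less_imp_le)
    finally show ?thesis
      using routing_drift[OF False] by (simp add: P_def)
  qed
  have "gen R F q \<le> A + (\<Sum>j\<in>UNIV. (real n * \<beta> j - real (cnt q j)) * G j) - (\<Sum>s\<in>multi q. G (fst s))"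
    unfolding gen_pull multi0 single split A_def by simp
  also have "\<dots> \<le> lam * (\<Sum>j\<in>UNIV. 1 / us j) / real n - 2 * \<mu>min * (\<Sum>j\<in>UNIV. (D q j)\<^sup>2) + G0 / real n
      + real (card (multi q)) * (3 * G0 / real n)"
    using arrivals busy multi by linarith
  also have "\<dots> \<le> C0 * (1 + real (card (multi q))) / real n - 2 * \<mu>min * (\<Sum>j\<in>UNIV. (D q j)\<^sup>2)"
  proof -
    define X where "X = lam * (\<Sum>j\<in>UNIV. 1 / us j)"
    define c where "c = real (card (multi q))"
    have "0 \<le> X" "0 \<le> c"
      unfolding X_def c_def using lam_pos us_pos by (auto intro!: mult_nonneg_nonneg sum_nonneg simp: less_imp_le)
    \<comment> \<open>The 4 in \<open>C0\<close> collects one \<open>G0\<close> from the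
      second-order terms of the services and three from \<open>G_abs\<close>.\<close>
    then have "X + G0 + c * (3 * G0) \<le> (X + 4 * G0) * (1 + c)"
      using G0 by (simp add: algebra_simps)
    then have "(X + G0 + c * (3 * G0)) / real n \<le> (X + 4 * G0) * (1 + c) / real n"
      by (rule divide_right_mono) simp
    then show ?thesis
      unfolding C0_def G0_def[symmetric] X_def[symmetric] c_def[symmetric] by (simp add: add_divide_distrib)
  qed
  finally show ?thesis .
qed

lemma F_bound: "\<bar>F q\<bar> \<le> (\<Sum>j\<in>UNIV. 1 / us j)"
proof -
  have "F q \<le> (\<Sum>j\<in>UNIV. 1 / us j)"
    unfolding F_def using D_bound us_pos
    by (intro sum_mono divide_right_mono) (auto simp: abs_square_le_1 less_imp_le)
  moreover have "0 \<le> F q"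
    unfolding F_def using us_pos by (intro sum_nonneg) (auto simp: less_imp_le)
  ultimately show ?thesis by simp
qed

lemma integrable_D: "integrable (measure_pmf \<pi>) (\<lambda>q. \<Sum>j\<in>UNIV. (D q j)\<^sup>2)"
  using D_bound
  by (intro Bochner_Integration.integrable_sum measure_pmf.integrable_const_bound[of _ 1])
     (auto simp: abs_square_le_1)

lemma integrable_multi: "integrable (measure_pmf \<pi>) (\<lambda>q. real (card (multi q)))"
proof -
  have "real (card (multi q)) \<le> real n" for q
    using card_mono[of S "multi q"] by (simp add: multi_def card_S)
  then show ?thesis
    by (intro measure_pmf.integrable_const_bound[of _ "real n"]) auto
qed

lemma invariant_D_le:
  assumes inv: "invariant \<pi>"
  shows "(\<integral>q. (\<Sum>j\<in>UNIV. (D q j)\<^sup>2) \<partial>measure_pmf \<pi>) \<le>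
    C0 * (1 + (\<integral>q. real (card (multi q)) \<partial>measure_pmf \<pi>)) / (2 * real n * \<mu>min)"
proof -
  note C = invariantD(1)[OF inv]
  have "0 = (\<integral>q. gen R F q \<partial>measure_pmf \<pi>)"
    by (rule invariantD(2)[OF inv F_bound, symmetric])
  also have "\<dots> \<le> (\<integral>q. C0 / real n * (1 + real (card (multi q))) - 2 * \<mu>min * (\<Sum>j\<in>UNIV. (D q j)\<^sup>2) \<partial>measure_pmf \<pi>)"
  proof (rule integral_mono)
    show "integrable (measure_pmf \<pi>) (gen R F)"
      by (rule integrable_bounded_on[OF C]) (rule abs_gen_le_on[OF F_bound])
    show "integrable (measure_pmf \<pi>) (\<lambda>q. C0 / real n * (1 + real (card (multi q))) - 2 * \<mu>min * (\<Sum>j\<in>UNIV. (D q j)\<^sup>2))"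
      by (intro Bochner_Integration.integrable_diff integrable_mult_right Bochner_Integration.integrable_add integrable_D integrable_multi) simp
    show "gen R F q \<le> C0 / real n * (1 + real (card (multi q))) - 2 * \<mu>min * (\<Sum>j\<in>UNIV. (D q j)\<^sup>2)" for q
      using gen_F_le[of q] by simp
  qed
  also have "\<dots> = C0 / real n * (1 + (\<integral>q. real (card (multi q)) \<partial>measure_pmf \<pi>)) -
      2 * \<mu>min * (\<integral>q. (\<Sum>j\<in>UNIV. (D q j)\<^sup>2) \<partial>measure_pmf \<pi>)"
    using integrable_multi integrable_D
    by (subst Bochner_Integration.integral_diff) (simp_all del: Bochner_Integration.integral_sum)
  finally have "0 \<le> C0 / real n * (1 + (\<integral>q. real (card (multi q)) \<partial>measure_pmf \<pi>)) -
      2 * \<mu>min * (\<integral>q. (\<Sum>j\<in>UNIV. (D q j)\<^sup>2) \<partial>measure_pmf \<pi>)" .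
  moreover have "x \<le> C0 * y / (2 * real n * \<mu>min)" if "0 \<le> C0 / real n * y - 2 * \<mu>min * x" for x y
  proof -
    have "2 * \<mu>min * x \<le> C0 * y / real n"
      using that by simp
    then have "2 * \<mu>min * x * real n \<le> C0 * y"
      using n_pos by (simp add: pos_le_divide_eq)
    then show ?thesis
      using \<mu>min_pos n_pos by (simp add: pos_le_divide_eq mult_ac)
  qed
  ultimately show ?thesis
    by blast
qed

section \<open>Distance to the equilibrium point\<close>

lemma x_star_eq:
  assumes "lam < (\<Sum>j\<in>UNIV. \<beta> j * \<mu> j)"
  shows "x_star lam \<beta> \<mu> = (\<lambda>k j. if k = 0 then \<beta> j else if k = 1 then \<nu> j else 0)"
proof -
  have "(THE \<nu>. equilibrium lam \<beta> \<mu> \<nu>) = \<nu>"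
    by (intro the1_equality equilibrium_ex1 lam_pos \<beta>_pos \<mu>_pos assms eq)
  then show ?thesis
    unfolding x_star_def by (simp only:)
qed

text \<open>Level 0 agrees exactly, level 1 deviates by the error of the idle fraction, and from
  level 2 on the occupancy is at most the fraction of servers in \<open>multi\<close>. The weights
  from level 1 on sum to 1.\<close>

lemma occ_dist_x_star_le:
  assumes "lam < (\<Sum>j\<in>UNIV. \<beta> j * \<mu> j)"
  shows "occ_dist (occupancy \<beta> n q) (x_star lam \<beta> \<mu>) \<le> (\<Sum>j\<in>UNIV. \<bar>D q j\<bar> + real (card (multi q)) / real n)"
  unfolding occ_dist_def
proof (rule sum_mono)
  fix j
  define d where "d k = \<bar>occupancy \<beta> n q k j - x_star lam \<beta> \<mu> k j\<bar>" for k
  define X where "X = \<bar>D q j\<bar> + real (card (multi q)) / real n"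
  have rn: "real n > 0"
    using n_pos by simp
  have d0: "d 0 = 0"
    using rn by (simp add: d_def occupancy_def x_star_eq[OF assms] pool_size_real)
  have d1: "d 1 = \<bar>D q j\<bar>"
  proof -
    have "card {i. i < pool_size \<beta> n j \<and> 1 \<le> q (j, i)} + cnt q j = pool_size \<beta> n j"
    proof -
      have "card ({i. i < pool_size \<beta> n j \<and> 1 \<le> q (j, i)} \<union> {i. i < pool_size \<beta> n j \<and> q (j, i) = 0}) =
          card {i. i < pool_size \<beta> n j \<and> 1 \<le> q (j, i)} + cnt q j"
        unfolding cnt_def by (rule card_Un_disjoint) auto
      moreover have "{i. i < pool_size \<beta> n j \<and> 1 \<le> q (j, i)} \<union> {i. i < pool_size \<beta> n j \<and> q (j, i) = 0} = {..<pool_size \<beta> n j}"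
        by auto
      ultimately show ?thesis
        by (simp only: card_lessThan)
    qed
    then have "real (card {i. i < pool_size \<beta> n j \<and> 1 \<le> q (j, i)}) + real (cnt q j) = \<beta> j * real n"
      unfolding pool_size_real[of j, symmetric] of_nat_add[symmetric] by (rule arg_cong)
    then have "real (card {i. i < pool_size \<beta> n j \<and> 1 \<le> q (j, i)}) = \<beta> j * real n - real (cnt q j)"
      by linarith
    then have "occupancy \<beta> n q 1 j - \<nu> j = - D q j"
      using rn by (simp add: occupancy_def D_def us_def diff_divide_distrib)
    then show ?thesis
      by (simp add: d_def x_star_eq[OF assms])
  qed
  have d2: "d k \<le> real (card (multi q)) / real n" if "k \<ge> 2" for k
  proof -
    have "card {i. i < pool_size \<beta> n j \<and> k \<le> q (j, i)} \<le> card (multi q)"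
      using that by (intro card_inj_on_le[where f = "Pair j"]) (auto simp: inj_on_def multi_def servers_def)
    then show ?thesis
      using that rn by (auto simp: d_def occupancy_def x_star_eq[OF assms] divide_right_mono)
  qed
  have dX: "d (Suc k) \<le> X" for k
  proof (cases k)
    case 0
    then show ?thesis
      using d1 rn by (simp add: X_def)
  next
    case (Suc k')
    then have "d (Suc k) \<le> real (card (multi q)) / real n"
      by (intro d2) simp
    then show ?thesis
      by (simp add: X_def)
  qed
  define g where "g = (\<lambda>k. (1/2) ^ k * (d k / (1 + d k)))"
  have s: "summable g"
    unfolding g_def d_def by (rule occ_dist_summable)
  have "g 0 = 0"
    by (simp add: g_def d0)
  then have "(\<Sum>k. g k) = (\<Sum>k. g (Suc k))"
    using suminf_split_head[OF s] by linarith
  also have "\<dots> \<le> (\<Sum>k. (1/2) ^ Suc k * X)"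
  proof (rule suminf_le)
    show "summable (\<lambda>k. g (Suc k))"
      by (subst summable_Suc_iff) (rule s)
    show "summable (\<lambda>k. (1/2) ^ Suc k * X)"
      using sums_mult2[OF power_half_series, of X] by (rule sums_summable)
    fix k
    have "0 \<le> d (Suc k)"
      by (simp add: d_def)
    then have "d (Suc k) / (1 + d (Suc k)) \<le> d (Suc k) / 1"
      by (intro divide_left_mono) auto
    then have "d (Suc k) / (1 + d (Suc k)) \<le> X"
      using dX[of k] by simp
    then show "g (Suc k) \<le> (1/2) ^ Suc k * X"
      unfolding g_def by (intro mult_left_mono) auto
  qed
  also have "\<dots> = 1 * X"
    by (rule sums_unique[symmetric]) (rule sums_mult2[OF power_half_series])
  also have "\<dots> = X"
    by simp
  finally show "(\<Sum>k. (1/2) ^ k * (\<bar>occupancy \<beta> n q k j - x_star lam \<beta> \<mu> k j\<bar> /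
      (1 + \<bar>occupancy \<beta> n q k j - x_star lam \<beta> \<mu> k j\<bar>))) \<le> \<bar>D q j\<bar> + real (card (multi q)) / real n"
    unfolding g_def d_def X_def .
qed

text \<open>A Chebyshev bound in pointwise form: the right-hand side dominates the indicator of
  being far from the limit and contains only quantities whose means are under control.\<close>

lemma far_from_x_star:
  assumes sub: "lam < (\<Sum>j\<in>UNIV. \<beta> j * \<mu> j)" and \<delta>: "\<delta> > 0"
    and far: "\<delta> \<le> occ_dist (occupancy \<beta> n q) (x_star lam \<beta> \<mu>)"
  shows "1 \<le> (2 * real CARD('a) / \<delta>)\<^sup>2 * (\<Sum>j\<in>UNIV. (D q j)\<^sup>2) + 2 * real CARD('a) / \<delta> * (real (card (multi q)) / real n)"
proof -
  \<comment> \<open>\<open>2 / c\<close> is the share of \<open>\<delta>\<close> that falls to one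
    pool; in some pool at least one of the two terms reaches half of it.\<close>
  define c where "c = 2 * real CARD('a) / \<delta>"
  define y where "y = real (card (multi q)) / real n"
  have c: "c > 0"
    using \<delta> by (simp add: c_def)
  have y: "y \<ge> 0"
    by (simp add: y_def)
  have "\<exists>j. \<delta> / real CARD('a) \<le> \<bar>D q j\<bar> + y"
  proof (rule ccontr)
    assume "\<not> ?thesis"
    then have "(\<Sum>j\<in>UNIV. \<bar>D q j\<bar> + y) < (\<Sum>j\<in>(UNIV :: 'a set). \<delta> / real CARD('a))"
      by (intro sum_strict_mono) (auto simp: not_le)
    also have "\<dots> = \<delta>"
      by simp
    finally show False
      using far occ_dist_x_star_le[OF sub, of q] by (simp add: y_def)
  qed
  then obtain j where j: "2 / c \<le> \<bar>D q j\<bar> + y"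
    using \<delta> by (auto simp: c_def)
  have nn: "0 \<le> c\<^sup>2 * (\<Sum>j\<in>UNIV. (D q j)\<^sup>2)" "0 \<le> c * y"
    using c y by (auto intro!: mult_nonneg_nonneg sum_nonneg)
  show ?thesis
    unfolding c_def[symmetric] y_def[symmetric]
  proof (cases "1 / c \<le> y")
    case True
    then have "1 \<le> c * y"
      using c by (simp add: pos_divide_le_eq mult.commute)
    then show "1 \<le> c\<^sup>2 * (\<Sum>j\<in>UNIV. (D q j)\<^sup>2) + c * y"
      using nn by linarith
  next
    case False
    then have "1 / c \<le> \<bar>D q j\<bar>"
      using j by (simp add: field_simps)
    then have "1 \<le> c * \<bar>D q j\<bar>"
      using c by (simp add: pos_divide_le_eq mult.commute)
    then have "1 \<le> (c * \<bar>D q j\<bar>)\<^sup>2"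
      by (simp add: one_le_power)
    also have "\<dots> = c\<^sup>2 * (D q j)\<^sup>2"
      by (simp add: power_mult_distrib)
    also have "\<dots> \<le> c\<^sup>2 * (\<Sum>j\<in>UNIV. (D q j)\<^sup>2)"
      by (intro mult_left_mono member_le_sum) auto
    finally show "1 \<le> c\<^sup>2 * (\<Sum>j\<in>UNIV. (D q j)\<^sup>2) + c * y"
      using nn by linarith
  qed
qed

text \<open>Near the limit the continuity bound \<open>e\<close> applies; away from it the trivial
  bound \<open>2 * M\<close> is multiplied by the pointwise estimate of
  \<open>far_from_x_star\<close>.\<close>

lemma occ_law_integral_close:
  assumes sub: "lam < (\<Sum>j\<in>UNIV. \<beta> j * \<mu> j)" and \<delta>: "\<delta> > 0" and e: "e \<ge> 0"
    and f: "f \<in> borel_measurable (occ_borel \<beta>)"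
    and M: "\<And>x. x \<in> occ_space \<beta> \<Longrightarrow> \<bar>f x\<bar> \<le> M"
    and close: "\<And>x. x \<in> occ_space \<beta> \<Longrightarrow> occ_dist x (x_star lam \<beta> \<mu>) < \<delta> \<Longrightarrow> \<bar>f x - f (x_star lam \<beta> \<mu>)\<bar> \<le> e"
  shows "\<bar>(\<integral>x. f x \<partial>occ_law \<pi>) - f (x_star lam \<beta> \<mu>)\<bar> \<le> e + 2 * M *
    ((2 * real CARD('a) / \<delta>)\<^sup>2 * (\<integral>q. (\<Sum>j\<in>UNIV. (D q j)\<^sup>2) \<partial>measure_pmf \<pi>) +
     2 * real CARD('a) / \<delta> * ((\<integral>q. real (card (multi q)) \<partial>measure_pmf \<pi>) / real n))"
proof -
  define y where "y = x_star lam \<beta> \<mu>"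
  define c where "c = 2 * real CARD('a) / \<delta>"
  define h where "h q = c\<^sup>2 * (\<Sum>j\<in>UNIV. (D q j)\<^sup>2) + c * (real (card (multi q)) / real n)" for q
  have occ: "occupancy \<beta> n q \<in> occ_space \<beta>" for q
    by (rule occupancy_in_occ_space[OF n_sizes \<beta>_pos])
  have y: "y \<in> occ_space \<beta>"
    unfolding y_def by (rule x_star_in_occ_space[OF lam_pos \<beta>_pos \<mu>_pos sub])
  have M0: "0 \<le> M"
    using M[OF y] by (rule order_trans[OF abs_ge_zero])
  have c: "c > 0"
    using \<delta> by (simp add: c_def)
  have h0: "0 \<le> h q" for q
    unfolding h_def using c by (auto intro!: add_nonneg_nonneg mult_nonneg_nonneg sum_nonneg)
  have pt: "\<bar>f (occupancy \<beta> n q) - f y\<bar> \<le> e + 2 * M * h q" for q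
  proof (cases "occ_dist (occupancy \<beta> n q) y < \<delta>")
    case True
    then have "\<bar>f (occupancy \<beta> n q) - f y\<bar> \<le> e"
      using close[OF occ] by (simp add: y_def)
    moreover have "0 \<le> 2 * M * h q"
      using M0 h0 by simp
    ultimately show ?thesis by linarith
  next
    case False
    have "\<bar>f (occupancy \<beta> n q) - f y\<bar> \<le> 2 * M * 1"
      using M[OF occ[of q]] M[OF y] by linarith
    also have "\<dots> \<le> 2 * M * h q"
      using far_from_x_star[OF sub \<delta>, of q] False M0
      by (intro mult_left_mono) (auto simp: h_def c_def y_def)
    finally show ?thesis
      using e by linarith
  qed
  have int_f: "integrable (measure_pmf \<pi>) (\<lambda>q. f (occupancy \<beta> n q))"
    using M[OF occ] by (intro measure_pmf.integrable_const_bound[of _ M]) auto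
  have int_h: "integrable (measure_pmf \<pi>) h"
    unfolding h_def by (intro Bochner_Integration.integrable_add integrable_mult_right integrable_D integrable_divide integrable_multi)
  have "(\<integral>x. f x \<partial>occ_law \<pi>) = (\<integral>q. f (occupancy \<beta> n q) \<partial>measure_pmf \<pi>)"
    unfolding occ_law_def using measurable_occupancy by (intro integral_distr f) simp
  then have "\<bar>(\<integral>x. f x \<partial>occ_law \<pi>) - f y\<bar> = \<bar>\<integral>q. f (occupancy \<beta> n q) - f y \<partial>measure_pmf \<pi>\<bar>"
    using int_f by simp
  also have "\<dots> \<le> (\<integral>q. \<bar>f (occupancy \<beta> n q) - f y\<bar> \<partial>measure_pmf \<pi>)"
    by (rule integral_abs_bound)
  also have "\<dots> \<le> (\<integral>q. e + 2 * M * h q \<partial>measure_pmf \<pi>)"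
    using int_f int_h pt
    by (intro integral_mono) (auto intro!: integrable_abs Bochner_Integration.integrable_diff Bochner_Integration.integrable_add)
  also have "\<dots> = e + 2 * M * (\<integral>q. h q \<partial>measure_pmf \<pi>)"
    using int_h by simp
  also have "(\<integral>q. h q \<partial>measure_pmf \<pi>) = c\<^sup>2 * (\<integral>q. (\<Sum>j\<in>UNIV. (D q j)\<^sup>2) \<partial>measure_pmf \<pi>) +
      c * ((\<integral>q. real (card (multi q)) \<partial>measure_pmf \<pi>) / real n)"
    unfolding h_def using integrable_D integrable_multi
    by (subst Bochner_Integration.integral_add) (simp_all del: Bochner_Integration.integral_sum)
  finally show ?thesis
    by (simp add: c_def y_def del: Bochner_Integration.integral_sum)
qed

end

section \<open>The limit\<close>

lemma boundary_drift_tendsto_0: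
  fixes c \<theta> lam :: real
  assumes c: "c > 0" and \<theta>: "0 < \<theta>" "\<theta> < 1" and lam: "lam > 0"
  shows "(\<lambda>n. lam * real n * \<theta> ^ nat \<lfloor>c * real n\<rfloor>) \<longlonglongrightarrow> 0"
proof -
  define b where "b = - ln \<theta>"
  have b: "b > 0"
    using \<theta> by (simp add: b_def)
  have bound: "lam * real n * \<theta> ^ nat \<lfloor>c * real n\<rfloor> \<le> lam * real n * (exp b * exp (- (b * c) * real n))" for n
  proof (rule mult_left_mono)
    \<comment> \<open>Rounding down costs at most one power of \<open>\<theta>\<close>, which
      becomes the constant \<open>exp b\<close>.\<close>
    have "c * real n - 1 \<le> real (nat \<lfloor>c * real n\<rfloor>)"
      using c by linarith
    then have "b * (c * real n - 1) \<le> b * real (nat \<lfloor>c * real n\<rfloor>)"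
      using b by (intro mult_left_mono) auto
    then have "exp (- (b * real (nat \<lfloor>c * real n\<rfloor>))) \<le> exp (b + - (b * c) * real n)"
      by (simp add: algebra_simps)
    also have "exp (- (b * real (nat \<lfloor>c * real n\<rfloor>))) = \<theta> ^ nat \<lfloor>c * real n\<rfloor>"
      using \<theta> by (simp add: b_def exp_of_nat_mult[symmetric] mult.commute exp_of_nat2_mult)
    finally show "\<theta> ^ nat \<lfloor>c * real n\<rfloor> \<le> exp b * exp (- (b * c) * real n)"
      by (simp add: exp_add[symmetric])
  qed (use lam in simp)
  have "(\<lambda>n. lam * real n * (exp b * exp (- k * real n))) \<longlonglongrightarrow> 0" if "k > 0" for k
    using that lam b by real_asymp
  from this[of "b * c"] have lim: "(\<lambda>n. lam * real n * (exp b * exp (- (b * c) * real n))) \<longlonglongrightarrow> 0"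
    using b c by simp
  show ?thesis
    by (rule tendsto_sandwich[OF _ _ tendsto_const lim]) (use bound lam \<theta> in auto)
qed

section \<open>Choice of constants and weak convergence\<close>

context
  fixes lam :: real and \<beta> \<mu> :: "'p::finite \<Rightarrow> real" and B :: "'p \<Rightarrow> enat"
  assumes lam: "lam > 0" and \<beta>: "\<And>j. \<beta> j > 0" and \<mu>: "\<And>j. \<mu> j > 0" and B: "\<And>j. B j \<ge> 1"
    and sum_\<beta>: "(\<Sum>j\<in>UNIV. \<beta> j) = 1"
    and sub: "lam < (\<Sum>j\<in>UNIV. \<beta> j * \<mu> j)"
begin

text \<open>Records what the locales yield for a single size, with one error bound for both means,
  so that the limit can be taken by filter reasoning outside them.\<close>

definition near_equilibrium :: "('p \<Rightarrow> real) \<Rightarrow> nat \<Rightarrow> real \<Rightarrow> bool" where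
  "near_equilibrium \<nu> n e \<longleftrightarrow> n \<in> sizes \<beta> \<and> pull_ergodic lam \<beta> \<mu> B n \<and>
     (\<exists>!P. pull_stationary lam \<beta> \<mu> B n P) \<and>
     (\<exists>\<pi>. stationary_law lam \<beta> \<mu> B n = pull.occ_law \<beta> n \<pi> \<and>
        (\<integral>q. (\<Sum>j\<in>UNIV. (pull_equilibrium.D \<beta> n \<nu> q j)\<^sup>2) \<partial>measure_pmf \<pi>) \<le> e \<and>
        (\<integral>q. real (card (pull.multi \<beta> n q)) \<partial>measure_pmf \<pi>) / real n \<le> e)"

lemma eventually_stationary:
  fixes \<nu> :: "'p \<Rightarrow> real"
  assumes eq: "equilibrium lam \<beta> \<mu> \<nu>"
  obtains a :: "nat \<Rightarrow> real" where "a \<longlonglongrightarrow> 0"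
    "\<forall>\<^sub>F n in inf sequentially (principal (sizes \<beta>)). near_equilibrium \<nu> n (a n)"
proof -
  define \<sigma> where "\<sigma> = (\<Sum>j\<in>UNIV. \<beta> j * \<mu> j)"
  define lo hi where "lo = Min (range \<mu>)" and "hi = Max (range \<mu>)"
  have lo: "lo > 0"
    unfolding lo_def using \<mu> by (subst Min_gr_iff) auto
  have "\<mu> undefined \<le> hi"
    unfolding hi_def by (rule Max_ge) auto
  then have hi: "hi > 0"
    using \<mu>[of undefined] by linarith
  \<comment> \<open>The capacity gap is split into three equal parts: one for the increase from
    \<open>lam\<close> to \<open>lam / \<theta>\<close>, one for the capacity lost to
    \<open>m\<close> idle servers, one for \<open>\<eta>\<close>.\<close>
  define d where "d = (\<sigma> - lam) / 3"
  have d: "d > 0" "lam + 3 * d = \<sigma>"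
    using sub unfolding d_def \<sigma>_def[symmetric] by (simp_all add: field_simps)
  define c where "c = d / hi"
  define \<theta> where "\<theta> = lam / (lam + d)"
  define \<kappa> where "\<kappa> = min 1 (d / hi)"
  define m where "m n = nat \<lfloor>c * real n\<rfloor>" for n :: nat
  define en where "en n = lam * real n * \<theta> ^ m n" for n :: nat
  define C0 where "C0 = lam * (\<Sum>j\<in>UNIV. 1 / (\<beta> j - \<nu> j)) + 4 * (\<Sum>j\<in>UNIV. \<mu> j / (\<beta> j - \<nu> j))"
  have c: "c > 0" "c * hi = d"
    using d hi by (auto simp: c_def)
  have \<theta>: "0 < \<theta>" "\<theta> < 1" "lam / \<theta> = lam + d"
    using lam d by (auto simp: \<theta>_def)
  have \<kappa>: "0 < \<kappa>" "\<kappa> \<le> 1" "\<kappa> * hi \<le> d"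
  proof -
    show "0 < \<kappa>" "\<kappa> \<le> 1"
      using d hi by (auto simp: \<kappa>_def)
    have "\<kappa> * hi \<le> d / hi * hi"
      using hi by (intro mult_right_mono) (auto simp: \<kappa>_def)
    then show "\<kappa> * hi \<le> d"
      using hi by simp
  qed
  have en: "en \<longlonglongrightarrow> 0"
    unfolding en_def m_def by (rule boundary_drift_tendsto_0[OF c(1) \<theta>(1,2) lam])
  have C0: "C0 \<ge> 0"
    unfolding C0_def using eq lam \<mu>
    by (intro add_nonneg_nonneg mult_nonneg_nonneg sum_nonneg) (auto simp: equilibrium_def less_imp_le)
  \<comment> \<open>The sum of the bounds on the two means; for the sizes considered both summands
    are nonnegative, so it dominates each.\<close>
  define a where "a n = C0 * (1 + en n / (\<kappa> * lo)) / (2 * real n * lo) + en n / (\<kappa> * lo) / real n" for n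
  have lim: "a \<longlonglongrightarrow> 0"
  proof -
    have 1: "(\<lambda>n. 1 / real n) \<longlonglongrightarrow> 0"
      by (rule lim_1_over_n)
    have "(\<lambda>n. C0 * (1 + en n / (\<kappa> * lo)) / (2 * lo) * (1 / real n) + en n / (\<kappa> * lo) * (1 / real n)) \<longlonglongrightarrow>
        C0 * (1 + 0 / (\<kappa> * lo)) / (2 * lo) * 0 + 0 / (\<kappa> * lo) * 0"
      using \<kappa> lo by (intro tendsto_intros en 1) auto
    also have "(\<lambda>n. C0 * (1 + en n / (\<kappa> * lo)) / (2 * lo) * (1 / real n) + en n / (\<kappa> * lo) * (1 / real n)) = a"
      by (auto simp: a_def fun_eq_iff)
    finally show ?thesis
      by simp
  qed
  \<comment> \<open>This is the assumption \<open>small\<close> of \<open>pull_lyapunov\<close>, the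
    only one of its assumptions that asks for large \<open>n\<close>.\<close>
  have "\<forall>\<^sub>F n in sequentially. en n < \<kappa> * lo / 2"
    using \<kappa> lo by (intro order_tendstoD(2)[OF en]) simp
  then have "\<forall>\<^sub>F n in inf sequentially (principal (sizes \<beta>)). n \<in> sizes \<beta> \<and> en n < \<kappa> * lo / 2"
    unfolding eventually_inf_principal by eventually_elim simp
  then have ev: "\<forall>\<^sub>F n in inf sequentially (principal (sizes \<beta>)). near_equilibrium \<nu> n (a n)"
  proof eventually_elim
    case (elim n)
    interpret P: pull lam \<beta> \<mu> B n
      by standard (use lam \<beta> \<mu> B sum_\<beta> elim in auto)
    have lo_eq: "P.\<mu>min = lo" and hi_eq: "P.\<mu>max = hi"
      by (simp_all add: P.\<mu>min_def P.\<mu>max_def lo_def hi_def)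
    have n: "real n > 0"
      using P.n_pos by simp
    interpret PL: pull_lyapunov lam \<beta> \<mu> B n \<theta> d \<kappa> "m n"
    proof
      have "real (m n) \<le> c * real n"
        using c by (simp add: m_def)
      then have "real (m n) * hi \<le> c * real n * hi"
        using hi by (intro mult_right_mono) auto
      also have "\<dots> = d * real n"
        using c(2) by (simp add: mult_ac)
      finally have "real (m n) * hi \<le> d * real n" .
      moreover have "lam * real n / \<theta> = (lam + d) * real n"
        using \<theta>(3) by (simp add: times_divide_eq_left[symmetric])
      moreover have "real n * \<sigma> = (lam + 3 * d) * real n"
        using d(2) by simp
      ultimately show "lam * real n / \<theta> + real (m n) * P.\<mu>max + real n * d \<le> real n * (\<Sum>j\<in>UNIV. \<beta> j * \<mu> j)"
        unfolding hi_eq \<sigma>_def[symmetric] by (simp add: algebra_simps)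
      show "lam * real n * \<theta> ^ m n \<le> \<kappa> * P.\<mu>min / 2"
        using elim by (simp add: lo_eq en_def)
    qed (use \<theta> d \<kappa> in \<open>auto simp: hi_eq\<close>)
    interpret PE: pull_equilibrium lam \<beta> \<mu> B n \<nu>
      by standard (rule eq)
    obtain \<pi> where \<pi>: "P.invariant \<pi>"
      using PL.invariant_exists by blast
    define y where "y = (\<integral>q. real (card (P.multi q)) \<partial>measure_pmf \<pi>)"
    have y: "y \<le> en n / (\<kappa> * lo)"
      using PL.invariant_multi_le[OF \<pi>] by (simp add: y_def en_def lo_eq)
    have C0_eq: "PE.C0 = C0"
      by (simp add: PE.C0_def PE.us_def C0_def)
    have "(\<integral>q. (\<Sum>j\<in>UNIV. (PE.D q j)\<^sup>2) \<partial>measure_pmf \<pi>) \<le> C0 * (1 + y) / (2 * real n * lo)"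
      using PE.invariant_D_le[OF \<pi>] by (simp only: C0_eq lo_eq y_def)
    also have "\<dots> \<le> C0 * (1 + en n / (\<kappa> * lo)) / (2 * real n * lo)"
      using y C0 lo n by (intro divide_right_mono mult_left_mono) auto
    finally have 1: "(\<integral>q. (\<Sum>j\<in>UNIV. (PE.D q j)\<^sup>2) \<partial>measure_pmf \<pi>) \<le> C0 * (1 + en n / (\<kappa> * lo)) / (2 * real n * lo)" .
    have 2: "y / real n \<le> en n / (\<kappa> * lo) / real n"
      using y n by (intro divide_right_mono) auto
    have nn: "0 \<le> C0 * (1 + en n / (\<kappa> * lo)) / (2 * real n * lo)" "0 \<le> en n / (\<kappa> * lo) / real n"
      using C0 lo n \<kappa> lam \<theta> by (auto simp: en_def)
    show ?case
      unfolding near_equilibrium_def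
    proof (intro conjI exI[of _ \<pi>])
      show "n \<in> sizes \<beta>"
        using elim by simp
      show "pull_ergodic lam \<beta> \<mu> B n"
        by (rule P.pull_ergodic_if_invariant[OF \<pi>])
      show "\<exists>!P. pull_stationary lam \<beta> \<mu> B n P" "stationary_law lam \<beta> \<mu> B n = P.occ_law \<pi>"
        by (rule PL.stationary_law_eq[OF \<pi>])+
      show "(\<integral>q. (\<Sum>j\<in>UNIV. (PE.D q j)\<^sup>2) \<partial>measure_pmf \<pi>) \<le> a n"
        using 1 nn unfolding a_def by linarith
      show "(\<integral>q. real (card (P.multi q)) \<partial>measure_pmf \<pi>) / real n \<le> a n"
        using 2 nn unfolding a_def y_def by linarith
    qed
  qed
  show thesis
    by (rule that[OF lim ev])
qed

lemma borel_measurable_continuous_map_occ: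
  assumes "continuous_map (occ_top \<beta>) euclideanreal f"
  shows "f \<in> borel_measurable (occ_borel \<beta>)"
proof (rule borel_measurableI)
  interpret M: Metric_space "occ_space \<beta>" occ_dist
    by (rule Metric_space_occ)
  have space: "space (occ_borel \<beta>) = occ_space \<beta>"
    by (simp add: occ_borel_def space_measure_of_conv)
  have sub: "{U. openin (occ_top \<beta>) U} \<subseteq> Pow (occ_space \<beta>)"
    using openin_subset[of "occ_top \<beta>"] by auto
  fix U :: "real set" assume "open U"
  then have "openin (occ_top \<beta>) {x \<in> topspace (occ_top \<beta>). f x \<in> U}"
    using assms by (intro openin_continuous_map_preimage) auto
  moreover have "{x \<in> topspace (occ_top \<beta>). f x \<in> U} = f -` U \<inter> space (occ_borel \<beta>)"
    by (auto simp: space)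
  ultimately show "f -` U \<inter> space (occ_borel \<beta>) \<in> sets (occ_borel \<beta>)"
    using sub by (auto simp: occ_borel_def)
qed

lemma continuous_map_occ_close:
  fixes e :: real
  assumes f: "continuous_map (occ_top \<beta>) euclideanreal f" and y: "y \<in> occ_space \<beta>" and e: "e > 0"
  obtains \<delta> where "\<delta> > 0" "\<And>x. x \<in> occ_space \<beta> \<Longrightarrow> occ_dist x y < \<delta> \<Longrightarrow> \<bar>f x - f y\<bar> \<le> e"
proof -
  interpret M: Metric_space "occ_space \<beta>" occ_dist
    by (rule Metric_space_occ)
  let ?U = "{x \<in> topspace (occ_top \<beta>). f x \<in> ball (f y) e}"
  have "openin (occ_top \<beta>) ?U"
    using f by (intro openin_continuous_map_preimage) auto
  moreover have "y \<in> ?U"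
    using y e by simp
  ultimately obtain \<delta> where \<delta>: "\<delta> > 0" "M.mball y \<delta> \<subseteq> ?U"
    unfolding M.openin_mtopology by blast
  show thesis
  proof (rule that[OF \<delta>(1)])
    fix x assume "x \<in> occ_space \<beta>" "occ_dist x y < \<delta>"
    then have "x \<in> M.mball y \<delta>"
      using y by (simp add: M.in_mball M.commute)
    then have "f x \<in> ball (f y) e"
      using \<delta>(2) by blast
    then show "\<bar>f x - f y\<bar> \<le> e"
      by (simp add: dist_real_def abs_minus_commute)
  qed
qed

lemma pull_limit:
  "(\<forall>\<^sub>F n in inf sequentially (principal (sizes \<beta>)).
      pull_ergodic lam \<beta> \<mu> B n \<and> (\<exists>!\<pi>. pull_stationary lam \<beta> \<mu> B n \<pi>))
   \<and> weakly_converges (occ_top \<beta>) (stationary_law lam \<beta> \<mu> B)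
      (return (occ_borel \<beta>) (x_star lam \<beta> \<mu>)) (inf sequentially (principal (sizes \<beta>)))"
proof
  let ?F = "inf sequentially (principal (sizes \<beta>))"
  interpret M: Metric_space "occ_space \<beta>" occ_dist
    by (rule Metric_space_occ)
  define y where "y = x_star lam \<beta> \<mu>"
  have y: "y \<in> occ_space \<beta>"
    unfolding y_def by (rule x_star_in_occ_space[OF lam \<beta> \<mu> sub])
  obtain \<nu> where eq: "equilibrium lam \<beta> \<mu> \<nu>"
    using equilibrium_ex1[OF lam \<beta> \<mu> sub] by blast
  obtain a where a: "a \<longlonglongrightarrow> 0"
    "\<forall>\<^sub>F n in ?F. near_equilibrium \<nu> n (a n)"
    using eventually_stationary[OF eq] .
  show "\<forall>\<^sub>F n in ?F. pull_ergodic lam \<beta> \<mu> B n \<and> (\<exists>!\<pi>. pull_stationary lam \<beta> \<mu> B n \<pi>)"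
    using a(2) by eventually_elim (simp only: near_equilibrium_def)
  have a_F: "(a \<longlongrightarrow> 0) ?F"
    by (rule tendsto_mono[OF inf_le1 a(1)])
  show "weakly_converges (occ_top \<beta>) (stationary_law lam \<beta> \<mu> B) (return (occ_borel \<beta>) (x_star lam \<beta> \<mu>)) ?F"
    unfolding weakly_converges_def y_def[symmetric]
  proof (intro allI impI)
    fix f :: "'p occ \<Rightarrow> real"
    assume "continuous_map (occ_top \<beta>) euclideanreal f \<and> bounded (f ` topspace (occ_top \<beta>))"
    then have f: "continuous_map (occ_top \<beta>) euclideanreal f" and bd: "bounded (f ` occ_space \<beta>)"
      by auto
    obtain M where M: "\<And>x. x \<in> occ_space \<beta> \<Longrightarrow> \<bar>f x\<bar> \<le> M"
      using bd by (auto simp: bounded_iff)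
    have fm: "f \<in> borel_measurable (occ_borel \<beta>)"
      by (rule borel_measurable_continuous_map_occ[OF f])
    have "(\<integral>x. f x \<partial>return (occ_borel \<beta>) y) = f y"
      using y fm by (intro integral_return) (simp add: occ_borel_def space_measure_of_conv)
    moreover have "((\<lambda>n. \<integral>x. f x \<partial>stationary_law lam \<beta> \<mu> B n) \<longlongrightarrow> f y) ?F"
    proof (rule tendstoI)
      fix e :: real assume e: "e > 0"
      obtain \<delta> where \<delta>: "\<delta> > 0" "\<And>x. x \<in> occ_space \<beta> \<Longrightarrow> occ_dist x y < \<delta> \<Longrightarrow> \<bar>f x - f y\<bar> \<le> e / 2"
        using continuous_map_occ_close[OF f y, of "e / 2"] e by auto
      define c where "c = 2 * real CARD('p) / \<delta>"
      have c: "c \<ge> 0"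
        using \<delta> by (simp add: c_def)
      have M0: "M \<ge> 0"
        using M[OF y] by (rule order_trans[OF abs_ge_zero])
      have "((\<lambda>n. e / 2 + 2 * M * (c\<^sup>2 * a n + c * a n)) \<longlongrightarrow> e / 2 + 2 * M * (c\<^sup>2 * 0 + c * 0)) ?F"
        by (intro tendsto_intros a_F)
      then have "\<forall>\<^sub>F n in ?F. e / 2 + 2 * M * (c\<^sup>2 * a n + c * a n) < e"
        by (rule order_tendstoD(2)) (use e in simp)
      with a(2) show "\<forall>\<^sub>F n in ?F. dist (\<integral>x. f x \<partial>stationary_law lam \<beta> \<mu> B n) (f y) < e"
      proof eventually_elim
        case (elim n)
        then obtain \<pi> where \<pi>: "stationary_law lam \<beta> \<mu> B n = pull.occ_law \<beta> n \<pi>"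
          "(\<integral>q. (\<Sum>j\<in>UNIV. (pull_equilibrium.D \<beta> n \<nu> q j)\<^sup>2) \<partial>measure_pmf \<pi>) \<le> a n"
          "(\<integral>q. real (card (pull.multi \<beta> n q)) \<partial>measure_pmf \<pi>) / real n \<le> a n"
          unfolding near_equilibrium_def by blast
        interpret PE: pull_equilibrium lam \<beta> \<mu> B n \<nu>
          by standard (use lam \<beta> \<mu> B sum_\<beta> elim eq in \<open>auto simp: near_equilibrium_def\<close>)
        have "\<bar>(\<integral>x. f x \<partial>PE.occ_law \<pi>) - f y\<bar> \<le> e / 2 + 2 * M *
          (c\<^sup>2 * (\<integral>q. (\<Sum>j\<in>UNIV. (PE.D q j)\<^sup>2) \<partial>measure_pmf \<pi>) +
           c * ((\<integral>q. real (card (PE.multi q)) \<partial>measure_pmf \<pi>) / real n))"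
          unfolding c_def y_def
          by (rule PE.occ_law_integral_close[OF sub \<delta>(1) _ fm M]) (use \<delta>(2) e in \<open>auto simp: y_def\<close>)
        also have "\<dots> \<le> e / 2 + 2 * M * (c\<^sup>2 * a n + c * a n)"
          using \<pi>(2,3) c M0 by (intro add_left_mono mult_left_mono add_mono) auto
        also have "\<dots> < e"
          using elim by simp
        finally show ?case
          unfolding \<pi>(1) dist_real_def .
      qed
    qed
    ultimately show "((\<lambda>n. \<integral>x. f x \<partial>stationary_law lam \<beta> \<mu> B n) \<longlongrightarrow> (\<integral>x. f x \<partial>return (occ_borel \<beta>) y)) ?F"
      by simp
  qed
qed

end

theorem theorem2:
  fixes lam :: real and \<beta> \<mu> :: "'p::finite \<Rightarrow> real" and B :: "'p \<Rightarrow> enat"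
  assumes "lam > 0" and "\<And>j. \<beta> j > 0" and "\<And>j. \<mu> j > 0" and "\<And>j. B j \<ge> 1"
    and "(\<Sum>j\<in>UNIV. \<beta> j) = 1"
    and "lam < (\<Sum>j\<in>UNIV. \<beta> j * \<mu> j)"
  shows "(\<forall>\<^sub>F n in inf sequentially (principal (sizes \<beta>)).
            pull_ergodic lam \<beta> \<mu> B n \<and> (\<exists>!\<pi>. pull_stationary lam \<beta> \<mu> B n \<pi>))
       \<and> weakly_converges (occ_top \<beta>) (stationary_law lam \<beta> \<mu> B)
            (return (occ_borel \<beta>) (x_star lam \<beta> \<mu>))
            (inf sequentially (principal (sizes \<beta>)))"
  using assms by (rule pull_limit)

end
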